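(* Let $d\ge 1$, $\lambda\in\mathbb{R}\setminus\{0\}$ and $T>0$. Assume that $u_0\in L^2(\mathbb{T}^d)$ and that the solution $u$ of the periodic logarithmic Schrödinger equation $$\mathrm{i}\,\partial_t u+\Delta u=\lambda u\ln|u|^2\ \text{ on } \mathbb{T}^d,\qquad u(\cdot,0)=u_0,$$ has the regularity $$u\in C\big((0,T];\,H^1(\mathbb{T}^d)\cap L^\infty(\mathbb{T}^d)\big).$$ Let $\tau>0$ be the time step, $M=[T/\tau]$, $N$ (a positive integer) the Fourier cut-off, and let $u_N^{m+1}$ be the numerical solution given by the Lie-Trotter time-splitting Fourier spectral scheme $$u_N^{0}=\Pi_N^d u_0,\qquad u_N^{m+1}=\Phi_A^\tau\,\Pi_N^d\,\Phi_B^\tau[u_N^m],\quad m=0,1,\dots,M-1.$$ Then, with $u^{m+1}:=u(\cdot,(m+1)\tau)$, $$\|u^{m+1}-u_N^{m+1}\|\le C\,\mathrm{e}^{2|\lambda|T}\,\big(\mathcal{C}(u_0,u)+\ln N\big)\,\big(\sqrt{\tau}+N^{-1}\big)\,|u|_{C(H^1)},\qquad m=0,1,\dots,M-1,$$ where $C$ is a positive constant independent of $\tau$, $N$ and any function (it may depend on parameters such as $T,d,|\lambda|$), and $$\mathcal{C}(u_0,u):=\ln(\|u_0\|+1)+\ln\big(\|u\|_{C(L^\infty)}+1\big).$$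
   Context: $\mathbb{T}^d=[-\pi,\pi)^d$ is the $d$-dimensional torus with $2\pi$-periodic boundary conditions, $|\mathbb{T}|=2\pi$; functions are complex-valued and $2\pi$-periodic. $\|\cdot\|$ is the $L^2(\mathbb{T}^d)$-norm. For $u\in L^2(\mathbb{T}^d)$ with Fourier coefficients $\hat u_k=|\mathbb{T}|^{-d}\int_{\mathbb{T}^d}u(x)\mathrm{e}^{-\mathrm{i}k\cdot x}\,\mathrm{d}x$, set $\|u\|_{H^1(\mathbb{T}^d)}=|\mathbb{T}|^{d/2}\big(\sum_{k\in\mathbb{Z}^d}(1+|k|^2)|\hat u_k|^2\big)^{1/2}$ and $|u|_{H^1(\mathbb{T}^d)}=|\mathbb{T}|^{d/2}\big(\sum_{k\in\mathbb{Z}^d\setminus\{0\}}|k|^{2}|\hat u_k|^2\big)^{1/2}$; $H^1(\mathbb{T}^d)$ is the space of $u\in L^2(\mathbb{T}^d)$ with finite $\|u\|_{H^1}$. Also $|u|_{C(H^1)}:=\sup_{t\in(0,T]}|u(\cdot,t)|_{H^1(\mathbb{T}^d)}$ and $\|u\|_{C(L^\infty)}:=\sup_{t\in(0,T]}\|u(\cdot,t)\|_{L^\infty(\mathbb{T}^d)}$. The nonlinearity $u\ln|u|^2$ is understood to be $0$ where $u=0$. $\Pi_N^d$ is the $L^2$-orthogonal projection $\Pi_N^d u(x)=\sum_{k\in\mathbb{K}_N^d}\hat u_k\,\mathrm{e}^{\mathrm{i}k\cdot x}$ with $\mathbb{K}_N^d=\{k\in\mathbb{Z}^d:|k_i|\le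 N,\ 1\le i\le d\}$. The flow maps are $\Phi_A^t[v_0]=\mathrm{e}^{\mathrm{i}t\Delta}v_0=\sum_{k\in\mathbb{Z}^d}\mathrm{e}^{-\mathrm{i}|k|^2t}\,\hat v_{0,k}\,\mathrm{e}^{\mathrm{i}k\cdot x}$ and $\Phi_B^t[w_0](x)=\mathrm{e}^{-\mathrm{i}\lambda t\ln|w_0(x)|^2}w_0(x)$, with $\Phi_B^t[w_0](x)=0$ where $w_0(x)=0$. $[T/\tau]$ denotes the integer part. The Fourier coefficients in the scheme are taken to be computed exactly.
   Formalization: The formal theorem takes N ≥ 2 instead of any positive integer N: for N = 1, where ln N = 0, the data u_0 = κe^{2ix} with κ → 0 give a zero numerical solution, and no constant C independent of the functions exists. *)

theory Defs
  imports "HOL-Probability.Essential_Supremum"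
begin

text \<open>
  The dimension is \<open>d = CARD('n)\<close>. Functions on the torus are \<open>2\<pi>\<close>-periodic functions on
  \<open>real ^ 'n\<close>, integrated over the fundamental cell; equality of \<open>L\<^sup>2\<close>-functions is equality almost
  everywhere there.
\<close>

definition torus_cell :: "(real ^ 'n) set" where
  "torus_cell = {x. \<forall>i. - pi \<le> x $ i \<and> x $ i < pi}"

abbreviation torus :: "(real ^ 'n) measure" where
  "torus \<equiv> lebesgue_on torus_cell"

definition periodic :: "(real ^ 'n \<Rightarrow> complex) \<Rightarrow> bool" where
  "periodic f \<longleftrightarrow> (\<forall>x i. f (x + (2 * pi) *\<^sub>R axis i 1) = f x)"

definition in_L2 :: "(real ^ 'n \<Rightarrow> complex) \<Rightarrow> bool" where
  "in_L2 f \<longleftrightarrow> periodic f \<and> f \<in> borel_measurable torus \<and> integrable torus (\<lambda>x. (cmod (f x))\<^sup>2)"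

definition L2_norm :: "(real ^ 'n \<Rightarrow> complex) \<Rightarrow> real" where
  "L2_norm f = sqrt (LINT x|torus. (cmod (f x))\<^sup>2)"

definition Linf_norm :: "(real ^ 'n \<Rightarrow> complex) \<Rightarrow> ereal" where
  "Linf_norm f = esssup torus (\<lambda>x. ereal (cmod (f x)))"

definition freq :: "int ^ 'n \<Rightarrow> real ^ 'n" where
  "freq k = (\<chi> i. real_of_int (k $ i))"

definition fourier :: "(real ^ 'n \<Rightarrow> complex) \<Rightarrow> int ^ 'n \<Rightarrow> complex" where
  "fourier f k = (LINT x|torus. f x * cis (- (freq k \<bullet> x))) / of_real ((2 * pi) ^ CARD('n))"

definition in_H1 :: "(real ^ 'n \<Rightarrow> complex) \<Rightarrow> bool" where
  "in_H1 f \<longleftrightarrow> in_L2 f \<and>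
     (\<lambda>k. (1 + (norm (freq k))\<^sup>2) * (cmod (fourier f k))\<^sup>2) summable_on UNIV"

text \<open>The two quantities below are meaningful for functions satisfying \<^const>\<open>in_H1\<close> only.\<close>

definition H1_norm :: "(real ^ 'n \<Rightarrow> complex) \<Rightarrow> real" where
  "H1_norm f = (2 * pi) powr (real CARD('n) / 2) *
     sqrt (\<Sum>\<^sub>\<infinity>k\<in>UNIV. (1 + (norm (freq k))\<^sup>2) * (cmod (fourier f k))\<^sup>2)"

definition H1_seminorm :: "(real ^ 'n \<Rightarrow> complex) \<Rightarrow> real" where
  "H1_seminorm f = (2 * pi) powr (real CARD('n) / 2) *
     sqrt (\<Sum>\<^sub>\<infinity>k\<in>UNIV - {0}. (norm (freq k))\<^sup>2 * (cmod (fourier f k))\<^sup>2)"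

text \<open>
  \<open>C((0,T]; H\<^sup>1 \<inter> L\<^sup>\<infinity>)\<close>: continuity in both norms. As the interval is open at \<open>0\<close>, the two suprema
  over \<open>(0,T]\<close> may be infinite, so they are extended reals.
\<close>

definition regular_solution :: "real \<Rightarrow> (real \<Rightarrow> real ^ 'n \<Rightarrow> complex) \<Rightarrow> bool" where
  "regular_solution T u \<longleftrightarrow>
     (\<forall>t\<in>{0<..T}. in_H1 (u t) \<and> Linf_norm (u t) < \<infinity>) \<and>
     (\<forall>t\<in>{0<..T}. ((\<lambda>s. H1_norm (\<lambda>x. u s x - u t x)) \<longlongrightarrow> 0) (at t within {0<..T}) \<and>
                  ((\<lambda>s. Linf_norm (\<lambda>x. u s x - u t x)) \<longlongrightarrow> 0) (at t within {0<..T}))"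

definition C_H1_seminorm :: "real \<Rightarrow> (real \<Rightarrow> real ^ 'n \<Rightarrow> complex) \<Rightarrow> ereal" where
  "C_H1_seminorm T u = (SUP t\<in>{0<..T}. ereal (H1_seminorm (u t)))"

definition C_Linf_norm :: "real \<Rightarrow> (real \<Rightarrow> real ^ 'n \<Rightarrow> complex) \<Rightarrow> ereal" where
  "C_Linf_norm T u = (SUP t\<in>{0<..T}. Linf_norm (u t))"

definition ln_ereal :: "ereal \<Rightarrow> ereal" where
  "ln_ereal x = (if x = \<infinity> then \<infinity> else ereal (ln (real_of_ereal x)))"

definition log_factor ::
    "real \<Rightarrow> (real ^ 'n \<Rightarrow> complex) \<Rightarrow> (real \<Rightarrow> real ^ 'n \<Rightarrow> complex) \<Rightarrow> ereal" where
  "log_factor T u0 u = ereal (ln (L2_norm u0 + 1)) + ln_ereal (C_Linf_norm T u + 1)"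

definition log_nonlinearity :: "complex \<Rightarrow> complex" where
  "log_nonlinearity z = (if z = 0 then 0 else z * of_real (ln ((cmod z)\<^sup>2)))"

definition partial :: "'n \<Rightarrow> (real ^ 'n \<Rightarrow> complex) \<Rightarrow> real ^ 'n \<Rightarrow> complex" where
  "partial j f x = vector_derivative (\<lambda>s. f (x + s *\<^sub>R axis j 1)) (at 0)"

definition laplacian :: "(real ^ 'n \<Rightarrow> complex) \<Rightarrow> real ^ 'n \<Rightarrow> complex" where
  "laplacian f x = (\<Sum>j\<in>UNIV. partial j (partial j f) x)"

text \<open>
  \<open>C\<^sup>\<infinity>\<close> periodic functions: every iterated partial derivative exists and is differentiable, hence
  continuous.
\<close>

definition test_function :: "(real ^ 'n \<Rightarrow> complex) \<Rightarrow> bool" where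
  "test_function \<phi> \<longleftrightarrow> periodic \<phi> \<and> (\<forall>js. foldr partial js \<phi> differentiable_on UNIV)"

text \<open>
  Solutions are in \<open>C([0,T]; L\<^sup>2)\<close>, attain the initial value in that space, and satisfy
  \<open>\<i> \<partial>\<^sub>t u + \<Delta> u = \<lambda> u ln |u|\<^sup>2\<close> in the sense of distributions on the torus. For such \<open>u\<close> the
  nonlinearity is continuous in time with values in \<open>L\<^sup>1\<close>, so that the distributional time derivative
  of the pairing with a test function is a classical one.
\<close>

definition log_schroedinger_solution ::
    "real \<Rightarrow> real \<Rightarrow> (real ^ 'n \<Rightarrow> complex) \<Rightarrow> (real \<Rightarrow> real ^ 'n \<Rightarrow> complex) \<Rightarrow> bool" where
  "log_schroedinger_solution lam T u0 u \<longleftrightarrow>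
     (\<forall>t\<in>{0..T}. in_L2 (u t) \<and>
        ((\<lambda>s. L2_norm (\<lambda>x. u s x - u t x)) \<longlongrightarrow> 0) (at t within {0..T})) \<and>
     (AE x in torus. u 0 x = u0 x) \<and>
     (\<forall>\<phi>. test_function \<phi> \<longrightarrow> (\<forall>t\<in>{0<..<T}. \<exists>D.
        ((\<lambda>s. LINT x|torus. u s x * \<phi> x) has_vector_derivative D) (at t) \<and>
        \<i> * D + (LINT x|torus. u t x * laplacian \<phi> x) =
          of_real lam * (LINT x|torus. log_nonlinearity (u t x) * \<phi> x)))"

definition freq_box :: "nat \<Rightarrow> (int ^ 'n) set" where
  "freq_box N = {k. \<forall>i. \<bar>k $ i\<bar> \<le> int N}"

definition fourier_proj :: "nat \<Rightarrow> (real ^ 'n \<Rightarrow> complex) \<Rightarrow> real ^ 'n \<Rightarrow> complex" where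
  "fourier_proj N f x = (\<Sum>k\<in>freq_box N. fourier f k * cis (freq k \<bullet> x))"

text \<open>
  The series is taken pointwise; in the scheme it is only applied to trigonometric polynomials,
  for which all but finitely many terms vanish.
\<close>

definition flow_A :: "real \<Rightarrow> (real ^ 'n \<Rightarrow> complex) \<Rightarrow> real ^ 'n \<Rightarrow> complex" where
  "flow_A t v x =
     (\<Sum>\<^sub>\<infinity>k\<in>UNIV. cis (- ((norm (freq k))\<^sup>2 * t)) * fourier v k * cis (freq k \<bullet> x))"

definition flow_B :: "real \<Rightarrow> real \<Rightarrow> (real ^ 'n \<Rightarrow> complex) \<Rightarrow> real ^ 'n \<Rightarrow> complex" where
  "flow_B lam t w x =
     (if w x = 0 then 0 else cis (- (lam * t * ln ((cmod (w x))\<^sup>2))) * w x)"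

primrec lie_trotter ::
    "real \<Rightarrow> real \<Rightarrow> nat \<Rightarrow> (real ^ 'n \<Rightarrow> complex) \<Rightarrow> nat \<Rightarrow> real ^ 'n \<Rightarrow> complex" where
  "lie_trotter lam tau N u0 0 = fourier_proj N u0"
| "lie_trotter lam tau N u0 (Suc m) =
     flow_A tau (fourier_proj N (flow_B lam tau (lie_trotter lam tau N u0 m)))"

text \<open>
  The error estimate for this scheme is stated for \<open>N \<ge> 2\<close>. With \<open>N = 1\<close>, where \<open>ln N = 0\<close>, no constant
  independent of the data exists: for \<open>d = 1\<close> and \<open>u\<^sub>0 = \<kappa> e\<^sup>2\<^sup>i\<^sup>x\<close> the solution is the plane wave
  \<open>u = \<kappa> exp (\<i> (2x - (4 + \<lambda> ln \<kappa>\<^sup>2) t))\<close> and the numerical solution vanishes, so that the error is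
  \<open>(2\<pi>)\<^sup>1\<^sup>/\<^sup>2 \<kappa>\<close>, whereas \<^const>\<open>log_factor\<close> tends to \<open>0\<close> as \<open>\<kappa> \<rightarrow> 0\<close> and the \<open>H\<^sup>1\<close>-seminorm
  is \<open>2 (2\<pi>)\<^sup>1\<^sup>/\<^sup>2 \<kappa>\<close>.
\<close>

end

theory Submission
  imports Defs
begin

text \<open>
  Write \<open>f z = z ln |z|\<^sup>2\<close>, let \<open>\<Pi>\<close> be the projection onto the trigonometric polynomials with frequencies in the
  box, \<open>E s = exp (\<i> s \<Delta>)\<close>, and let \<open>K\<close> bound the \<open>H\<^sup>1\<close>-seminorm of the solution. The error is controlled by an
  energy inequality in continuous time. On the time step starting at \<open>t\<close> with numerical solution \<open>w\<close> put
  \<open>b = \<Phi>\<^sub>B\<^sup>s[w]\<close>, \<open>v = \<Pi> b\<close> and \<open>c = E s v\<close>; at \<open>s = 0\<close> this \<open>c\<close> is \<open>w\<close>, and at the end of the step it is the next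
  iterate. With \<open>a = u(t + s)\<close> and the trigonometric polynomial \<open>H = \<Pi> a - c\<close>, the equation gives
  \<open>d/ds \<parallel>H\<parallel>\<^sup>2 = 2 \<lambda> Im (\<langle>f a, H\<rangle> - \<langle>f b, E(-s) H\<rangle>)\<close>, and the bracket is the sum of
  \<open>\<langle>f(\<Pi> a) - f c, H\<rangle>\<close>, the projection defects \<open>\<langle>f a - f(\<Pi> a), H\<rangle>\<close> and \<open>\<langle>f v - f b, E(-s) H\<rangle>\<close>, and the
  commutator \<open>\<langle>f c, H\<rangle> - \<langle>f v, E(-s) H\<rangle>\<close>. As \<open>\<Pi> a - c = H\<close>, the imaginary part of the first is at most
  \<open>2 \<parallel>H\<parallel>\<^sup>2\<close> by the well-known monotonicity of \<open>f\<close> (\<open>log_nonlinearity_monotone\<close>). The others are at most a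
  constant times \<open>ln N (\<surd>\<tau> + 1/N) K \<parallel>H\<parallel>\<close> (\<open>energy_rate_le\<close>), so that Gronwall's inequality, chained over the
  steps, yields the rate.

  The difficulty is that \<open>f\<close> is only log-Lipschitz: \<open>|f p - f q| \<le> 2 |p - q| (1 + |ln max(|p|,|q|)\<^sup>2|)\<close> up to
  constants, and the logarithm is unbounded at small and at large values. Three observations control it by
  \<open>ln N\<close> (\<open>gauged_difference_pairing_le\<close>).

  \<^item> The defects and the commutator do not change when a real multiple of the identity is added to \<open>f\<close>. Hence
    \<open>f\<close> may be replaced by \<open>z ln (|z|/\<kappa>)\<^sup>2\<close> with any scale \<open>\<kappa> > 0\<close>; the choice is \<open>\<kappa> = |M| + K\<close>, where \<open>M\<close> is the mean
    of \<open>p\<close>.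
  \<^item> Where \<open>|p|\<close> is below \<open>\<kappa>/4\<close> one has \<open>\<kappa> \<le> 2 (|p - M| + K)\<close>, and the right-hand side has \<open>L\<^sup>2\<close>-norm of order \<open>K\<close> by
    Poincare's inequality. So small values cost only \<open>K/N\<close> once \<open>ln (4N)\<close> is split off from the logarithm.
  \<^item> Everything is tested against a trigonometric polynomial, whose maximum is at most of order \<open>N\<^sup>d\<close> times its
    \<open>L\<^sup>2\<close>-norm. So large values are harmless once \<open>ln (N\<^sup>d)\<close> is split off.

  In the commutator the factor \<open>E s - 1\<close> is of size \<open>\<surd>(2s) |k|\<close> at frequency \<open>k\<close>. Since \<open>|k\<^sub>j| \<le> N\<close>, the factor
  \<open>k\<^sub>j\<close> can be traded for \<open>N\<close> times the difference between a function and its translate by \<open>1/N\<close>, and \<open>f\<close> of a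
  translate minus \<open>f\<close> is again a difference of the kind treated above (\<open>schroedinger_commutator_le\<close>).

  The same use of translations gives the \<open>H\<^sup>1\<close>-stability of the scheme: \<open>\<Phi>\<^sub>B\<^sup>s\<close> is Lipschitz with constant
  \<open>1 + 2 |\<lambda>| s\<close>, although its derivative is singular at \<open>0\<close>. The Fourier analysis rests on the translation
  invariance of integrals of periodic functions, which yields orthogonality, and on the Stone-Weierstrass theorem,
  which yields completeness.
\<close>

section \<open>The fundamental cell and integrals of periodic functions\<close>

definition cell_lo :: "real ^ 'n" where "cell_lo = (\<chi> i. - pi)"
definition cell_hi :: "real ^ 'n" where "cell_hi = (\<chi> i. pi)"

lemma box_subset_torus_cell: "box cell_lo cell_hi \<subseteq> (torus_cell :: (real^'n) set)"
  by (auto simp: torus_cell_def cell_lo_def cell_hi_def mem_box_cart less_imp_le)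

lemma torus_cell_subset_cbox: "(torus_cell :: (real^'n) set) \<subseteq> cbox cell_lo cell_hi"
  by (auto simp: torus_cell_def cell_lo_def cell_hi_def mem_box_cart less_imp_le)

lemma negligible_cbox_minus_torus_cell:
  "negligible (cbox cell_lo cell_hi - (torus_cell :: (real^'n) set))"
  by (rule negligible_subset[OF negligible_frontier_interval[of cell_lo cell_hi]])
     (use box_subset_torus_cell in auto)

lemma torus_cell_lmeasurable: "(torus_cell :: (real^'n) set) \<in> lmeasurable"
proof -
  have "torus_cell = cbox cell_lo cell_hi - (cbox cell_lo cell_hi - (torus_cell :: (real^'n) set))"
    using torus_cell_subset_cbox by auto
  then show ?thesis
    using negligible_cbox_minus_torus_cell
    by (metis fmeasurable.Diff lmeasurable_cbox negligible_iff_measure)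
qed

lemma torus_cell_sets: "(torus_cell :: (real^'n) set) \<in> sets lebesgue"
  using torus_cell_lmeasurable by (rule fmeasurableD)

lemma finite_measure_torus: "finite_measure (torus :: (real^'n) measure)"
  by (rule finite_measure_lebesgue_on[OF torus_cell_lmeasurable])

lemma measure_torus_cell: "measure lebesgue (torus_cell :: (real^'n) set) = (2 * pi) ^ CARD('n)"
proof -
  have "measure lebesgue (torus_cell :: (real^'n) set) = measure lebesgue (cbox cell_lo (cell_hi :: real^'n))"
    by (rule measure_negligible_symdiff[OF lmeasurable_cbox])
       (rule negligible_subset[OF negligible_cbox_minus_torus_cell],
         use torus_cell_subset_cbox in auto)
  also have "\<dots> = (\<Prod>i\<in>(UNIV::'n set). cell_hi $ i - cell_lo $ i)"
    using content_cbox_cart[of "cell_lo :: real^'n" cell_hi]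
    by (simp add: cell_hi_def cell_lo_def interval_ne_empty_cart)
  finally show ?thesis by (simp add: cell_hi_def cell_lo_def)
qed

lemma integral_torus_const: "(LINT x|(torus :: (real^'n) measure). c) = (2 * pi) ^ CARD('n) *\<^sub>R (c :: 'b :: {banach, second_countable_topology})"
  using torus_cell_lmeasurable[where 'n = 'n] measure_torus_cell[where 'n = 'n]
  by (simp add: measure_restrict_space torus_cell_sets)

lemma continuous_integrable_torus:
  fixes g :: "real ^ 'n \<Rightarrow> 'b :: euclidean_space"
  assumes "continuous_on UNIV g"
  shows "integrable torus g"
proof -
  have "set_integrable lebesgue (cbox cell_lo (cell_hi :: real^'n)) g"
    by (intro absolutely_integrable_continuous continuous_on_subset[OF assms]) auto
  then have "set_integrable lebesgue torus_cell g"
    by (rule set_integrable_subset[OF _ torus_cell_sets torus_cell_subset_cbox])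
  then show ?thesis
    by (simp add: integrable_restrict_space set_integrable_def torus_cell_sets)
qed

lemma integral_torus_eq_cbox:
  fixes g :: "real ^ 'n \<Rightarrow> 'b :: euclidean_space"
  assumes "continuous_on UNIV g"
  shows "(LINT x|torus. g x) = integral (cbox cell_lo cell_hi) g"
proof -
  have "(LINT x|torus. g x) = integral torus_cell g"
    by (intro lebesgue_integral_eq_integral continuous_integrable_torus assms torus_cell_sets)
  also have "\<dots> = integral (cbox cell_lo cell_hi) g"
    by (rule integral_subset_negligible[OF torus_cell_subset_cbox negligible_cbox_minus_torus_cell])
  finally show ?thesis .
qed

text \<open>
  The fundamental cell with its \<open>j\<close>-th edge replaced by \<open>[l, r]\<close>: cutting the cell across the \<open>j\<close>-th axis and
  shifting along it stay within this family.
\<close>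

definition slab :: "'n \<Rightarrow> real \<Rightarrow> real \<Rightarrow> (real ^ 'n) set" where
  "slab j l r = cbox (\<chi> i. if i = j then l else - pi) (\<chi> i. if i = j then r else pi)"

lemma cell_eq_slab: "cbox cell_lo cell_hi = slab j (- pi) pi"
  unfolding slab_def cell_lo_def cell_hi_def by (rule arg_cong2[where f = cbox]) (auto simp: vec_eq_iff)

lemma integral_slab_shift:
  fixes g :: "real ^ 'n \<Rightarrow> complex"
  shows "integral (slab j l r) (\<lambda>x. g (x + h *\<^sub>R axis j 1)) = integral (slab j (l + h) (r + h)) g"
proof -
  have "slab j (l + h) (r + h) = cbox ((\<chi> i. if i = j then l else - pi) + h *\<^sub>R axis j 1)
      ((\<chi> i. if i = j then r else pi) + h *\<^sub>R axis j 1)"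
    unfolding slab_def by (rule arg_cong2[where f = cbox]) (auto simp: vec_eq_iff axis_def)
  then show ?thesis
    using integral_shift_cbox_plus[of _ _ g "h *\<^sub>R axis j 1"]
    by (simp add: slab_def o_def add.commute)
qed

lemma integral_slab_split:
  fixes g :: "real ^ 'n \<Rightarrow> complex"
  assumes "continuous_on UNIV g" "l \<le> c" "c \<le> r"
  shows "integral (slab j l r) g = integral (slab j l c) g + integral (slab j c r) g"
proof -
  have "g integrable_on slab j l r"
    unfolding slab_def by (rule integrable_continuous) (rule continuous_on_subset[OF assms(1)], simp)
  then have "integral (slab j l r) g = integral (slab j l r \<inter> {x. x \<bullet> axis j 1 \<le> c}) g
      + integral (slab j l r \<inter> {x. x \<bullet> axis j 1 \<ge> c}) g"
    unfolding slab_def by (rule integral_split) (simp add: axis_in_Basis_iff)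
  moreover have "slab j l r \<inter> {x. x \<bullet> axis j 1 \<le> c} = slab j l c"
    using assms(2,3) unfolding slab_def set_eq_iff Int_iff mem_box_cart
    by (auto simp: inner_axis; metis order_trans)
  moreover have "slab j l r \<inter> {x. x \<bullet> axis j 1 \<ge> c} = slab j c r"
    using assms(2,3) unfolding slab_def set_eq_iff Int_iff mem_box_cart
    by (auto simp: inner_axis; metis order_trans)
  ultimately show ?thesis by simp
qed

text \<open>
  The part of the shifted cell that sticks out on one side is a translate by the period of the part that is
  missing on the other side.
\<close>

lemma periodic_integral_translate:
  fixes g :: "real ^ 'n \<Rightarrow> complex"
  assumes cont: "continuous_on UNIV g" and per: "periodic g" and h: "0 \<le> h" "h \<le> 2 * pi"
  shows "(LINT x|torus. g (x + h *\<^sub>R axis j 1)) = (LINT x|torus. g x)"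
proof -
  have "(LINT x|torus. g (x + h *\<^sub>R axis j 1))
      = integral (slab j (- pi) pi) (\<lambda>x. g (x + h *\<^sub>R axis j 1))"
    unfolding cell_eq_slab[symmetric]
    by (rule integral_torus_eq_cbox) (intro continuous_intros continuous_on_compose2[OF cont], auto)
  also have "\<dots> = integral (slab j (- pi + h) (pi + h)) g"
    by (rule integral_slab_shift)
  also have "\<dots> = integral (slab j (- pi + h) pi) g + integral (slab j pi (pi + h)) g"
    using h by (intro integral_slab_split cont) auto
  also have "slab j pi (pi + h) = slab j (- pi + 2 * pi) (- pi + h + 2 * pi)"
    by (simp add: algebra_simps)
  also have "integral \<dots> g = integral (slab j (- pi) (- pi + h)) g"
    using per by (subst integral_slab_shift[symmetric]) (simp add: periodic_def)
  also have "integral (slab j (- pi + h) pi) g + integral (slab j (- pi) (- pi + h)) g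
      = integral (slab j (- pi) pi) g"
    using h by (subst integral_slab_split[OF cont, of "- pi" "- pi + h" pi]) auto
  also have "\<dots> = (LINT x|torus. g x)"
    unfolding cell_eq_slab[symmetric] by (rule integral_torus_eq_cbox[OF cont, symmetric])
  finally show ?thesis .
qed

section \<open>Square-integrable functions and trigonometric polynomials\<close>

definition square_integrable :: "(real ^ 'n \<Rightarrow> complex) \<Rightarrow> bool" where
  "square_integrable f \<longleftrightarrow> f \<in> borel_measurable torus \<and> integrable torus (\<lambda>x. (cmod (f x))\<^sup>2)"

lemma square_integrableD:
  assumes "square_integrable f"
  shows "f \<in> borel_measurable torus" "integrable torus (\<lambda>x. (cmod (f x))\<^sup>2)"
  using assms by (auto simp: square_integrable_def)

lemma in_L2_square_integrable: "in_L2 f \<Longrightarrow> square_integrable f"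
  by (simp add: in_L2_def square_integrable_def)

lemma integrable_torus_const: "integrable torus (\<lambda>x. c :: 'b :: {banach, second_countable_topology})"
  by (rule finite_measure.integrable_const[OF finite_measure_torus])

lemma integrable_torus_bounded:
  fixes f :: "real ^ 'n \<Rightarrow> 'b :: {banach, second_countable_topology}"
  assumes "f \<in> borel_measurable torus" "AE x in torus. norm (f x) \<le> C"
  shows "integrable torus f"
  by (rule Bochner_Integration.integrable_bound[OF integrable_torus_const[of C] assms(1)])
     (use assms(2) in auto)

lemma square_integrable_bounded:
  assumes "f \<in> borel_measurable torus" "AE x in torus. cmod (f x) \<le> C"
  shows "square_integrable f"
proof -
  have "AE x in torus. norm ((cmod (f x))\<^sup>2) \<le> C\<^sup>2"
    using assms(2) by eventually_elim (simp add: power_mono)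
  then show ?thesis
    unfolding square_integrable_def using assms(1)
    by (auto intro!: integrable_torus_bounded[where C = "C\<^sup>2"])
qed

lemma square_integrable_mult_integrable:
  assumes "square_integrable f" "square_integrable g"
  shows "integrable torus (\<lambda>x. cmod (f x) * cmod (g x))"
proof (rule Bochner_Integration.integrable_bound)
  show "integrable torus (\<lambda>x. (cmod (f x))\<^sup>2 + (cmod (g x))\<^sup>2)"
    by (intro Bochner_Integration.integrable_add square_integrableD(2) assms)
  show "(\<lambda>x. cmod (f x) * cmod (g x)) \<in> borel_measurable torus"
    by (intro borel_measurable_times borel_measurable_norm[THEN measurable_compose[rotated]] square_integrableD(1) assms)
  have "a * b \<le> a\<^sup>2 + b\<^sup>2" if "a \<ge> 0" "b \<ge> 0" for a b :: real
    using sum_squares_bound[of a b] mult_nonneg_nonneg[OF that] by linarith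
  then show "AE x in torus. norm (cmod (f x) * cmod (g x)) \<le> norm ((cmod (f x))\<^sup>2 + (cmod (g x))\<^sup>2)"
    by auto
qed

lemma square_integrable_imp_integrable:
  assumes "square_integrable f"
  shows "integrable torus f"
proof -
  have "square_integrable (\<lambda>x :: real ^ 'a. 1)"
    by (rule square_integrable_bounded[where C = 1]) auto
  from square_integrable_mult_integrable[OF assms this]
  have "integrable torus (\<lambda>x. cmod (f x))" by simp
  then show ?thesis
    by (subst (asm) integrable_norm_iff[OF square_integrableD(1)[OF assms]])
qed

lemma square_integrable_add:
  assumes "square_integrable f" "square_integrable g"
  shows "square_integrable (\<lambda>x. f x + g x)"
  unfolding square_integrable_def
proof
  show meas: "(\<lambda>x. f x + g x) \<in> borel_measurable torus"
    by (intro borel_measurable_add square_integrableD(1) assms)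
  show "integrable torus (\<lambda>x. (cmod (f x + g x))\<^sup>2)"
  proof (rule Bochner_Integration.integrable_bound)
    show "integrable torus (\<lambda>x. 2 * (cmod (f x))\<^sup>2 + 2 * (cmod (g x))\<^sup>2)"
      by (intro Bochner_Integration.integrable_add Bochner_Integration.integrable_mult_right square_integrableD(2) assms)
    have "(cmod (a + b))\<^sup>2 \<le> 2 * (cmod a)\<^sup>2 + 2 * (cmod b)\<^sup>2" for a b
    proof -
      have "(cmod (a + b))\<^sup>2 \<le> (cmod a + cmod b)\<^sup>2"
        by (simp add: power_mono norm_triangle_ineq)
      also have "\<dots> \<le> 2 * (cmod a)\<^sup>2 + 2 * (cmod b)\<^sup>2"
        using sum_squares_bound[of "cmod a" "cmod b"] by (simp add: power2_sum)
      finally show ?thesis .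
    qed
    then show "AE x in torus. norm ((cmod (f x + g x))\<^sup>2) \<le> norm (2 * (cmod (f x))\<^sup>2 + 2 * (cmod (g x))\<^sup>2)"
      by auto
  qed (use meas in measurable)
qed

lemma square_integrable_scale:
  assumes "square_integrable f"
  shows "square_integrable (\<lambda>x. c * f x)"
  unfolding square_integrable_def norm_mult power_mult_distrib
  by (intro conjI borel_measurable_times borel_measurable_const Bochner_Integration.integrable_mult_right
      square_integrableD assms)

lemma square_integrable_diff:
  assumes "square_integrable f" "square_integrable g"
  shows "square_integrable (\<lambda>x. f x - g x)"
  using square_integrable_add[OF assms(1) square_integrable_scale[OF assms(2), of "-1"]] by simp

lemma square_integrable_continuous:
  assumes "continuous_on UNIV f"
  shows "square_integrable f"
  unfolding square_integrable_def
  by (intro conjI borel_measurable_integrable continuous_integrable_torus continuous_intros assms)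

lemma continuous_measurable_torus:
  "continuous_on UNIV f \<Longrightarrow> f \<in> borel_measurable torus" for f :: "real ^ 'n \<Rightarrow> complex"
  by (rule borel_measurable_integrable[OF continuous_integrable_torus])

lemma L2_norm_nonneg [simp]: "L2_norm f \<ge> 0"
  by (simp add: L2_norm_def)

lemma L2_norm_power2: "(L2_norm f)\<^sup>2 = (LINT x|torus. (cmod (f x))\<^sup>2)"
  by (simp add: L2_norm_def)

text \<open>
  If \<open>g\<close> is not square-integrable, its norm is \<open>0\<close> by the convention for the Lebesgue integral.
\<close>

lemma L2_norm_mono:
  assumes "square_integrable f" "\<And>x. cmod (g x) \<le> cmod (f x)"
  shows "L2_norm g \<le> L2_norm f"
  unfolding L2_norm_def
  by (intro real_sqrt_le_mono integral_mono') (use assms square_integrableD(2)[OF assms(1)] in \<open>auto simp: power_mono\<close>)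

lemma L2_norm_scale: "L2_norm (\<lambda>x. c * f x) = cmod c * L2_norm f"
  by (simp add: L2_norm_def norm_mult power_mult_distrib real_sqrt_mult)

lemma L2_norm_minus_commute: "L2_norm (\<lambda>x. f x - g x) = L2_norm (\<lambda>x. g x - f x)"
  by (simp add: L2_norm_def norm_minus_commute)

lemma L2_norm_const: "L2_norm (\<lambda>x :: real ^ 'n. c) = sqrt ((2 * pi) ^ CARD('n)) * cmod c"
  by (simp add: L2_norm_def integral_torus_const real_sqrt_mult measure_restrict_space torus_cell_sets measure_torus_cell)

lemma L2_Cauchy_Schwarz:
  assumes f: "square_integrable f" and g: "square_integrable g"
  shows "(LINT x|torus. cmod (f x) * cmod (g x)) \<le> L2_norm f * L2_norm g"
proof -
  let ?P = "LINT x|torus. cmod (f x) * cmod (g x)"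
  have P: "?P \<ge> 0" by simp
  note [measurable] = square_integrableD(1)[OF f] square_integrableD(1)[OF g]
  have "(\<integral>\<^sup>+x. ennreal (cmod (f x)) * ennreal (cmod (g x)) \<partial>torus)\<^sup>2
      \<le> (\<integral>\<^sup>+x. ennreal (cmod (f x)) ^ 2 \<partial>torus) * (\<integral>\<^sup>+x. ennreal (cmod (g x)) ^ 2 \<partial>torus)"
    by (rule Cauchy_Schwarz_nn_integral) measurable
  also have "(\<integral>\<^sup>+x. ennreal (cmod (f x)) * ennreal (cmod (g x)) \<partial>torus) = ennreal ?P"
    by (simp add: nn_integral_eq_integral[symmetric] ennreal_mult square_integrable_mult_integrable[OF f g])
  also have "(\<integral>\<^sup>+x. ennreal (cmod (f x)) ^ 2 \<partial>torus) = ennreal ((L2_norm f)\<^sup>2)"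
    by (simp add: nn_integral_eq_integral[symmetric] ennreal_power L2_norm_power2 square_integrableD[OF f])
  also have "(\<integral>\<^sup>+x. ennreal (cmod (g x)) ^ 2 \<partial>torus) = ennreal ((L2_norm g)\<^sup>2)"
    by (simp add: nn_integral_eq_integral[symmetric] ennreal_power L2_norm_power2 square_integrableD[OF g])
  finally have "ennreal (?P\<^sup>2) \<le> ennreal ((L2_norm f * L2_norm g)\<^sup>2)"
    using P by (simp add: ennreal_power ennreal_mult[symmetric] power_mult_distrib)
  then have "?P\<^sup>2 \<le> (L2_norm f * L2_norm g)\<^sup>2" by (subst (asm) ennreal_le_iff) auto
  then show ?thesis by (rule power2_le_imp_le) simp
qed

lemma L2_norm_triangle:
  assumes f: "square_integrable f" and g: "square_integrable g"
  shows "L2_norm (\<lambda>x. f x + g x) \<le> L2_norm f + L2_norm g"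
proof (rule power2_le_imp_le)
  have "(L2_norm (\<lambda>x. f x + g x))\<^sup>2 \<le> (LINT x|torus. (cmod (f x))\<^sup>2 + (cmod (g x))\<^sup>2 + 2 * (cmod (f x) * cmod (g x)))"
    unfolding L2_norm_power2
  proof (rule integral_mono)
    fix x
    have "(cmod (f x + g x))\<^sup>2 \<le> (cmod (f x) + cmod (g x))\<^sup>2"
      by (simp add: power_mono norm_triangle_ineq)
    then show "(cmod (f x + g x))\<^sup>2 \<le> (cmod (f x))\<^sup>2 + (cmod (g x))\<^sup>2 + 2 * (cmod (f x) * cmod (g x))"
      by (simp add: power2_sum)
  qed (use square_integrableD[OF square_integrable_add[OF f g]] square_integrableD[OF f] square_integrableD[OF g]
        square_integrable_mult_integrable[OF f g] in auto)
  also have "\<dots> = (L2_norm f)\<^sup>2 + (L2_norm g)\<^sup>2 + 2 * (LINT x|torus. cmod (f x) * cmod (g x))"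
    using square_integrableD[OF f] square_integrableD[OF g] square_integrable_mult_integrable[OF f g]
    by (simp add: L2_norm_power2)
  also have "\<dots> \<le> (L2_norm f + L2_norm g)\<^sup>2"
    using L2_Cauchy_Schwarz[OF f g] by (simp add: power2_sum)
  finally show "(L2_norm (\<lambda>x. f x + g x))\<^sup>2 \<le> (L2_norm f + L2_norm g)\<^sup>2" .
qed simp

lemma L2_norm_triangle_sub:
  assumes "square_integrable f" "square_integrable g"
  shows "L2_norm f \<le> L2_norm (\<lambda>x. f x - g x) + L2_norm g"
  using L2_norm_triangle[OF square_integrable_diff[OF assms] assms(2)] by simp

definition trig_poly :: "nat \<Rightarrow> (int ^ 'n \<Rightarrow> complex) \<Rightarrow> real ^ 'n \<Rightarrow> complex" where
  "trig_poly N c x = (\<Sum>k\<in>freq_box N. c k * cis (freq k \<bullet> x))"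

text \<open>
  The part of the square of the \<open>H\<^sup>1\<close>-seminorm of a function with Fourier coefficients \<open>c\<close>
  that comes from the frequencies in \<open>F\<close>.
\<close>

abbreviation H1_sum :: "(int ^ 'n) set \<Rightarrow> (int ^ 'n \<Rightarrow> complex) \<Rightarrow> real" where
  "H1_sum F c \<equiv> (2 * pi) ^ CARD('n) * (\<Sum>k\<in>F. (norm (freq k))\<^sup>2 * (cmod (c k))\<^sup>2)"

lemma freq_box_eq_image:
  "(freq_box N :: (int ^ 'n) set) = vec_lambda ` (PiE UNIV (\<lambda>_. {- int N..int N}))"
proof -
  have *: "\<bar>a\<bar> \<le> int N \<longleftrightarrow> a \<in> {- int N..int N}" for a by auto
  show ?thesis
    unfolding freq_box_def *
  proof (intro set_eqI iffI)
    fix k :: "int ^ 'n" assume "k \<in> {k. \<forall>i. k $ i \<in> {- int N..int N}}"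
    then have "vec_nth k \<in> PiE UNIV (\<lambda>_. {- int N..int N})" by (simp add: PiE_iff)
    moreover have "k = vec_lambda (vec_nth k)" by (simp add: vec_nth_inverse)
    ultimately show "k \<in> vec_lambda ` (PiE UNIV (\<lambda>_. {- int N..int N}))" by blast
  qed (auto simp: PiE_iff)
qed

lemma finite_freq_box [simp]: "finite (freq_box N :: (int ^ 'n) set)"
  unfolding freq_box_eq_image by (intro finite_imageI finite_PiE) auto

lemma card_freq_box: "card (freq_box N :: (int ^ 'n) set) = (2 * N + 1) ^ CARD('n)"
  unfolding freq_box_eq_image
  by (subst card_image) (auto simp: inj_on_def vec_lambda_inject card_PiE nat_add_distrib nat_mult_distrib)

lemma finite_subset_freq_box:
  assumes "finite F"
  shows "\<exists>N. F \<subseteq> (freq_box N :: (int ^ 'n) set)"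
  using assms
proof induction
  case (insert k F)
  then obtain N where N: "F \<subseteq> freq_box N" by blast
  define N' where "N' = max N (nat (Max (range (\<lambda>i. \<bar>k $ i\<bar>))))"
  have "\<bar>k $ i\<bar> \<le> int N'" for i
  proof -
    have "\<bar>k $ i\<bar> \<le> Max (range (\<lambda>i. \<bar>k $ i\<bar>))" by (rule Max_ge) auto
    then show ?thesis unfolding N'_def by linarith
  qed
  moreover have "freq_box N \<subseteq> (freq_box N' :: (int ^ 'n) set)"
    by (auto simp: freq_box_def N'_def intro: order_trans)
  ultimately show ?case using N by (intro exI[of _ N']) (auto simp: freq_box_def)
qed simp

lemma freq_box_mono: "N \<le> M \<Longrightarrow> freq_box N \<subseteq> freq_box M"
  by (auto simp: freq_box_def intro: order_trans)

lemma fourier_proj_eq_trig_poly: "fourier_proj N f = trig_poly N (fourier f)"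
  by (simp add: fun_eq_iff fourier_proj_def trig_poly_def)

lemma continuous_trig_poly [continuous_intros]: "continuous_on S (trig_poly N c)"
  unfolding trig_poly_def by (intro continuous_intros)

lemma square_integrable_trig_poly [simp]: "square_integrable (trig_poly N c)"
  by (intro square_integrable_continuous continuous_intros)

lemma periodic_cis_freq: "periodic (\<lambda>x. cis (freq k \<bullet> x))"
proof -
  have "cis (freq k \<bullet> (x + (2 * pi) *\<^sub>R axis i 1)) = cis (freq k \<bullet> x)" for x i
  proof -
    have "freq k \<bullet> (x + (2 * pi) *\<^sub>R axis i 1) = freq k \<bullet> x + 2 * pi * real_of_int (k $ i)"
      by (simp add: inner_add_right inner_axis freq_def)
    then show ?thesis by (simp add: cis_mult[symmetric] cis_multiple_2pi)
  qed
  then show ?thesis by (simp add: periodic_def)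
qed

lemma periodic_trig_poly [simp]: "periodic (trig_poly N c)"
  by (simp add: periodic_def trig_poly_def periodic_cis_freq[unfolded periodic_def, rule_format])

lemma trig_poly_translate:
  "trig_poly N c (x + h *\<^sub>R axis j 1) = trig_poly N (\<lambda>k. cis (h * real_of_int (k $ j)) * c k) x"
  by (simp add: trig_poly_def inner_add_right inner_axis freq_def cis_mult[symmetric] mult_ac)

lemma trig_poly_diff: "trig_poly N c x - trig_poly N c' x = trig_poly N (\<lambda>k. c k - c' k) x"
  by (simp add: trig_poly_def sum_subtractf ring_distribs)

lemma trig_poly_cong:
  "(\<And>k. k \<in> freq_box N \<Longrightarrow> c k = c' k) \<Longrightarrow> trig_poly N c = trig_poly N c'"
  by (simp add: fun_eq_iff trig_poly_def)

lemma freq_0 [simp]: "freq 0 = 0"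
  by (simp add: freq_def vec_eq_iff)

lemma freq_add: "freq (k + l) = freq k + freq l"
  by (simp add: freq_def vec_eq_iff)

lemma freq_diff: "freq (k - l) = freq k - freq l"
  by (simp add: freq_def vec_eq_iff)

text \<open>
  A translation along an axis with \<open>k\<^sub>j \<noteq> 0\<close> multiplies the integral by a number other than \<open>1\<close>, but does not
  change it.
\<close>

lemma integral_cis_freq:
  "(LINT x|(torus :: (real ^ 'n) measure). cis (freq k \<bullet> x)) = (if k = 0 then of_real ((2 * pi) ^ CARD('n)) else 0)"
proof (cases "k = 0")
  case True
  then show ?thesis
    using integral_torus_const[of "1 :: complex", where 'n = 'n] by (simp add: scaleR_conv_of_real)
next
  case False
  then obtain j where j: "k $ j \<noteq> 0" by (auto simp: vec_eq_iff)
  \<comment> \<open>This shift makes the phase \<open>1\<close> or \<open>-1\<close>, whose exponential is not \<open>1\<close>.\<close>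
  define h where "h = 1 / \<bar>real_of_int (k $ j)\<bar>"
  have "h \<le> 1" using j by (auto simp: h_def divide_le_eq)
  then have h: "0 \<le> h" "h \<le> 2 * pi"
    using pi_gt3 by (auto simp: h_def)
  let ?I = "LINT x|(torus :: (real ^ 'n) measure). cis (freq k \<bullet> x)"
  have "?I = (LINT x|(torus :: (real ^ 'n) measure). cis (freq k \<bullet> (x + h *\<^sub>R axis j 1)))"
    by (rule periodic_integral_translate[OF _ periodic_cis_freq h, symmetric]) (intro continuous_intros)
  also have "\<dots> = cis (h * real_of_int (k $ j)) * ?I"
    by (simp add: inner_add_right inner_axis freq_def cis_mult[symmetric] mult_ac)
  finally have "(1 - cis (h * real_of_int (k $ j))) * ?I = 0" by (simp add: algebra_simps)
  moreover have "cis (h * real_of_int (k $ j)) \<noteq> 1"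
  proof
    assume "cis (h * real_of_int (k $ j)) = 1"
    then have "sin (h * real_of_int (k $ j)) = 0" by (simp add: complex_eq_iff)
    moreover have "h * real_of_int (k $ j) = 1 \<or> h * real_of_int (k $ j) = -1"
      using j by (auto simp: h_def abs_if)
    moreover have "sin (1 :: real) > 0" using pi_gt3 by (intro sin_gt_zero) auto
    ultimately show False by auto
  qed
  ultimately show ?thesis using False by auto
qed

lemma integrable_torus_mult_cis:
  fixes f :: "real ^ 'n \<Rightarrow> complex"
  assumes "integrable torus f"
  shows "integrable torus (\<lambda>x. f x * cis (v \<bullet> x))"
proof (rule Bochner_Integration.integrable_bound[OF assms])
  show "(\<lambda>x. f x * cis (v \<bullet> x)) \<in> borel_measurable torus"
    by (intro borel_measurable_times borel_measurable_integrable[OF assms] continuous_measurable_torus continuous_intros)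
qed (simp add: norm_mult)

lemma integrable_torus_mult_cis_minus:
  fixes f :: "real ^ 'n \<Rightarrow> complex"
  assumes "integrable torus f"
  shows "integrable torus (\<lambda>x. f x * cis (- (v \<bullet> x)))"
  using integrable_torus_mult_cis[OF assms, of "- v"] by simp

lemma fourier_diff:
  "integrable torus f \<Longrightarrow> integrable torus g \<Longrightarrow> fourier (\<lambda>x. f x - g x) k = fourier f k - fourier g k"
  by (simp add: fourier_def ring_distribs integrable_torus_mult_cis_minus diff_divide_distrib)

lemma integral_mult_cnj_trig_poly:
  fixes f :: "real ^ 'n \<Rightarrow> complex"
  assumes "integrable torus f"
  shows "(LINT x|torus. f x * cnj (trig_poly N c x)) =
    of_real ((2 * pi) ^ CARD('n)) * (\<Sum>k\<in>freq_box N. fourier f k * cnj (c k))"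
proof -
  have "(LINT x|torus. f x * cnj (trig_poly N c x)) = (LINT x|torus. (\<Sum>k\<in>freq_box N. (f x * cis (- (freq k \<bullet> x))) * cnj (c k)))"
    by (simp add: trig_poly_def sum_distrib_left cis_cnj mult_ac)
  also have "\<dots> = (\<Sum>k\<in>freq_box N. (LINT x|torus. f x * cis (- (freq k \<bullet> x))) * cnj (c k))"
    by (subst Bochner_Integration.integral_sum)
       (auto intro!: integrable_torus_mult_cis_minus assms Bochner_Integration.integrable_mult_left)
  also have "\<dots> = (\<Sum>k\<in>freq_box N. of_real ((2 * pi) ^ CARD('n)) * (fourier f k * cnj (c k)))"
    by (simp add: fourier_def)
  finally show ?thesis by (simp add: sum_distrib_left)
qed

lemma fourier_trig_poly:
  "fourier (trig_poly N c) k = (if k \<in> freq_box N then c k else 0)"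
proof -
  have "(LINT x|torus. trig_poly N c x * cis (- (freq k \<bullet> x)))
      = (LINT x|(torus :: (real ^ 'a) measure). (\<Sum>l\<in>freq_box N. c l * cis (freq (l - k) \<bullet> x)))"
    by (simp add: trig_poly_def sum_distrib_right freq_diff inner_diff_left mult.assoc cis_mult)
  also have "\<dots> = (\<Sum>l\<in>freq_box N. c l * (LINT x|(torus :: (real ^ 'a) measure). cis (freq (l - k) \<bullet> x)))"
    by (subst Bochner_Integration.integral_sum)
       (auto intro!: continuous_integrable_torus continuous_intros Bochner_Integration.integrable_mult_right)
  also have "\<dots> = (\<Sum>l\<in>freq_box N. if l = k then c l * of_real ((2 * pi) ^ CARD('a)) else 0)"
    by (intro sum.cong) (auto simp: integral_cis_freq)
  finally show ?thesis by (simp add: fourier_def)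
qed

lemma L2_norm_trig_poly:
  "(L2_norm (trig_poly N c :: real ^ 'n \<Rightarrow> complex))\<^sup>2 = (2 * pi) ^ CARD('n) * (\<Sum>k\<in>freq_box N. (cmod (c k))\<^sup>2)"
proof -
  have "of_real ((L2_norm (trig_poly N c :: real ^ 'n \<Rightarrow> complex))\<^sup>2) =
      (LINT x|(torus :: (real ^ 'n) measure). trig_poly N c x * cnj (trig_poly N c x))"
    by (simp add: L2_norm_power2 complex_norm_square[symmetric] flip: integral_complex_of_real)
  also have "\<dots> = of_real ((2 * pi) ^ CARD('n)) * (\<Sum>k\<in>freq_box N. fourier (trig_poly N c) k * cnj (c k))"
    by (intro integral_mult_cnj_trig_poly square_integrable_imp_integrable) simp
  also have "\<dots> = of_real ((2 * pi) ^ CARD('n) * (\<Sum>k\<in>freq_box N. (cmod (c k))\<^sup>2))"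
    by (simp add: fourier_trig_poly complex_norm_square[symmetric] flip: of_real_power)
  finally show ?thesis by (simp only: of_real_eq_iff)
qed

text \<open>
  Pythagoras: the defect of the best approximation plus the distance of \<open>c\<close> from the Fourier coefficients. It
  contains both Bessel's inequality and the best-approximation property of the projection.
\<close>

lemma L2_norm_diff_trig_poly:
  fixes f :: "real ^ 'n \<Rightarrow> complex"
  assumes f: "square_integrable f"
  shows "(L2_norm (\<lambda>x. f x - trig_poly N c x))\<^sup>2 = (L2_norm f)\<^sup>2
     - (2 * pi) ^ CARD('n) * (\<Sum>k\<in>freq_box N. (cmod (fourier f k))\<^sup>2)
     + (2 * pi) ^ CARD('n) * (\<Sum>k\<in>freq_box N. (cmod (fourier f k - c k))\<^sup>2)"
proof -
  let ?P = "trig_poly N c"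
  note [simp] = square_integrableD(2)[OF f] square_integrableD(2)[OF square_integrable_trig_poly]
  have norm: "(cmod (a - b))\<^sup>2 = (cmod a)\<^sup>2 - 2 * Re (a * cnj b) + (cmod b)\<^sup>2" for a b
    unfolding cmod_power2 by (simp add: power2_eq_square algebra_simps)
  have int: "integrable torus (\<lambda>x. f x * cnj (?P x))"
  proof (rule Bochner_Integration.integrable_bound)
    show "integrable torus (\<lambda>x. cmod (f x) * cmod (?P x))"
      by (intro square_integrable_mult_integrable f) simp
    show "(\<lambda>x. f x * cnj (?P x)) \<in> borel_measurable torus"
      by (intro borel_measurable_times square_integrableD(1)[OF f] continuous_measurable_torus continuous_intros)
  qed (simp add: norm_mult)
  have "(L2_norm (\<lambda>x. f x - ?P x))\<^sup>2 = (L2_norm f)\<^sup>2 - 2 * Re (LINT x|torus. f x * cnj (?P x)) + (L2_norm ?P)\<^sup>2"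
  proof -
    define w where "w x = f x * cnj (?P x)" for x
    have w: "integrable torus w" using int by (simp add: w_def[abs_def])
    have "(L2_norm (\<lambda>x. f x - ?P x))\<^sup>2 = (LINT x|torus. (cmod (f x))\<^sup>2 - 2 * Re (w x) + (cmod (?P x))\<^sup>2)"
      by (simp only: L2_norm_power2 norm w_def)
    also have "\<dots> = (L2_norm f)\<^sup>2 - 2 * Re (LINT x|torus. w x) + (L2_norm ?P)\<^sup>2"
      using w by (simp add: L2_norm_power2 integrable_Re)
    finally show ?thesis by (simp only: w_def)
  qed
  also have "(LINT x|torus. f x * cnj (?P x)) =
      of_real ((2 * pi) ^ CARD('n)) * (\<Sum>k\<in>freq_box N. fourier f k * cnj (c k))"
    by (intro integral_mult_cnj_trig_poly square_integrable_imp_integrable f)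
  finally show ?thesis
    unfolding L2_norm_trig_poly norm
    by (simp add: sum.distrib sum_subtractf sum_distrib_left algebra_simps del: of_real_power of_real_mult)
qed

lemma Bessel_box:
  fixes f :: "real ^ 'n \<Rightarrow> complex"
  assumes "square_integrable f"
  shows "(2 * pi) ^ CARD('n) * (\<Sum>k\<in>freq_box N. (cmod (fourier f k))\<^sup>2) \<le> (L2_norm f)\<^sup>2"
  using L2_norm_diff_trig_poly[OF assms, of N "fourier f"] zero_le_power2[of "L2_norm (\<lambda>x. f x - trig_poly N (fourier f) x)"]
  by simp

lemma Bessel:
  fixes f :: "real ^ 'n \<Rightarrow> complex"
  assumes "square_integrable f" "finite F"
  shows "(2 * pi) ^ CARD('n) * (\<Sum>k\<in>F. (cmod (fourier f k))\<^sup>2) \<le> (L2_norm f)\<^sup>2"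
proof -
  obtain N where "F \<subseteq> freq_box N" using finite_subset_freq_box[OF assms(2)] by blast
  then have "(\<Sum>k\<in>F. (cmod (fourier f k))\<^sup>2) \<le> (\<Sum>k\<in>freq_box N. (cmod (fourier f k))\<^sup>2)"
    by (intro sum_mono2) auto
  then show ?thesis
    using Bessel_box[OF assms(1), of N] by (smt (verit) mult_left_mono pi_gt_zero zero_le_power)
qed

lemma norm_fourier_le:
  fixes f :: "real ^ 'n \<Rightarrow> complex"
  assumes "square_integrable f"
  shows "cmod (fourier f k) \<le> L2_norm f"
proof (rule power2_le_imp_le)
  have "1 \<le> (2 * pi) ^ CARD('n)" using pi_gt3 by (intro one_le_power) auto
  then have "(cmod (fourier f k))\<^sup>2 \<le> (2 * pi) ^ CARD('n) * (cmod (fourier f k))\<^sup>2"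
    by (simp add: mult_le_cancel_right1)
  also have "\<dots> \<le> (L2_norm f)\<^sup>2"
    using Bessel[OF assms, of "{k}"] by simp
  finally show "(cmod (fourier f k))\<^sup>2 \<le> (L2_norm f)\<^sup>2" .
qed simp

section \<open>Pointwise estimates for the logarithmic nonlinearity\<close>

lemma norm_cis_minus_1_le: "cmod (cis a - 1) \<le> \<bar>a\<bar>"
proof (rule power2_le_imp_le)
  have "(cmod (cis a - 1))\<^sup>2 = (cos a - 1)\<^sup>2 + (sin a)\<^sup>2"
    by (simp add: cmod_power2)
  also have "\<dots> = 2 - 2 * cos a"
    using sin_cos_squared_add[of a] by (simp add: power2_diff)
  also have "\<dots> = (2 * sin (a / 2))\<^sup>2"
    using cos_double_sin[of "a / 2"] by (simp add: power_mult_distrib)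
  also have "\<dots> \<le> \<bar>a\<bar>\<^sup>2"
    unfolding abs_le_square_iff[symmetric] power2_abs using abs_sin_x_le_abs_x[of "a / 2"] by (simp add: abs_mult)
  finally show "(cmod (cis a - 1))\<^sup>2 \<le> \<bar>a\<bar>\<^sup>2" .
qed simp

lemma norm_cis_diff_le: "cmod (cis a - cis b) \<le> \<bar>a - b\<bar>"
proof -
  have "cis a - cis b = cis b * (cis (a - b) - 1)"
    by (simp add: algebra_simps cis_mult)
  then show ?thesis using norm_cis_minus_1_le[of "a - b"] by (simp add: norm_mult)
qed

lemma norm_cis_minus_1_power2_le: "(cmod (cis a - 1))\<^sup>2 \<le> 2 * \<bar>a\<bar>"
proof -
  have "cmod (cis a - 1) \<le> 2" using norm_triangle_ineq4[of "cis a" 1] by simp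
  then have "cmod (cis a - 1) * cmod (cis a - 1) \<le> 2 * \<bar>a\<bar>"
    using norm_cis_minus_1_le by (intro mult_mono) auto
  then show ?thesis by (simp add: power2_eq_square)
qed

lemma norm_cis_minus_1_ge:
  assumes "\<bar>a\<bar> \<le> 1"
  shows "\<bar>a\<bar> \<le> 2 * cmod (cis a - 1)"
proof -
  have "b \<le> 2 * sin b" if "0 \<le> b" "b \<le> 1" for b :: real
  proof -
    have "\<bar>sin b - b\<bar> \<le> \<bar>b\<bar> ^ 3 / 6"
      using Maclaurin_sin_bound[of b 3] by (simp add: sin_coeff_def lessThan_nat_numeral fact_numeral)
    moreover have "b ^ 3 \<le> b" using that power_decreasing[of 1 3 b] by simp
    ultimately show ?thesis using that by linarith
  qed
  then have "\<bar>a\<bar> \<le> 2 * sin \<bar>a\<bar>" using assms by simp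
  also have "\<dots> \<le> 2 * \<bar>sin a\<bar>" by (auto simp: abs_if)
  also have "\<bar>sin a\<bar> \<le> cmod (cis a - 1)"
    using abs_Im_le_cmod[of "cis a - 1"] by simp
  finally show ?thesis by simp
qed

text \<open>
  This inequality tames the logarithm in all estimates of differences below: the factor \<open>y\<close> is the smaller of the
  two moduli.
\<close>

lemma mult_ln_diff_le:
  assumes "0 < y" "y \<le> (x :: real)"
  shows "0 \<le> y * (ln x - ln y)" "y * (ln x - ln y) \<le> x - y"
proof -
  have "ln x - ln y = ln (x / y)" using assms by (simp add: ln_div)
  also have "\<dots> \<le> x / y - 1" using assms by (intro ln_le_minus_one) auto
  finally have "y * (ln x - ln y) \<le> y * (x / y - 1)" using assms by (intro mult_left_mono) auto
  then show "y * (ln x - ln y) \<le> x - y" using assms by (simp add: algebra_simps)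
  show "0 \<le> y * (ln x - ln y)" using assms by simp
qed

text \<open>
  The value of the nonlinear flow at a point depends only on the value of the initial function there; this is that
  scalar flow.
\<close>

definition phase_flow :: "real \<Rightarrow> real \<Rightarrow> complex \<Rightarrow> complex" where
  "phase_flow lam t z = (if z = 0 then 0 else cis (- (lam * t * ln ((cmod z)\<^sup>2))) * z)"

lemma flow_B_eq_phase_flow: "flow_B lam t w = (\<lambda>x. phase_flow lam t (w x))"
  by (simp add: fun_eq_iff flow_B_def phase_flow_def)

lemma norm_phase_flow [simp]: "cmod (phase_flow lam t z) = cmod z"
  by (simp add: phase_flow_def norm_mult)

lemma phase_flow_0_time [simp]: "phase_flow lam 0 z = z"
  by (simp add: phase_flow_def)

lemma ln_power2: "x > 0 \<Longrightarrow> ln (x\<^sup>2) = 2 * ln (x :: real)"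
  by (simp add: ln_realpow)

text \<open>
  Rotating both numbers by the phase of the larger one leaves their distance unchanged; the remaining phase
  difference acts on the smaller one, where \<open>mult_ln_diff_le\<close> applies.
\<close>

lemma phase_flow_lipschitz:
  assumes "t \<ge> 0"
  shows "cmod (phase_flow lam t p - phase_flow lam t q) \<le> (1 + 2 * \<bar>lam\<bar> * t) * cmod (p - q)"
proof -
  have *: "cmod (phase_flow lam t p - phase_flow lam t q) \<le> (1 + 2 * \<bar>lam\<bar> * t) * cmod (p - q)"
    if le: "cmod q \<le> cmod p" for p q
  proof (cases "q = 0")
    case True
    have "1 * cmod p \<le> (1 + 2 * \<bar>lam\<bar> * t) * cmod p"
      using assms by (intro mult_right_mono) auto
    then show ?thesis using True by (simp add: phase_flow_def norm_mult)
  next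
    case False
    then have pos: "cmod q > 0" "cmod p > 0" using le by (auto simp: less_le_trans)
    define \<theta> where "\<theta> z = - (lam * t * ln ((cmod z)\<^sup>2))" for z :: complex
    have "phase_flow lam t p - phase_flow lam t q = cis (\<theta> p) * (p - q) + (cis (\<theta> p) - cis (\<theta> q)) * q"
      using pos by (auto simp: phase_flow_def \<theta>_def algebra_simps)
    then have "cmod (phase_flow lam t p - phase_flow lam t q) \<le> cmod (p - q) + cmod (cis (\<theta> p) - cis (\<theta> q)) * cmod q"
      by (metis norm_triangle_ineq norm_mult norm_cis mult_1)
    also have "cmod (cis (\<theta> p) - cis (\<theta> q)) * cmod q \<le> \<bar>\<theta> p - \<theta> q\<bar> * cmod q"
      by (intro mult_right_mono norm_cis_diff_le) auto
    also have "\<theta> p - \<theta> q = - (2 * lam * t) * (ln (cmod p) - ln (cmod q))"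
      using pos by (simp add: \<theta>_def ln_power2 algebra_simps)
    also have "\<bar>\<dots>\<bar> = 2 * \<bar>lam\<bar> * t * (ln (cmod p) - ln (cmod q))"
      using pos le assms by (simp add: abs_mult)
    also have "2 * \<bar>lam\<bar> * t * (ln (cmod p) - ln (cmod q)) * cmod q
        = 2 * \<bar>lam\<bar> * t * (cmod q * (ln (cmod p) - ln (cmod q)))" by simp
    also have "\<dots> \<le> 2 * \<bar>lam\<bar> * t * (cmod p - cmod q)"
      using assms pos le by (intro mult_left_mono mult_ln_diff_le) auto
    also have "\<dots> \<le> 2 * \<bar>lam\<bar> * t * cmod (p - q)"
      using assms norm_triangle_ineq2[of p q] by (intro mult_left_mono) auto
    finally show ?thesis by (simp add: algebra_simps)
  qed
  show ?thesis
    using *[of q p] *[of p q] by (cases "cmod q \<le> cmod p") (auto simp: norm_minus_commute)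
qed

text \<open>
  With \<open>|q| \<le> |p|\<close>, the part \<open>(p - q) ln |p|\<^sup>2\<close> of the difference is a real multiple of \<open>p - q\<close> and drops out of
  the imaginary part. What remains is \<open>q (ln |p|\<^sup>2 - ln |q|\<^sup>2)\<close>, of modulus at most \<open>2 (|p| - |q|)\<close>.
\<close>

lemma log_nonlinearity_monotone:
  "\<bar>Im ((log_nonlinearity p - log_nonlinearity q) * cnj (p - q))\<bar> \<le> 2 * (cmod (p - q))\<^sup>2"
proof -
  have *: "\<bar>Im ((log_nonlinearity p - log_nonlinearity q) * cnj (p - q))\<bar> \<le> 2 * (cmod (p - q))\<^sup>2"
    if le: "cmod q \<le> cmod p" for p q
  proof (cases "q = 0")
    case True
    have "p * cnj p * of_real r = of_real ((cmod p)\<^sup>2 * r)" for r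
      by (simp add: complex_norm_square[symmetric] flip: of_real_power)
    then have "Im (log_nonlinearity p * cnj p) = 0"
      by (simp add: log_nonlinearity_def mult_ac)
    then show ?thesis using True by (simp add: log_nonlinearity_def)
  next
    case False
    then have pos: "cmod q > 0" "cmod p > 0" using le by (auto simp: less_le_trans)
    define a b where "a = ln ((cmod p)\<^sup>2)" and "b = ln (cmod p) - ln (cmod q)"
    have "log_nonlinearity p - log_nonlinearity q = of_real a * (p - q) + of_real (2 * b) * q"
      using pos by (auto simp: log_nonlinearity_def a_def b_def ln_power2 algebra_simps)
    then have "(log_nonlinearity p - log_nonlinearity q) * cnj (p - q)
        = of_real a * ((p - q) * cnj (p - q)) + of_real (2 * b) * q * cnj (p - q)"
      by (simp only: ring_distribs mult.assoc)
    also have "(p - q) * cnj (p - q) = of_real ((cmod (p - q))\<^sup>2)"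
      by (simp only: complex_norm_square)
    finally have "Im ((log_nonlinearity p - log_nonlinearity q) * cnj (p - q))
        = Im (of_real (2 * b) * q * cnj (p - q))" by simp
    also have "\<bar>\<dots>\<bar> \<le> cmod (of_real (2 * b) * q * cnj (p - q))" by (rule abs_Im_le_cmod)
    also have "\<dots> = 2 * (cmod q * b) * cmod (p - q)"
      using pos le by (simp add: norm_mult b_def del: complex_cnj_diff of_real_mult of_real_diff)
    also have "cmod q * b \<le> cmod p - cmod q"
      unfolding b_def using pos le by (intro mult_ln_diff_le) auto
    also have "cmod p - cmod q \<le> cmod (p - q)" by (rule norm_triangle_ineq2)
    finally show ?thesis by (simp add: power2_eq_square mult_right_mono)
  qed
  \<comment> \<open>The expression is symmetric in \<open>p\<close> and \<open>q\<close>, so that the larger modulus may be taken first.\<close>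
  have swap: "(log_nonlinearity p - log_nonlinearity q) * cnj (p - q) = (log_nonlinearity q - log_nonlinearity p) * cnj (q - p)"
    by (simp add: algebra_simps)
  show ?thesis
    using *[of q p] *[of p q] unfolding swap norm_minus_commute[of q p]
    by (cases "cmod q \<le> cmod p") (simp_all del: complex_cnj_diff)
qed

text \<open>
  The nonlinearity in units where \<open>\<kappa>\<close> is \<open>1\<close>, that is \<open>z ln (|z|/\<kappa>)\<^sup>2\<close>. It differs from the original one by a
  multiple of the identity, which is what makes \<open>\<kappa>\<close> a free parameter later.
\<close>

definition gauged_nonlinearity :: "real \<Rightarrow> complex \<Rightarrow> complex" where
  "gauged_nonlinearity \<kappa> z = log_nonlinearity z - of_real (2 * ln \<kappa>) * z"

lemma gauged_nonlinearity_eq: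
  assumes "\<kappa> > 0" "z \<noteq> 0"
  shows "gauged_nonlinearity \<kappa> z = of_real (2 * ln (cmod z / \<kappa>)) * z"
  using assms by (simp add: gauged_nonlinearity_def log_nonlinearity_def ln_power2 ln_div algebra_simps)

lemma gauged_nonlinearity_0 [simp]: "gauged_nonlinearity \<kappa> 0 = 0"
  by (simp add: gauged_nonlinearity_def log_nonlinearity_def)

lemma gauged_nonlinearity_log_lipschitz:
  assumes "\<kappa> > 0"
  shows "cmod (gauged_nonlinearity \<kappa> p - gauged_nonlinearity \<kappa> q)
    \<le> 2 * cmod (p - q) * (1 + \<bar>ln (max (cmod p) (cmod q) / \<kappa>)\<bar>)"
proof -
  have *: "cmod (gauged_nonlinearity \<kappa> p - gauged_nonlinearity \<kappa> q) \<le> 2 * cmod (p - q) * (1 + \<bar>ln (cmod p / \<kappa>)\<bar>)"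
    if le: "cmod q \<le> cmod p" for p q
  proof (cases "q = 0")
    case True
    have "cmod (gauged_nonlinearity \<kappa> p) = 2 * cmod p * \<bar>ln (cmod p / \<kappa>)\<bar>" if "p \<noteq> 0"
      using assms that by (simp add: gauged_nonlinearity_eq norm_mult abs_mult del: of_real_mult)
    then show ?thesis using True by (cases "p = 0") (auto simp: algebra_simps)
  next
    case False
    then have pos: "cmod q > 0" "cmod p > 0" using le by (auto simp: less_le_trans)
    define b where "b = ln (cmod p) - ln (cmod q)"
    have "gauged_nonlinearity \<kappa> p - gauged_nonlinearity \<kappa> q
        = of_real (2 * ln (cmod p / \<kappa>)) * (p - q) + of_real (2 * b) * q"
      using pos assms by (simp add: gauged_nonlinearity_eq b_def ln_div algebra_simps)
    then have "cmod (gauged_nonlinearity \<kappa> p - gauged_nonlinearity \<kappa> q)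
        \<le> cmod (of_real (2 * ln (cmod p / \<kappa>)) * (p - q)) + cmod (of_real (2 * b) * q)"
      by (metis norm_triangle_ineq)
    also have "\<dots> = 2 * \<bar>ln (cmod p / \<kappa>)\<bar> * cmod (p - q) + 2 * (cmod q * b)"
      using pos le by (simp add: norm_mult b_def abs_mult del: of_real_mult of_real_diff)
    also have "cmod q * b \<le> cmod p - cmod q"
      unfolding b_def using pos le by (intro mult_ln_diff_le) auto
    also have "cmod p - cmod q \<le> cmod (p - q)" by (rule norm_triangle_ineq2)
    finally show ?thesis by (simp add: algebra_simps)
  qed
  show ?thesis
    using *[of q p] *[of p q] by (cases "cmod q \<le> cmod p") (auto simp: norm_minus_commute max_def)
qed

text \<open>
  The pointwise form of the main estimate. The logarithm of \<open>\<mu>/\<kappa>\<close>, with \<open>\<mu>\<close> the larger modulus, is split in two ways.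
  If \<open>\<mu> \<ge> \<kappa>\<close>, then \<open>ln (\<mu>/\<kappa>) = ln R + ln (\<mu>/(\<kappa>R)) \<le> ln R + \<mu>/(\<kappa>R)\<close>. If \<open>\<mu>\<close> is below \<open>\<kappa>/(4n)\<close>, then
  \<open>ln (\<kappa>/\<mu>) = ln (4n) + ln \<nu> \<le> ln (4n) + \<nu>\<close> with \<open>\<nu> = \<kappa>/(4n\<mu>)\<close>; since \<open>|p - q| \<le> 2\<mu>\<close>, the term with \<open>\<nu>\<close>
  contributes at most \<open>\<kappa>/n\<close>, and \<open>p\<close> is so much smaller than \<open>\<kappa>\<close> that it must be far from \<open>M\<close> or \<open>K\<close> must be large.
\<close>

lemma gauged_nonlinearity_diff_le:
  assumes \<kappa>: "\<kappa> = cmod M + K" "K > 0" and n: "n > 0" and R: "R \<ge> 1"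
  shows "cmod (gauged_nonlinearity \<kappa> p - gauged_nonlinearity \<kappa> q)
    \<le> 2 * cmod (p - q) * (1 + ln (4 * real n) + ln R + (cmod p + cmod q) / (\<kappa> * R))
      + 2 * (cmod (p - M) + K) / real n"
proof -
  define \<mu> where "\<mu> = max (cmod p) (cmod q)"
  have \<kappa>pos: "\<kappa> > 0" using \<kappa> by (simp add: add_nonneg_pos)
  have n1: "real n \<ge> 1" using n by simp
  have ln4: "0 \<le> ln (4 * real n)" and lnR: "0 \<le> ln R" using n1 R by auto
  have \<mu>0: "0 \<le> \<mu>" and \<mu>sum: "\<mu> \<le> cmod p + cmod q" by (auto simp: \<mu>_def le_max_iff_disj)
  have pq: "cmod (p - q) \<le> 2 * \<mu>"
    using norm_triangle_ineq4[of p q] by (auto simp: \<mu>_def)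
  have lip: "cmod (gauged_nonlinearity \<kappa> p - gauged_nonlinearity \<kappa> q) \<le> 2 * cmod (p - q) * (1 + \<bar>ln (\<mu> / \<kappa>)\<bar>)"
    unfolding \<mu>_def by (rule gauged_nonlinearity_log_lipschitz[OF \<kappa>pos])
  have A: "0 \<le> (cmod p + cmod q) / (\<kappa> * R)" and B: "0 \<le> 2 * (cmod (p - M) + K) / real n"
    using \<kappa>pos R \<kappa> n by auto
  consider "\<mu> = 0" | "\<mu> > 0" "\<mu> \<ge> \<kappa>" | "\<kappa> / (4 * real n) \<le> \<mu>" "\<mu> < \<kappa>" | "0 < \<mu>" "\<mu> < \<kappa> / (4 * real n)"
    using \<mu>0 \<kappa>pos by linarith
  then show ?thesis
  proof cases
    case 1
    then have "p = 0" "q = 0" by (auto simp: \<mu>_def max_def split: if_splits)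
    then show ?thesis using B by simp
  next
    case 2
    have "\<bar>ln (\<mu> / \<kappa>)\<bar> = ln R + ln (\<mu> / (\<kappa> * R))"
      using 2 \<kappa>pos R by (simp add: ln_div ln_mult)
    also have "ln (\<mu> / (\<kappa> * R)) \<le> \<mu> / (\<kappa> * R)"
      using 2 \<kappa>pos R by (intro ln_bound) auto
    also have "\<mu> / (\<kappa> * R) \<le> (cmod p + cmod q) / (\<kappa> * R)"
      using \<mu>sum \<kappa>pos R by (intro divide_right_mono) auto
    finally have "1 + \<bar>ln (\<mu> / \<kappa>)\<bar> \<le> 1 + ln (4 * real n) + ln R + (cmod p + cmod q) / (\<kappa> * R)"
      using ln4 by simp
    from mult_left_mono[OF this, of "2 * cmod (p - q)"] show ?thesis
      using lip B by simp
  next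
    case 3
    have "\<mu> > 0" using 3 \<kappa>pos n1 by (smt (verit) divide_pos_pos)
    then have "\<bar>ln (\<mu> / \<kappa>)\<bar> = ln (\<kappa> / \<mu>)"
      using 3 \<kappa>pos by (simp add: ln_div)
    also have "\<dots> \<le> ln (4 * real n)"
      using 3 \<kappa>pos \<open>\<mu> > 0\<close> n1 by (subst ln_le_cancel_iff) (auto simp: field_simps)
    finally have "1 + \<bar>ln (\<mu> / \<kappa>)\<bar> \<le> 1 + ln (4 * real n) + ln R + (cmod p + cmod q) / (\<kappa> * R)"
      using lnR A by simp
    from mult_left_mono[OF this, of "2 * cmod (p - q)"] show ?thesis
      using lip B by simp
  next
    case 4
    define \<nu> where "\<nu> = \<kappa> / (4 * real n * \<mu>)"
    have \<mu>\<kappa>: "\<mu> < \<kappa> / 4"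
    proof -
      have "\<kappa> / (4 * real n) \<le> \<kappa> / 4" using \<kappa>pos n1 by (intro divide_left_mono) auto
      then show ?thesis using 4 by simp
    qed
    have "\<bar>ln (\<mu> / \<kappa>)\<bar> = ln (4 * real n) + ln \<nu>"
      using 4 \<kappa>pos n1 \<mu>\<kappa> by (simp add: ln_div ln_mult \<nu>_def)
    also have "ln \<nu> \<le> \<nu>"
      using 4 \<kappa>pos n1 by (intro ln_bound) (auto simp: \<nu>_def)
    finally have "2 * cmod (p - q) * (1 + \<bar>ln (\<mu> / \<kappa>)\<bar>)
        \<le> 2 * cmod (p - q) * (1 + ln (4 * real n) + \<nu>)"
      by (intro mult_left_mono) auto
    also have "\<dots> = 2 * cmod (p - q) * (1 + ln (4 * real n)) + 2 * cmod (p - q) * \<nu>"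
      by (simp add: algebra_simps)
    also have "2 * cmod (p - q) * \<nu> \<le> 2 * (2 * \<mu>) * \<nu>"
      using pq 4 \<kappa>pos n1 by (intro mult_mono) (auto simp: \<nu>_def)
    also have "2 * (2 * \<mu>) * \<nu> = \<kappa> / real n"
      using 4 n1 by (simp add: \<nu>_def)
    also have "\<kappa> \<le> 2 * (cmod (p - M) + K)"
    proof -
      have "cmod M \<le> cmod (p - M) + cmod p"
        using norm_triangle_sub[of M p] by (simp add: norm_minus_commute)
      moreover have "cmod p \<le> \<mu>" by (simp add: \<mu>_def)
      ultimately have "\<kappa> \<le> (cmod (p - M) + K) + \<kappa> / 4" using \<mu>\<kappa> \<kappa> by linarith
      moreover have "0 \<le> cmod (p - M) + K" using \<kappa>(2) by simp
      ultimately show ?thesis by argo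
    qed
    finally have "2 * cmod (p - q) * (1 + \<bar>ln (\<mu> / \<kappa>)\<bar>)
        \<le> 2 * cmod (p - q) * (1 + ln (4 * real n)) + 2 * (cmod (p - M) + K) / real n"
      using n1 by (simp add: divide_right_mono)
    also have "\<dots> \<le> 2 * cmod (p - q) * (1 + ln (4 * real n) + ln R + (cmod p + cmod q) / (\<kappa> * R))
        + 2 * (cmod (p - M) + K) / real n"
      using A lnR by (intro add_right_mono mult_left_mono) auto
    finally show ?thesis using lip by simp
  qed
qed

text \<open>
  Continuity at \<open>0\<close> only needs some positive power of \<open>|z|\<close> on the right; with the square root,
  \<open>ln (1/r) \<le> 1/r\<close> for \<open>r = \<surd>|z|\<close> suffices.
\<close>

lemma norm_log_nonlinearity_small:
  assumes "cmod z \<le> 1"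
  shows "cmod (log_nonlinearity z) \<le> 4 * sqrt (cmod z)"
proof (cases "z = 0")
  case False
  define r where "r = sqrt (cmod z)"
  have r: "0 < r" "r \<le> 1" "cmod z = r\<^sup>2" using False assms by (auto simp: r_def)
  have "cmod (log_nonlinearity z) = r\<^sup>2 * (4 * \<bar>ln r\<bar>)"
    using False r by (simp add: log_nonlinearity_def norm_mult ln_realpow abs_mult)
  also have "\<bar>ln r\<bar> = ln (1 / r)" using r by (simp add: ln_div)
  also have "ln (1 / r) \<le> 1 / r" using r by (intro ln_bound) auto
  finally show ?thesis using r by (simp add: power2_eq_square flip: r_def)
qed (simp add: log_nonlinearity_def)

lemma norm_log_nonlinearity_le: "cmod (log_nonlinearity z) \<le> 4 + 2 * (cmod z)\<^sup>2"
proof (cases "cmod z \<le> 1")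
  case True
  then have "sqrt (cmod z) \<le> 1" by simp
  then show ?thesis using norm_log_nonlinearity_small[OF True] by (smt (verit) zero_le_power2)
next
  case False
  have "ln (cmod z) \<le> cmod z" using False by (intro ln_bound) auto
  then have "cmod z * (2 * ln (cmod z)) \<le> cmod z * (2 * cmod z)" using False by (intro mult_left_mono) auto
  moreover have "cmod (log_nonlinearity z) = cmod z * (2 * ln (cmod z))"
    using False by (auto simp: log_nonlinearity_def norm_mult ln_power2)
  ultimately show ?thesis by (simp add: power2_eq_square)
qed

lemma isCont_log_nonlinearity: "isCont log_nonlinearity z"
proof (cases "z = 0")
  case True
  have "((\<lambda>z. 4 * sqrt (cmod z)) \<longlongrightarrow> 0) (at 0)"
    by (auto intro!: tendsto_eq_intros)
  then have "(log_nonlinearity \<longlongrightarrow> 0) (at 0)"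
  proof (rule Lim_null_comparison[rotated])
    show "\<forall>\<^sub>F z in at 0. cmod (log_nonlinearity z) \<le> 4 * sqrt (cmod z)"
      unfolding eventually_at by (intro exI[of _ 1]) (auto intro!: norm_log_nonlinearity_small simp: dist_norm)
  qed
  then show ?thesis using True by (simp add: isCont_def log_nonlinearity_def)
next
  case False
  have "isCont (\<lambda>z. z * of_real (ln ((cmod z)\<^sup>2))) z"
    using False by (intro continuous_intros) auto
  moreover have "\<forall>\<^sub>F y in nhds z. y * of_real (ln ((cmod y)\<^sup>2)) = log_nonlinearity y"
    using t1_space_nhds[OF False] by eventually_elim (simp add: log_nonlinearity_def)
  ultimately show ?thesis by (subst isCont_cong[symmetric]) (auto elim: eventually_mono)
qed

lemma continuous_log_nonlinearity:
  "continuous_on S f \<Longrightarrow> continuous_on S (\<lambda>x. log_nonlinearity (f x))"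
  by (rule continuous_on_compose2[of UNIV log_nonlinearity])
     (auto simp: continuous_on_eq_continuous_at isCont_log_nonlinearity)

text \<open>
  At a zero of the modulus the phase has no limit, but the flow preserves the modulus and so tends to \<open>0\<close>.
\<close>

lemma continuous_phase_flow_joint:
  "continuous_on UNIV (\<lambda>p. phase_flow lam (fst p) (snd p))"
proof (subst continuous_on_eq_continuous_at, simp, clarify)
  fix t z
  let ?F = "\<lambda>p. phase_flow lam (fst p) (snd p)"
  show "isCont ?F (t, z)"
  proof (cases "z = 0")
    case True
    have "((\<lambda>p. cmod (snd p)) \<longlongrightarrow> 0) (at (t, z))"
      using True by (auto intro!: tendsto_eq_intros)
    then have "((\<lambda>p. cmod (?F p)) \<longlongrightarrow> 0) (at (t, z))" by simp
    then have "(?F \<longlongrightarrow> 0) (at (t, z))" by (rule tendsto_norm_zero_cancel)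
    then show ?thesis using True by (simp add: isCont_def phase_flow_def)
  next
    case False
    have "isCont (\<lambda>p. cis (- (lam * fst p * ln ((cmod (snd p))\<^sup>2))) * snd p) (t, z)"
      unfolding isCont_def cis_conv_exp using False by (intro tendsto_intros) auto
    moreover have "\<forall>\<^sub>F p in nhds (t, z). snd p \<noteq> 0"
    proof -
      have "open (UNIV \<times> (- {0}) :: (real \<times> complex) set)" by (intro open_Times) auto
      from eventually_nhds_in_open[OF this, of "(t, z)"] show ?thesis
        using False by (auto elim: eventually_mono)
    qed
    then have "\<forall>\<^sub>F p in nhds (t, z). cis (- (lam * fst p * ln ((cmod (snd p))\<^sup>2))) * snd p = ?F p"
      by eventually_elim (simp add: phase_flow_def)
    ultimately show ?thesis by (subst isCont_cong[symmetric]) auto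
  qed
qed

lemma phase_flow_has_vector_derivative:
  "((\<lambda>t. phase_flow lam t z) has_vector_derivative - (\<i> * of_real lam * log_nonlinearity (phase_flow lam t z))) (at t within S)"
proof (cases "z = 0")
  case True
  then show ?thesis by (simp add: phase_flow_def log_nonlinearity_def)
next
  case False
  define L where "L = ln ((cmod z)\<^sup>2)"
  have "phase_flow lam s z = exp (of_real s * (- \<i> * of_real (lam * L))) * z" for s
    using False by (simp add: phase_flow_def L_def cis_conv_exp mult_ac)
  moreover have "log_nonlinearity (phase_flow lam t z) = phase_flow lam t z * of_real L"
    using False by (simp add: log_nonlinearity_def phase_flow_def norm_mult L_def)
  moreover have "((\<lambda>s. exp (of_real s * (- \<i> * of_real (lam * L))) * z) has_vector_derivative
     (- \<i> * of_real (lam * L)) * (exp (of_real t * (- \<i> * of_real (lam * L))) * z)) (at t within S)"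
    by (rule has_vector_derivative_real_field) (auto intro!: derivative_eq_intros)
  ultimately show ?thesis by (simp add: algebra_simps)
qed

section \<open>Density of trigonometric polynomials and the projection error\<close>

text \<open>
  The same functions as the trigonometric polynomials, without a prescribed frequency box: in this form closure under
  products is a double induction.
\<close>

inductive trig_sum :: "(real ^ 'n \<Rightarrow> complex) \<Rightarrow> bool" where
  monomial: "trig_sum (\<lambda>x. a * cis (freq k \<bullet> x))"
| add: "trig_sum f \<Longrightarrow> trig_sum g \<Longrightarrow> trig_sum (\<lambda>x. f x + g x)"

lemma trig_sum_const: "trig_sum (\<lambda>x. a)"
  using trig_sum.monomial[of a 0] by simp

lemma trig_sum_mult:
  assumes "trig_sum f" "trig_sum g"
  shows "trig_sum (\<lambda>x. f x * g x)"
  using assms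
proof (induction f rule: trig_sum.induct)
  case (monomial a k)
  from \<open>trig_sum g\<close> show ?case
  proof (induction g rule: trig_sum.induct)
    case (monomial b l)
    have "(\<lambda>x. a * cis (freq k \<bullet> x) * (b * cis (freq l \<bullet> x))) = (\<lambda>x. (a * b) * cis (freq (k + l) \<bullet> x))"
      by (simp add: freq_add inner_add_left cis_mult[symmetric] mult_ac)
    then show ?case by (metis trig_sum.monomial)
  next
    case (add g h)
    then show ?case by (simp add: ring_distribs trig_sum.add)
  qed
next
  case (add f h)
  then show ?case by (simp add: ring_distribs trig_sum.add)
qed

lemma trig_sum_sum:
  assumes "finite I" "\<And>i. i \<in> I \<Longrightarrow> trig_sum (f i)"
  shows "trig_sum (\<lambda>x. \<Sum>i\<in>I. f i x)"
  using assms by (induction I rule: finite_induct) (auto intro: trig_sum.add trig_sum_const)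

lemma trig_poly_extend:
  assumes "N \<le> M"
  shows "trig_poly N c = trig_poly M (\<lambda>k. if k \<in> freq_box N then c k else 0)"
proof
  fix x
  have "(\<Sum>k\<in>freq_box N. c k * cis (freq k \<bullet> x)) = (\<Sum>k\<in>freq_box M. if k \<in> freq_box N then c k * cis (freq k \<bullet> x) else 0)"
    by (simp add: sum.inter_restrict[symmetric] Int_absorb1 freq_box_mono[OF assms])
  also have "\<dots> = (\<Sum>k\<in>freq_box M. (if k \<in> freq_box N then c k else 0) * cis (freq k \<bullet> x))"
    by (intro sum.cong) auto
  finally show "trig_poly N c x = trig_poly M (\<lambda>k. if k \<in> freq_box N then c k else 0) x"
    by (simp add: trig_poly_def)
qed

lemma trig_sum_imp_trig_poly:
  assumes "trig_sum f"
  shows "\<exists>N c. f = trig_poly N c"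
  using assms
proof (induction f rule: trig_sum.induct)
  case (monomial a k)
  obtain N where "{k} \<subseteq> freq_box N" using finite_subset_freq_box[of "{k}"] by auto
  then have "(\<lambda>x. a * cis (freq k \<bullet> x)) = trig_poly N (\<lambda>l. if l = k then a else 0)"
    by (simp add: fun_eq_iff trig_poly_def mult_delta_left)
  then show ?case by blast
next
  case (add f g)
  then obtain N c M c' where f: "f = trig_poly N c" and g: "g = trig_poly M c'" by blast
  define c1 where "c1 = (\<lambda>k. if k \<in> freq_box N then c k else 0)"
  define c2 where "c2 = (\<lambda>k. if k \<in> freq_box M then c' k else 0)"
  have "f = trig_poly (max N M) c1" "g = trig_poly (max N M) c2"
    unfolding f g c1_def c2_def by (auto intro: trig_poly_extend)
  then have "(\<lambda>x. f x + g x) = trig_poly (max N M) (\<lambda>k. c1 k + c2 k)"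
    by (simp add: fun_eq_iff trig_poly_def sum.distrib ring_distribs)
  then show ?case by blast
qed

text \<open>
  The torus as a compact subset of a Euclidean space. Polynomials in the real coordinates of that space restrict to
  trigonometric polynomials, so that the Stone-Weierstrass theorem for polynomials becomes a statement on the torus.
\<close>

definition torus_embed :: "real ^ 'n \<Rightarrow> complex ^ 'n" where
  "torus_embed x = (\<chi> i. cis (x $ i))"

lemma continuous_torus_embed: "continuous_on S torus_embed"
  unfolding torus_embed_def by (intro continuous_intros)

lemma trig_sum_cis_coord: "trig_sum (\<lambda>x. a * cis (x $ i))" "trig_sum (\<lambda>x. a * cis (- x $ i))"
proof -
  have "freq (axis i 1) \<bullet> x = x $ i" "freq (- axis i 1) \<bullet> x = - x $ i" for x
    by (simp_all add: freq_def inner_vec_def axis_def if_distrib if_distribR cong: if_cong)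
  then show "trig_sum (\<lambda>x. a * cis (x $ i))" "trig_sum (\<lambda>x. a * cis (- x $ i))"
    using trig_sum.monomial[of a "axis i 1"] trig_sum.monomial[of a "- axis i 1"] by simp_all
qed

lemma trig_sum_real_polynomial:
  fixes g :: "complex ^ 'n \<Rightarrow> real"
  assumes "real_polynomial_function g"
  shows "trig_sum (\<lambda>x. of_real (g (torus_embed x)))"
  using assms
proof (induction g rule: real_polynomial_function.induct)
  case (linear g)
  interpret bounded_linear g by fact
  have coord: "trig_sum (\<lambda>x. of_real (torus_embed x \<bullet> b * g b))" if "b \<in> Basis" for b :: "complex ^ 'n"
  proof -
    from that obtain i u where b: "b = axis i u" and u: "u = 1 \<or> u = \<i>"
      by (auto simp: Basis_vec_def Basis_complex_def)
    have "torus_embed x \<bullet> b = cis (x $ i) \<bullet> u" for x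
      by (simp add: b inner_axis torus_embed_def)
    then have "(\<lambda>x. complex_of_real (torus_embed x \<bullet> b * g b)) =
        (\<lambda>x. (cnj u * of_real (g b) / 2) * cis (x $ i) + (u * of_real (g b) / 2) * cis (- x $ i))"
      using u by (auto simp: fun_eq_iff complex_eq_iff inner_complex_def)
    then show ?thesis by (simp only: trig_sum.add trig_sum_cis_coord)
  qed
  have expand: "g z = (\<Sum>b\<in>Basis. (z \<bullet> b) * g b)" for z
  proof -
    have "g z = g (\<Sum>b\<in>Basis. (z \<bullet> b) *\<^sub>R b)" by (simp only: euclidean_representation)
    also have "\<dots> = (\<Sum>b\<in>Basis. (z \<bullet> b) * g b)" by (simp only: sum scaleR real_scaleR_def)
    finally show ?thesis .
  qed
  have "(\<lambda>x. complex_of_real (g (torus_embed x))) = (\<lambda>x. \<Sum>b\<in>Basis. of_real (torus_embed x \<bullet> b * g b))"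
    by (rule ext, subst expand) simp
  then show ?case by (simp only: trig_sum_sum coord finite_Basis)
next
  case (add f g)
  then show ?case by (simp add: trig_sum.add)
next
  case (mult f g)
  then show ?case by (simp add: trig_sum_mult)
qed (simp add: trig_sum_const)

text \<open>
  A continuous function on the closed cell that agrees at points identified on the torus descends to the image of
  \<open>torus_embed\<close>, and the descended function is continuous because the cell is compact.
\<close>

lemma trig_poly_uniform_dense:
  fixes f :: "real ^ 'n \<Rightarrow> complex"
  assumes cont: "continuous_on (cbox cell_lo cell_hi) f"
    and inv: "\<And>x y. x \<in> cbox cell_lo cell_hi \<Longrightarrow> y \<in> cbox cell_lo cell_hi \<Longrightarrow> torus_embed x = torus_embed y \<Longrightarrow> f x = f y"
    and e: "e > 0"
  shows "\<exists>N c. \<forall>x\<in>cbox cell_lo cell_hi. cmod (f x - trig_poly N c x) < e"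
proof -
  let ?Q = "cbox cell_lo (cell_hi :: real ^ 'n)"
  define S where "S = torus_embed ` ?Q"
  define F where "F z = f (inv_into ?Q torus_embed z)" for z
  have F: "F (torus_embed x) = f x" if "x \<in> ?Q" for x
    unfolding F_def
    by (rule inv) (use that in \<open>auto simp: f_inv_into_f intro: inv_into_into\<close>)
  have S: "compact S"
    unfolding S_def by (intro compact_continuous_image continuous_torus_embed compact_cbox)
  have "continuous_on S F"
  proof (subst continuous_on_closed_vimage[OF compact_imp_closed[OF S]], intro allI impI)
    fix C :: "complex set" assume "closed C"
    then have "closed (f -` C \<inter> ?Q)"
      using cont continuous_on_closed_vimage[OF closed_cbox] by blast
    then have "compact (f -` C \<inter> ?Q)"
      by (metis compact_Int_closed compact_cbox inf_commute inf.left_idem)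
    then have "compact (torus_embed ` (f -` C \<inter> ?Q))"
      by (intro compact_continuous_image continuous_torus_embed)
    moreover have "torus_embed ` (f -` C \<inter> ?Q) = F -` C \<inter> S"
      using F by (auto simp: S_def)
    ultimately show "closed (F -` C \<inter> S)" by (simp add: compact_imp_closed)
  qed
  then have "continuous_on S (\<lambda>z. Re (F z))" "continuous_on S (\<lambda>z. Im (F z))"
    by (auto intro: continuous_intros)
  then have re: "continuous_on S (\<lambda>z. Re (F z))" and im: "continuous_on S (\<lambda>z. Im (F z))" by auto
  obtain p where p: "real_polynomial_function p" "\<And>z. z \<in> S \<Longrightarrow> \<bar>Re (F z) - p z\<bar> < e / 2"
    using Stone_Weierstrass_real_polynomial_function[OF S re half_gt_zero[OF e]] by blast
  obtain q where q: "real_polynomial_function q" "\<And>z. z \<in> S \<Longrightarrow> \<bar>Im (F z) - q z\<bar> < e / 2"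
    using Stone_Weierstrass_real_polynomial_function[OF S im half_gt_zero[OF e]] by blast
  have "trig_sum (\<lambda>x. of_real (p (torus_embed x)) + \<i> * of_real (q (torus_embed x)))"
    by (intro trig_sum.add trig_sum_mult trig_sum_const trig_sum_real_polynomial p q)
  then obtain N c where Nc: "(\<lambda>x. of_real (p (torus_embed x)) + \<i> * of_real (q (torus_embed x))) = trig_poly N c"
    using trig_sum_imp_trig_poly by blast
  have "cmod (f x - trig_poly N c x) < e" if x: "x \<in> ?Q" for x
  proof -
    have z: "torus_embed x \<in> S" using x by (simp add: S_def)
    have eq: "trig_poly N c x = of_real (p (torus_embed x)) + \<i> * of_real (q (torus_embed x))"
      using fun_cong[OF Nc, of x] by simp
    have "cmod (f x - trig_poly N c x) \<le> \<bar>Re (f x - trig_poly N c x)\<bar> + \<bar>Im (f x - trig_poly N c x)\<bar>"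
      by (rule cmod_le)
    also have "\<dots> < e / 2 + e / 2"
      using p(2)[OF z] q(2)[OF z] by (intro add_strict_mono) (simp_all add: F[OF x] eq)
    finally show ?thesis by simp
  qed
  then show ?thesis by blast
qed

text \<open>
  Only boundary points of the cell are identified with other points of the cell. Hence every function that vanishes on the
  boundary descends to the torus.
\<close>

lemma torus_embed_inj_box:
  assumes "x \<in> box cell_lo cell_hi" "y \<in> cbox cell_lo cell_hi" "torus_embed x = torus_embed y"
  shows "x = (y :: real ^ 'n)"
proof (subst vec_eq_iff, rule allI)
  fix i
  have "cis (x $ i) = cis (y $ i)"
    using assms(3) by (simp add: torus_embed_def vec_eq_iff)
  then have "sin (x $ i) = sin (y $ i) \<and> cos (x $ i) = cos (y $ i)"
    by (simp add: complex_eq_iff)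
  then obtain n :: int where n: "x $ i = y $ i + 2 * pi * of_int n"
    using sin_cos_eq_iff by blast
  have "\<bar>x $ i - y $ i\<bar> < 2 * pi"
    using assms(1,2) unfolding mem_box_cart cell_lo_def cell_hi_def by (auto simp: abs_less_iff) (smt (verit))+
  then have "2 * pi * \<bar>of_int n\<bar> < 2 * pi" unfolding n by (simp add: abs_mult)
  then have "\<bar>real_of_int n\<bar> < 1" by simp
  then have "n = 0" by linarith
  then show "x $ i = y $ i" using n by simp
qed

lemma AE_torus_negligible:
  assumes "negligible Z"
  shows "AE x in torus. x \<notin> Z"
proof -
  have "AE x in lebesgue. x \<notin> Z"
    using assms by (auto simp: negligible_iff_null_sets intro: AE_not_in)
  then show ?thesis
    by (subst AE_restrict_space_iff) (auto simp: torus_cell_sets)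
qed

text \<open>
  A measurable function is an almost-everywhere limit of continuous functions. Clipping these at the bound of \<open>f\<close>
  makes the convergence dominated, and multiplying by cutoffs that vanish on the boundary of the cell makes
  them descend to the torus, where they are uniformly approximable.
\<close>

lemma trig_poly_L2_dense:
  fixes f :: "real ^ 'n \<Rightarrow> complex"
  assumes meas: "f \<in> borel_measurable torus" and bnd: "AE x in torus. cmod (f x) \<le> B" and e: "e > 0"
  shows "\<exists>N c. L2_norm (\<lambda>x. f x - trig_poly N c x) < e"
proof -
  let ?Q = "cbox cell_lo (cell_hi :: real ^ 'n)" and ?O = "box cell_lo (cell_hi :: real ^ 'n)"
  define D where "D = sqrt ((2 * pi) ^ CARD('n))"
  have D: "D > 0" by (simp add: D_def)
  have "f measurable_on torus_cell"
    using meas by (simp add: measurable_on_iff_borel_measurable torus_cell_sets)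
  then obtain Z g where Z: "negligible Z" and g: "\<And>n :: nat. continuous_on UNIV (g n)"
      and lim: "\<And>x. x \<notin> Z \<Longrightarrow> (\<lambda>n. g n x) \<longlonglongrightarrow> (if x \<in> torus_cell then f x else 0)"
    unfolding measurable_on_def by blast
  define clip :: "complex \<Rightarrow> complex" where "clip = closest_point (cball 0 \<bar>B\<bar>)"
  have clip_cont: "continuous_on UNIV clip"
    unfolding clip_def by (rule continuous_on_closest_point) auto
  have clip_bound: "cmod (clip z) \<le> \<bar>B\<bar>" for z
    using closest_point_in_set[of "cball 0 \<bar>B\<bar>" z] by (simp add: clip_def)
  have clip_id: "clip z = z" if "cmod z \<le> B" for z
    unfolding clip_def by (rule closest_point_self) (use that in auto)
  \<comment> \<open>A continuous cutoff: \<open>0\<close> off the open cell and increasing to \<open>1\<close> inside it.\<close>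
  define cut where "cut n x = min 1 (real n * infdist x (- ?O))" for n x
  have cut01: "0 \<le> cut n x" "cut n x \<le> 1" for n x by (auto simp: cut_def infdist_nonneg)
  have cut0: "cut n x = 0" if "x \<notin> ?O" for n x using that by (simp add: cut_def)
  have "cell_hi \<in> - ?O" by (simp add: mem_box_cart cell_hi_def)
  then have ne: "- ?O \<noteq> {}" by blast
  have cutlim: "(\<lambda>n. cut n x) \<longlonglongrightarrow> 1" if "x \<in> ?O" for x
  proof -
    have pos: "infdist x (- ?O) > 0"
      using that in_closed_iff_infdist_zero[of "- ?O" x] ne infdist_nonneg[of x "- ?O"]
        closed_Compl[OF open_box[of cell_lo cell_hi]]
      by (auto simp: less_le)
    \<comment> \<open>The cutoff equals \<open>1\<close> from the index on at which \<open>n\<close> times the distance exceeds \<open>1\<close>.\<close>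
    obtain m :: nat where m: "1 / infdist x (- ?O) < real m" using reals_Archimedean2 by blast
    have "cut n x = 1" if "n \<ge> m" for n
    proof -
      have "1 / infdist x (- ?O) < real n" using m that by linarith
      then show ?thesis using pos by (simp add: cut_def field_simps)
    qed
    then show ?thesis by (intro tendsto_eventually) (auto simp: eventually_sequentially)
  qed
  define h where "h n x = of_real (cut n x) * clip (g n x)" for n x
  have h_cont: "continuous_on UNIV (h n)" for n
    unfolding h_def cut_def
    by (intro continuous_intros continuous_on_compose2[OF clip_cont g]) auto
  have h_bound: "cmod (h n x) \<le> \<bar>B\<bar>" for n x
    using mult_mono[OF cut01(2)[of n x] clip_bound[of "g n x"]] cut01(1)[of n x]
    by (simp add: h_def norm_mult)
  have h_lim: "(\<lambda>n. h n x) \<longlonglongrightarrow> f x" if x: "x \<in> ?O" "x \<notin> Z" "cmod (f x) \<le> B" for x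
  proof -
    have "(\<lambda>n. g n x) \<longlonglongrightarrow> f x" using lim[OF x(2)] x(1) box_subset_torus_cell by auto
    then have "(\<lambda>n. clip (g n x)) \<longlonglongrightarrow> clip (f x)"
      using clip_cont by (intro isCont_tendsto_compose[of _ clip]) (auto simp: continuous_on_eq_continuous_at)
    then have "(\<lambda>n. of_real (cut n x) * clip (g n x)) \<longlonglongrightarrow> of_real 1 * clip (f x)"
      by (intro tendsto_intros cutlim x)
    then show ?thesis by (simp add: h_def clip_id x(3))
  qed
  have "(\<lambda>n. LINT x|torus. (cmod (f x - h n x))\<^sup>2) \<longlonglongrightarrow> (LINT x|(torus :: (real ^ 'n) measure). 0)"
  proof (rule integral_dominated_convergence[where w = "\<lambda>_. (2 * \<bar>B\<bar>)\<^sup>2"])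
    have neg: "negligible (?Q - ?O)" by (rule negligible_frontier_interval)
    have "AE x in torus. x \<in> torus_cell" by (auto simp: AE_space intro: AE_I2)
    then show "AE x in torus. (\<lambda>n. (cmod (f x - h n x))\<^sup>2) \<longlonglongrightarrow> 0"
      using bnd AE_torus_negligible[OF Z] AE_torus_negligible[OF neg]
    proof eventually_elim
      case (elim x)
      then have "x \<in> ?O" using torus_cell_subset_cbox by auto
      then have "(\<lambda>n. h n x) \<longlonglongrightarrow> f x" using elim by (intro h_lim) auto
      then have "(\<lambda>n. (cmod (f x - h n x))\<^sup>2) \<longlonglongrightarrow> (cmod (f x - f x))\<^sup>2"
        by (intro tendsto_intros)
      then show ?case by simp
    qed
    show "AE x in torus. norm ((cmod (f x - h n x))\<^sup>2) \<le> (2 * \<bar>B\<bar>)\<^sup>2" for n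
      using bnd
    proof eventually_elim
      case (elim x)
      have "cmod (f x - h n x) \<le> 2 * \<bar>B\<bar>"
        using norm_triangle_ineq4[of "f x" "h n x"] h_bound[of n x] elim by linarith
      then show ?case using power_mono[OF _ norm_ge_zero, of "f x - h n x" "2 * \<bar>B\<bar>" 2] by simp
    qed
    show "(\<lambda>x. (cmod (f x - h n x))\<^sup>2) \<in> borel_measurable torus" for n
      by (intro borel_measurable_power borel_measurable_norm[THEN measurable_compose[rotated]]
          borel_measurable_diff meas continuous_measurable_torus h_cont)
  qed (auto intro: integrable_torus_const)
  then have "(\<lambda>n. L2_norm (\<lambda>x. f x - h n x)) \<longlonglongrightarrow> sqrt 0"
    unfolding L2_norm_def by (intro tendsto_real_sqrt) simp
  then have "\<forall>\<^sub>F n in sequentially. L2_norm (\<lambda>x. f x - h n x) < e / 2"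
    using e by (intro order_tendstoD(2)) auto
  then obtain n where n: "L2_norm (\<lambda>x. f x - h n x) < e / 2"
    by (auto simp: eventually_sequentially)
  have "\<exists>N c. \<forall>x\<in>?Q. cmod (h n x - trig_poly N c x) < e / (2 * D)"
  proof (rule trig_poly_uniform_dense)
    show "continuous_on ?Q (h n)" using h_cont by (rule continuous_on_subset) auto
    fix x y assume xy: "x \<in> ?Q" "y \<in> ?Q" "torus_embed x = torus_embed y"
    show "h n x = h n y"
    proof (cases "x \<in> ?O \<or> y \<in> ?O")
      case True
      then have "x = y" using torus_embed_inj_box[of x y] torus_embed_inj_box[of y x] xy by auto
      then show ?thesis by simp
    qed (simp add: h_def cut0)
  qed (use e D in auto)
  then obtain N c where Nc: "\<And>x. x \<in> ?Q \<Longrightarrow> cmod (h n x - trig_poly N c x) < e / (2 * D)" by blast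
  have sq: "square_integrable (h n)" by (intro square_integrable_continuous h_cont)
  have "L2_norm (\<lambda>x. h n x - trig_poly N c x) \<le> sqrt (LINT x|(torus :: (real ^ 'n) measure). (e / (2 * D))\<^sup>2)"
    unfolding L2_norm_def
  proof (intro real_sqrt_le_mono integral_mono)
    show "integrable torus (\<lambda>x. (cmod (h n x - trig_poly N c x))\<^sup>2)"
      by (intro square_integrableD(2) square_integrable_diff sq) simp
    fix x assume "x \<in> space (torus :: (real ^ 'n) measure)"
    then have "x \<in> ?Q" using torus_cell_subset_cbox by auto
    then show "(cmod (h n x - trig_poly N c x))\<^sup>2 \<le> (e / (2 * D))\<^sup>2"
      using Nc by (intro power_mono) (auto simp: less_imp_le)
  qed (rule integrable_torus_const)
  also have "\<dots> = D * (e / (2 * D))"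
    using D e by (simp only: integral_torus_const) (simp add: real_sqrt_mult D_def)
  also have "\<dots> = e / 2" using D by simp
  finally have h_trig: "L2_norm (\<lambda>x. h n x - trig_poly N c x) \<le> e / 2" .
  have "L2_norm (\<lambda>x. f x - trig_poly N c x) \<le> L2_norm (\<lambda>x. f x - h n x) + L2_norm (\<lambda>x. h n x - trig_poly N c x)"
    using L2_norm_triangle[of "\<lambda>x. f x - h n x" "\<lambda>x. h n x - trig_poly N c x"]
      square_integrable_bounded[OF meas bnd] sq
    by (simp add: square_integrable_diff)
  then have "L2_norm (\<lambda>x. f x - trig_poly N c x) < e" using n h_trig by linarith
  then show ?thesis by blast
qed

text \<open>
  Outside the box \<open>|k| \<ge> N + 1\<close>, so that the tail of the Fourier series is bounded by the \<open>H\<^sup>1\<close>-sum divided by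
  \<open>(N + 1)\<^sup>2\<close>. Completeness enters by comparing with a good approximation whose frequencies may exceed the box. For
  \<open>N = 0\<close> this is Poincare's inequality.
\<close>

lemma L2_norm_diff_projection_le:
  fixes g :: "real ^ 'n \<Rightarrow> complex"
  assumes meas: "g \<in> borel_measurable torus" and bnd: "AE x in torus. cmod (g x) \<le> B"
    and H1: "\<And>F. finite F \<Longrightarrow> H1_sum F (fourier g) \<le> K\<^sup>2"
    and K: "K \<ge> 0"
  shows "L2_norm (\<lambda>x. g x - trig_poly N (fourier g) x) \<le> K / (real N + 1)"
proof (rule field_le_epsilon)
  fix e :: real assume "e > 0"
  from trig_poly_L2_dense[OF meas bnd this] obtain N1 c where c: "L2_norm (\<lambda>x. g x - trig_poly N1 c x) < e" by blast
  have sq: "square_integrable g" using square_integrable_bounded[OF meas bnd] .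
  define M where "M = max N N1"
  define c' where "c' = (\<lambda>k. if k \<in> freq_box N1 then c k else 0)"
  have "trig_poly N1 c = trig_poly M c'" unfolding c'_def by (rule trig_poly_extend) (simp add: M_def)
  moreover have "(L2_norm (\<lambda>x. g x - trig_poly M (fourier g) x))\<^sup>2 \<le> (L2_norm (\<lambda>x. g x - trig_poly M c' x))\<^sup>2"
    unfolding L2_norm_diff_trig_poly[OF sq] by (simp add: sum_nonneg)
  ultimately have "L2_norm (\<lambda>x. g x - trig_poly M (fourier g) x) \<le> L2_norm (\<lambda>x. g x - trig_poly N1 c x)"
    by (metis power2_le_imp_le L2_norm_nonneg)
  with c have 1: "L2_norm (\<lambda>x. g x - trig_poly M (fourier g) x) \<le> e" by simp
  define r where "r k = (if k \<in> freq_box N then 0 else fourier g k)" for k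
  have diff: "trig_poly M (fourier g) x - trig_poly N (fourier g) x = trig_poly M r x" for x
  proof -
    have "trig_poly N (fourier g) x = trig_poly M (\<lambda>k. if k \<in> freq_box N then fourier g k else 0) x"
      by (subst trig_poly_extend[of N M]) (auto simp: M_def)
    then show ?thesis by (simp add: trig_poly_diff r_def[abs_def] if_distrib cong: if_cong)
  qed
  \<comment> \<open>\<open>r\<close> lists the Fourier coefficients outside the box.\<close>
  have freq_ge: "(real N + 1)\<^sup>2 * (cmod (r k))\<^sup>2 \<le> (norm (freq k))\<^sup>2 * (cmod (fourier g k))\<^sup>2" for k
  proof (cases "k \<in> freq_box N")
    case False
    then obtain i where "\<not> \<bar>k $ i\<bar> \<le> int N" by (auto simp: freq_box_def)
    then have "real N + 1 \<le> \<bar>freq k $ i\<bar>" by (simp add: freq_def)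
    also have "\<dots> \<le> norm (freq k)" by (rule component_le_norm_cart)
    finally show ?thesis using False by (intro mult_mono power_mono) (auto simp: r_def)
  qed (simp add: r_def)
  have "(real N + 1)\<^sup>2 * (L2_norm (trig_poly M r :: real ^ 'n \<Rightarrow> complex))\<^sup>2
      = (2 * pi) ^ CARD('n) * (\<Sum>k\<in>freq_box M. (real N + 1)\<^sup>2 * (cmod (r k))\<^sup>2)"
    by (simp add: L2_norm_trig_poly sum_distrib_left mult_ac)
  also have "\<dots> \<le> H1_sum (freq_box M) (fourier g)"
    using freq_ge by (intro mult_left_mono sum_mono) auto
  also have "\<dots> \<le> K\<^sup>2" by (rule H1) simp
  finally have "((real N + 1) * L2_norm (trig_poly M r :: real ^ 'n \<Rightarrow> complex))\<^sup>2 \<le> K\<^sup>2"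
    by (simp add: power_mult_distrib)
  then have "(real N + 1) * L2_norm (trig_poly M r :: real ^ 'n \<Rightarrow> complex) \<le> K"
    using K by (rule power2_le_imp_le)
  then have 2: "L2_norm (trig_poly M r :: real ^ 'n \<Rightarrow> complex) \<le> K / (real N + 1)"
    by (simp add: pos_le_divide_eq mult.commute)
  have "L2_norm (\<lambda>x. g x - trig_poly N (fourier g) x)
      \<le> L2_norm (\<lambda>x. g x - trig_poly M (fourier g) x) + L2_norm (trig_poly M r :: real ^ 'n \<Rightarrow> complex)"
    using L2_norm_triangle[of "\<lambda>x. g x - trig_poly M (fourier g) x" "trig_poly M r"] sq
    by (simp add: square_integrable_diff diff[symmetric])
  then show "L2_norm (\<lambda>x. g x - trig_poly N (fourier g) x) \<le> K / (real N + 1) + e"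
    using 1 2 by simp
qed

section \<open>Lipschitz images of trigonometric polynomials\<close>

lemma continuous_phase_flow:
  assumes "continuous_on S w"
  shows "continuous_on S (\<lambda>x. phase_flow lam t (w x))"
proof -
  have "continuous_on S (\<lambda>x. (t, w x))" by (intro continuous_intros assms)
  from continuous_on_compose2[OF continuous_phase_flow_joint[of lam] this] show ?thesis by simp
qed

lemma periodic_compose: "periodic w \<Longrightarrow> periodic (\<lambda>x. F (w x))"
  by (simp add: periodic_def)

lemma fourier_translate:
  fixes g :: "real ^ 'n \<Rightarrow> complex"
  assumes "continuous_on UNIV g" "periodic g" "0 \<le> h" "h \<le> 2 * pi"
  shows "fourier (\<lambda>x. g (x + h *\<^sub>R axis j 1)) k = cis (h * real_of_int (k $ j)) * fourier g k"
proof -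
  let ?G = "\<lambda>x. g x * cis (- (freq k \<bullet> x))"
  have "periodic (\<lambda>x. cis (- (freq k \<bullet> x)))"
    using periodic_compose[OF periodic_cis_freq[of k], of cnj] by (simp add: cis_cnj)
  then have per: "periodic ?G" using assms(2) by (simp add: periodic_def)
  have "(LINT x|torus. ?G x) = (LINT x|torus. ?G (x + h *\<^sub>R axis j 1))"
    by (rule periodic_integral_translate[OF _ per assms(3,4), symmetric]) (intro continuous_intros assms)
  also have "\<dots> = (LINT x|torus. cis (- (h * real_of_int (k $ j))) * (g (x + h *\<^sub>R axis j 1) * cis (- (freq k \<bullet> x))))"
  proof -
    have "cis (- (freq k \<bullet> (x + h *\<^sub>R axis j 1))) = cis (- (h * real_of_int (k $ j))) * cis (- (freq k \<bullet> x))" for x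
    proof -
      have "- (freq k \<bullet> (x + h *\<^sub>R axis j 1)) = - (h * real_of_int (k $ j)) + - (freq k \<bullet> x)"
        by (simp add: inner_add_right inner_axis freq_def)
      then show ?thesis by (simp only: cis_mult)
    qed
    then show ?thesis by (simp only: mult.left_commute)
  qed
  also have "\<dots> = cis (- (h * real_of_int (k $ j))) * (LINT x|torus. g (x + h *\<^sub>R axis j 1) * cis (- (freq k \<bullet> x)))"
    by simp
  finally have "cis (h * real_of_int (k $ j)) * (LINT x|torus. ?G x)
      = (cis (h * real_of_int (k $ j)) * cis (- (h * real_of_int (k $ j)))) * (LINT x|torus. g (x + h *\<^sub>R axis j 1) * cis (- (freq k \<bullet> x)))"
    by (simp only: mult.assoc)
  then show ?thesis by (simp add: fourier_def cis_mult)
qed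

lemma power2_norm_freq: "(norm (freq k))\<^sup>2 = (\<Sum>j\<in>UNIV. (real_of_int (k $ j))\<^sup>2)"
  by (simp add: norm_vec_def L2_set_def sum_nonneg freq_def)

text \<open>
  A map that contracts distances up to a factor \<open>L\<close> contracts translation differences by the same factor, and in Fourier
  coefficients the translate by \<open>h\<close> minus the function is multiplication by \<open>exp (\<i> h k\<^sub>j) - 1\<close>. Dividing by \<open>h\<close> and
  letting \<open>h\<close> tend to \<open>0\<close> replaces this factor by \<open>\<i> k\<^sub>j\<close>.
\<close>

lemma H1_sum_le_of_lipschitz:
  fixes b :: "real ^ 'n \<Rightarrow> complex"
  assumes b: "continuous_on UNIV b" "periodic b" and L: "L \<ge> 0"
    and lip: "\<And>x y. cmod (b x - b y) \<le> L * cmod (trig_poly N c x - trig_poly N c y)"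
    and F: "finite F"
  shows "(\<Sum>k\<in>F. (norm (freq k))\<^sup>2 * (cmod (fourier b k))\<^sup>2)
    \<le> L\<^sup>2 * (\<Sum>k\<in>freq_box N. (norm (freq k))\<^sup>2 * (cmod (c k))\<^sup>2)"
proof -
  have coord: "(\<Sum>k\<in>F. (real_of_int (k $ j))\<^sup>2 * (cmod (fourier b k))\<^sup>2)
      \<le> L\<^sup>2 * (\<Sum>k\<in>freq_box N. (real_of_int (k $ j))\<^sup>2 * (cmod (c k))\<^sup>2)" for j
  proof (rule tendsto_upperbound)
    have "((\<lambda>h. sin (h * a) / h) \<longlongrightarrow> a) (at_right 0)" for a :: real
    proof -
      have "((\<lambda>h. sin (h * a)) has_real_derivative a) (at 0)"
        by (auto intro!: derivative_eq_intros)
      then have "((\<lambda>h. sin (h * a) / h) \<longlongrightarrow> a) (at 0)"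
        by (simp add: DERIV_def)
      then show ?thesis by (rule filterlim_mono[OF _ order_refl]) (simp add: at_le)
    qed
    then show "((\<lambda>h. \<Sum>k\<in>F. (sin (h * real_of_int (k $ j)) / h)\<^sup>2 * (cmod (fourier b k))\<^sup>2)
        \<longlongrightarrow> (\<Sum>k\<in>F. (real_of_int (k $ j))\<^sup>2 * (cmod (fourier b k))\<^sup>2)) (at_right 0)"
      by (intro tendsto_intros)
    have "(\<Sum>k\<in>F. (sin (h * real_of_int (k $ j)) / h)\<^sup>2 * (cmod (fourier b k))\<^sup>2)
        \<le> L\<^sup>2 * (\<Sum>k\<in>freq_box N. (real_of_int (k $ j))\<^sup>2 * (cmod (c k))\<^sup>2)" if h: "0 < h" "h < 1" for h
    proof -
      have h2: "0 \<le> h" "h \<le> 2 * pi" using h pi_gt3 by auto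
      let ?z = "\<lambda>k. cis (h * real_of_int (k $ j)) - 1 :: complex"
      let ?\<tau>b = "\<lambda>x. b (x + h *\<^sub>R axis j 1)"
      have \<tau>b: "continuous_on UNIV ?\<tau>b" by (intro continuous_on_compose2[OF b(1)] continuous_intros) auto
      have "(2 * pi) ^ CARD('n) * (\<Sum>k\<in>F. (sin (h * real_of_int (k $ j)))\<^sup>2 * (cmod (fourier b k))\<^sup>2)
          \<le> (2 * pi) ^ CARD('n) * (\<Sum>k\<in>F. (cmod (fourier (\<lambda>x. ?\<tau>b x - b x) k))\<^sup>2)"
      proof (intro mult_left_mono sum_mono)
        fix k
        have "fourier (\<lambda>x. ?\<tau>b x - b x) k = ?z k * fourier b k"
          using fourier_translate[OF b h2] fourier_diff[OF continuous_integrable_torus[OF \<tau>b] continuous_integrable_torus[OF b(1)]]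
          by (simp add: algebra_simps)
        moreover have "(sin (h * real_of_int (k $ j)))\<^sup>2 \<le> (cmod (?z k))\<^sup>2"
          using abs_Im_le_cmod[of "?z k"] by (subst abs_le_square_iff[symmetric]) simp
        ultimately show "(sin (h * real_of_int (k $ j)))\<^sup>2 * (cmod (fourier b k))\<^sup>2 \<le> (cmod (fourier (\<lambda>x. ?\<tau>b x - b x) k))\<^sup>2"
          by (simp add: norm_mult power_mult_distrib mult_right_mono)
      qed simp
      also have "\<dots> \<le> (L2_norm (\<lambda>x. ?\<tau>b x - b x))\<^sup>2"
        by (intro Bessel square_integrable_continuous continuous_intros \<tau>b b F)
      also have "\<dots> \<le> (L2_norm (\<lambda>x. of_real L * trig_poly N (\<lambda>k. ?z k * c k) x))\<^sup>2"
      proof (intro power_mono L2_norm_mono square_integrable_scale square_integrable_trig_poly)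
        fix x
        have "trig_poly N (\<lambda>k. ?z k * c k) x = trig_poly N c (x + h *\<^sub>R axis j 1) - trig_poly N c x"
          by (simp add: trig_poly_translate trig_poly_diff algebra_simps)
        then show "cmod (?\<tau>b x - b x) \<le> cmod (of_real L * trig_poly N (\<lambda>k. ?z k * c k) x)"
          using lip[of "x + h *\<^sub>R axis j 1" x] L by (simp add: norm_mult)
      qed simp
      also have "\<dots> = L\<^sup>2 * ((2 * pi) ^ CARD('n) * (\<Sum>k\<in>freq_box N. (cmod (?z k * c k))\<^sup>2))"
        by (simp only: L2_norm_scale power_mult_distrib[of "cmod _" "L2_norm _"] L2_norm_trig_poly) simp
      also have "(cmod (?z k * c k))\<^sup>2 \<le> h\<^sup>2 * ((real_of_int (k $ j))\<^sup>2 * (cmod (c k))\<^sup>2)" for k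
        using power_mono[OF norm_cis_minus_1_le[of "h * real_of_int (k $ j)"], of 2]
        by (simp add: norm_mult power_mult_distrib mult_right_mono flip: mult.assoc)
      then have "L\<^sup>2 * ((2 * pi) ^ CARD('n) * (\<Sum>k\<in>freq_box N. (cmod (?z k * c k))\<^sup>2))
          \<le> L\<^sup>2 * ((2 * pi) ^ CARD('n) * (\<Sum>k\<in>freq_box N. h\<^sup>2 * ((real_of_int (k $ j))\<^sup>2 * (cmod (c k))\<^sup>2)))"
        by (intro mult_left_mono sum_mono) auto
      also have "\<dots> = (2 * pi) ^ CARD('n) * (h\<^sup>2 * (L\<^sup>2 * (\<Sum>k\<in>freq_box N. (real_of_int (k $ j))\<^sup>2 * (cmod (c k))\<^sup>2)))"
        by (simp add: sum_distrib_left mult_ac)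
      finally have "(\<Sum>k\<in>F. (sin (h * real_of_int (k $ j)))\<^sup>2 * (cmod (fourier b k))\<^sup>2)
          \<le> h\<^sup>2 * (L\<^sup>2 * (\<Sum>k\<in>freq_box N. (real_of_int (k $ j))\<^sup>2 * (cmod (c k))\<^sup>2))"
        by (subst (asm) mult_le_cancel_left_pos) auto
      then show ?thesis using h by (simp add: power_divide sum_divide_distrib[symmetric] pos_divide_le_eq mult.commute)
    qed
    then show "\<forall>\<^sub>F h in at_right 0. (\<Sum>k\<in>F. (sin (h * real_of_int (k $ j)) / h)\<^sup>2 * (cmod (fourier b k))\<^sup>2)
        \<le> L\<^sup>2 * (\<Sum>k\<in>freq_box N. (real_of_int (k $ j))\<^sup>2 * (cmod (c k))\<^sup>2)"
      using eventually_at_right_real[of 0 "1 :: real"] by (auto elim!: eventually_mono)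
  qed (simp add: trivial_limit_at_right_real)
  have "(\<Sum>k\<in>F. (norm (freq k))\<^sup>2 * (cmod (fourier b k))\<^sup>2)
      = (\<Sum>j\<in>UNIV. \<Sum>k\<in>F. (real_of_int (k $ j))\<^sup>2 * (cmod (fourier b k))\<^sup>2)"
    unfolding power2_norm_freq sum_distrib_right by (rule sum.swap)
  also have "\<dots> \<le> (\<Sum>j\<in>UNIV. L\<^sup>2 * (\<Sum>k\<in>freq_box N. (real_of_int (k $ j))\<^sup>2 * (cmod (c k))\<^sup>2))"
    by (intro sum_mono coord)
  also have "\<dots> = L\<^sup>2 * (\<Sum>k\<in>freq_box N. (norm (freq k))\<^sup>2 * (cmod (c k))\<^sup>2)"
    unfolding power2_norm_freq sum_distrib_right sum_distrib_left[symmetric] by (subst sum.swap) simp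
  finally show ?thesis .
qed

section \<open>The nonlinearity tested against trigonometric polynomials\<close>

lemma log_nonlinearity_borel [measurable]: "log_nonlinearity \<in> borel_measurable borel"
  by (intro borel_measurable_continuous_onI continuous_log_nonlinearity continuous_on_id)

lemma integrable_log_nonlinearity:
  assumes "square_integrable f"
  shows "integrable torus (\<lambda>x. log_nonlinearity (f x))"
proof (rule Bochner_Integration.integrable_bound)
  show "integrable torus (\<lambda>x. 4 + 2 * (cmod (f x))\<^sup>2)"
    by (intro Bochner_Integration.integrable_add Bochner_Integration.integrable_mult_right
        square_integrableD(2) assms integrable_torus_const)
  show "(\<lambda>x. log_nonlinearity (f x)) \<in> borel_measurable torus"
    by (rule measurable_compose[OF square_integrableD(1)[OF assms] log_nonlinearity_borel])
  show "AE x in torus. norm (log_nonlinearity (f x)) \<le> norm (4 + 2 * (cmod (f x))\<^sup>2)"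
    using norm_log_nonlinearity_le by auto
qed

lemma integrable_gauged_nonlinearity:
  assumes "square_integrable f"
  shows "integrable torus (\<lambda>x. gauged_nonlinearity \<kappa> (f x))"
  unfolding gauged_nonlinearity_def
  by (intro Bochner_Integration.integrable_diff Bochner_Integration.integrable_mult_right
      integrable_log_nonlinearity square_integrable_imp_integrable assms)

lemma integrable_mult_cnj_trig_poly:
  fixes f :: "real ^ 'n \<Rightarrow> complex"
  assumes "integrable torus f"
  shows "integrable torus (\<lambda>x. f x * cnj (trig_poly N c x))"
proof -
  have "(\<lambda>x. f x * cnj (trig_poly N c x)) = (\<lambda>x. \<Sum>k\<in>freq_box N. (f x * cis (- (freq k \<bullet> x))) * cnj (c k))"
    by (simp add: trig_poly_def sum_distrib_left cis_cnj mult_ac)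
  then show ?thesis
    by (simp only:) (intro Bochner_Integration.integrable_sum Bochner_Integration.integrable_mult_left
        integrable_torus_mult_cis_minus assms)
qed

definition sqrt_cell_volume :: "nat \<Rightarrow> real" where
  "sqrt_cell_volume d = sqrt ((2 * pi) ^ d)"

lemma sqrt_cell_volume_ge_1: "sqrt_cell_volume d \<ge> 1"
proof -
  have "1 \<le> (2 * pi) ^ d" using pi_gt3 by (intro one_le_power) auto
  then show ?thesis by (simp only: sqrt_cell_volume_def real_sqrt_ge_1_iff)
qed

text \<open>
  The number of frequencies in the box is \<open>(2N + 1)\<^sup>d \<le> (3N)\<^sup>d\<close>; the Cauchy-Schwarz inequality would even give the square
  root of this number, but only its logarithm matters in the end.
\<close>

lemma norm_trig_poly_le:
  assumes "N \<ge> 1"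
  shows "cmod (trig_poly N c (x :: real ^ 'n)) \<le> 3 ^ CARD('n) * real N ^ CARD('n) * L2_norm (trig_poly N c :: real ^ 'n \<Rightarrow> complex)"
proof -
  let ?S = "\<Sum>k\<in>(freq_box N :: (int ^ 'n) set). (cmod (c k))\<^sup>2"
  define Y where "Y = 3 ^ CARD('n) * real N ^ CARD('n)"
  define P where "P = (2 * pi) ^ CARD('n)"
  define \<Phi> where "\<Phi> = L2_norm (trig_poly N c :: real ^ 'n \<Rightarrow> complex)"
  have Y: "Y = (3 * real N) ^ CARD('n)"
    unfolding Y_def by (rule power_mult_distrib[symmetric])
  have P1: "1 \<le> P" unfolding P_def using pi_gt3 by (intro one_le_power) auto
  have S0: "0 \<le> ?S" by (intro sum_nonneg) auto
  have "(2 * real N + 1) ^ CARD('n) \<le> (3 * real N) ^ CARD('n)"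
    using assms by (intro power_mono) auto
  then have card: "real (card (freq_box N :: (int ^ 'n) set)) \<le> Y"
    unfolding card_freq_box Y by (simp add: add.commute)
  have one: "1 \<le> Y"
    unfolding Y using assms by (intro one_le_power) auto
  have "cmod (trig_poly N c x) \<le> (\<Sum>k\<in>freq_box N. cmod (c k) * 1)"
    unfolding trig_poly_def by (rule sum_norm_le) (simp add: norm_mult)
  then have "(cmod (trig_poly N c x))\<^sup>2 \<le> (\<Sum>k\<in>freq_box N. cmod (c k) * 1)\<^sup>2"
    by (rule power_mono) simp
  also have "\<dots> \<le> ?S * (\<Sum>k\<in>(freq_box N :: (int ^ 'n) set). 1\<^sup>2)"
    by (rule Cauchy_Schwarz_ineq_sum)
  also have "\<dots> = real (card (freq_box N :: (int ^ 'n) set)) * ?S" by simp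
  also have "\<dots> \<le> Y\<^sup>2 * (P * ?S)"
  proof (rule mult_mono)
    have "Y * 1 \<le> Y * Y" using one by (intro mult_left_mono) auto
    then show "real (card (freq_box N :: (int ^ 'n) set)) \<le> Y\<^sup>2"
      using card unfolding power2_eq_square by linarith
    show "?S \<le> P * ?S" using mult_right_mono[OF P1 S0] by simp
  qed (use S0 in simp_all)
  also have "P * ?S = \<Phi>\<^sup>2"
    unfolding P_def \<Phi>_def by (rule L2_norm_trig_poly[symmetric])
  also have "Y\<^sup>2 * \<Phi>\<^sup>2 = (Y * \<Phi>)\<^sup>2" by (rule power_mult_distrib[symmetric])
  finally have "cmod (trig_poly N c x) \<le> Y * \<Phi>"
    by (rule power2_le_imp_le) (use one in \<open>simp add: \<Phi>_def\<close>)
  then show ?thesis by (simp only: Y_def \<Phi>_def)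
qed

lemma L2_norm_trig_poly_mono:
  assumes "\<And>k. k \<in> freq_box N \<Longrightarrow> cmod (c k) \<le> cmod (c' k)"
  shows "L2_norm (trig_poly N c :: real ^ 'n \<Rightarrow> complex) \<le> L2_norm (trig_poly N c' :: real ^ 'n \<Rightarrow> complex)"
proof (rule power2_le_imp_le)
  show "(L2_norm (trig_poly N c :: real ^ 'n \<Rightarrow> complex))\<^sup>2 \<le> (L2_norm (trig_poly N c' :: real ^ 'n \<Rightarrow> complex))\<^sup>2"
    unfolding L2_norm_trig_poly using assms by (intro mult_left_mono sum_mono power_mono) auto
qed simp

text \<open>
  The three summands stem from the logarithmic factor \<open>1 + ln (4N) + d ln N\<close>, from the large values and from the small
  values in \<open>gauged_nonlinearity_diff_le\<close>, with every constant replaced by at most \<open>2 ln N\<close> times itself.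
\<close>

definition pairing_const :: "nat \<Rightarrow> real \<Rightarrow> real" where
  "pairing_const d \<Theta> = 2 * (5 + real d) + 4 * 3 ^ d * (2 * sqrt_cell_volume d + \<Theta>) + 4 * (1 + sqrt_cell_volume d)"

lemma pairing_const_pos: "\<Theta> \<ge> 0 \<Longrightarrow> pairing_const d \<Theta> > 0"
  using sqrt_cell_volume_ge_1[of d] by (simp add: pairing_const_def add_pos_nonneg)

text \<open>
  This is where \<open>N \<ge> 2\<close> enters: bounded quantities can be absorbed into \<open>ln N\<close>.
\<close>

lemma one_le_2_ln: "N \<ge> 2 \<Longrightarrow> 1 \<le> 2 * ln (real N)"
  using ln2_ge_two_thirds ln_mono[of 2 "real N"] by linarith

text \<open>
  The main estimate. The pointwise bound is used with \<open>R = N\<^sup>d\<close>: the term with \<open>(|p| + |q|)/(\<kappa>R)\<close>, which is quadratic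
  in the functions, is integrated with the test function estimated by its maximum, which is of order \<open>R\<close>. All other terms
  are products of two square-integrable functions.
\<close>

lemma gauged_difference_pairing_le:
  fixes p q :: "real ^ 'n \<Rightarrow> complex"
  assumes p: "square_integrable p" and q: "square_integrable q"
    and K: "K > 0" and M: "L2_norm (\<lambda>x. p x - M) \<le> K" and \<Theta>: "\<Theta> \<ge> 0" "L2_norm (\<lambda>x. p x - q x) \<le> \<Theta> * K"
    and N: "N \<ge> 2"
  shows "cmod (LINT x|torus. (gauged_nonlinearity (cmod M + K) (p x) - gauged_nonlinearity (cmod M + K) (q x)) * cnj (trig_poly N c x))
    \<le> pairing_const CARD('n) \<Theta> * ln (real N) * (L2_norm (\<lambda>x. p x - q x) + K / real N) * L2_norm (trig_poly N c :: real ^ 'n \<Rightarrow> complex)"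
proof -
  define \<kappa> where "\<kappa> = cmod M + K"
  define \<phi> where "\<phi> = (trig_poly N c :: real ^ 'n \<Rightarrow> complex)"
  define R where "R = real N ^ CARD('n)"
  define D where "D = sqrt_cell_volume CARD('n)"
  define \<epsilon> where "\<epsilon> = L2_norm (\<lambda>x. p x - q x)"
  define \<Phi> where "\<Phi> = L2_norm \<phi>"
  define l where "l = ln (real N)"
  define Z where "Z = (3 :: real) ^ CARD('n)"
  have \<kappa>: "\<kappa> > 0" using K by (simp add: \<kappa>_def add_nonneg_pos)
  have R: "R \<ge> 1" using N by (simp add: R_def one_le_power)
  have D: "D \<ge> 1" by (simp add: D_def sqrt_cell_volume_ge_1)
  have l: "1 \<le> 2 * l" unfolding l_def by (rule one_le_2_ln[OF N])
  have Z: "Z \<ge> 1" by (simp add: Z_def)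
  have \<epsilon>: "\<epsilon> \<ge> 0" and \<Phi>: "\<Phi> \<ge> 0" by (simp_all add: \<epsilon>_def \<Phi>_def)
  have sq\<phi>: "square_integrable \<phi>" by (simp add: \<phi>_def)
  have sqM: "square_integrable (\<lambda>x :: real ^ 'n. a)" for a by (intro square_integrable_continuous continuous_intros)
  have sqpq: "square_integrable (\<lambda>x. p x - q x)" and sqpM: "square_integrable (\<lambda>x. p x - M)"
    using p q sqM by (auto intro: square_integrable_diff)
  have sup: "cmod (\<phi> x) \<le> Z * R * \<Phi>" for x
    unfolding \<phi>_def \<Phi>_def R_def Z_def using N by (intro norm_trig_poly_le) auto
  define A where "A = 2 * (1 + ln (4 * real N) + ln R)"
  have A0: "A \<ge> 0" using N R by (simp add: A_def)
  have norm_const: "L2_norm (\<lambda>x :: real ^ 'n. a) = D * cmod a" for a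
    by (simp add: L2_norm_const D_def sqrt_cell_volume_def)
  define rhs where "rhs x = A * (cmod (p x - q x) * cmod (\<phi> x))
      + 2 * Z * \<Phi> / \<kappa> * (cmod (p x - q x) * cmod (p x))
      + 2 * Z * \<Phi> / \<kappa> * (cmod (p x - q x) * cmod (q x))
      + 2 / real N * (cmod (p x - M) * cmod (\<phi> x)) + 2 / real N * (cmod (of_real K :: complex) * cmod (\<phi> x))" for x
  have int_terms: "integrable torus (\<lambda>x. cmod (p x - q x) * cmod (\<phi> x))"
     "integrable torus (\<lambda>x. cmod (p x - q x) * cmod (p x))"
     "integrable torus (\<lambda>x. cmod (p x - q x) * cmod (q x))"
     "integrable torus (\<lambda>x. cmod (p x - M) * cmod (\<phi> x))"
     "integrable torus (\<lambda>x. cmod (of_real K :: complex) * cmod (\<phi> x))"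
    by (intro square_integrable_mult_integrable sqpq sqpM sq\<phi> p q sqM)+
  have int_rhs: "integrable torus rhs"
    unfolding rhs_def by (intro Bochner_Integration.integrable_add Bochner_Integration.integrable_mult_right int_terms)
  let ?lhs = "\<lambda>x. (gauged_nonlinearity \<kappa> (p x) - gauged_nonlinearity \<kappa> (q x)) * cnj (\<phi> x)"
  have int_lhs: "integrable torus ?lhs"
    unfolding \<phi>_def by (intro integrable_mult_cnj_trig_poly Bochner_Integration.integrable_diff integrable_gauged_nonlinearity p q)
  have pointwise: "cmod (?lhs x) \<le> rhs x" for x
  proof -
    have "cmod (?lhs x) \<le> (2 * cmod (p x - q x) * (1 + ln (4 * real N) + ln R + (cmod (p x) + cmod (q x)) / (\<kappa> * R))
      + 2 * (cmod (p x - M) + K) / real N) * cmod (\<phi> x)"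
      unfolding norm_mult complex_mod_cnj using N R K
      by (intro mult_right_mono gauged_nonlinearity_diff_le) (auto simp: \<kappa>_def)
    also have "\<dots> = A * (cmod (p x - q x) * cmod (\<phi> x))
        + 2 * cmod (p x - q x) * ((cmod (p x) + cmod (q x)) / (\<kappa> * R)) * cmod (\<phi> x)
        + 2 / real N * (cmod (p x - M) * cmod (\<phi> x)) + 2 / real N * (K * cmod (\<phi> x))"
      by (simp add: A_def algebra_simps add_divide_distrib)
    also have "2 * cmod (p x - q x) * ((cmod (p x) + cmod (q x)) / (\<kappa> * R)) * cmod (\<phi> x)
        \<le> 2 * cmod (p x - q x) * ((cmod (p x) + cmod (q x)) / (\<kappa> * R)) * (Z * R * \<Phi>)"
      using \<kappa> R by (intro mult_left_mono sup) auto
    also have "\<dots> = 2 * Z * \<Phi> / \<kappa> * (cmod (p x - q x) * cmod (p x)) + 2 * Z * \<Phi> / \<kappa> * (cmod (p x - q x) * cmod (q x))"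
      using \<kappa> R by (simp add: field_simps)
    finally show ?thesis using K by (simp add: rhs_def)
  qed
  have "cmod (LINT x|torus. ?lhs x) \<le> (LINT x|torus. cmod (?lhs x))" by (rule integral_norm_bound)
  also have "\<dots> \<le> (LINT x|torus. rhs x)"
    by (intro integral_mono integrable_norm int_lhs int_rhs pointwise)
  also have "\<dots> = A * (LINT x|torus. cmod (p x - q x) * cmod (\<phi> x))
      + 2 * Z * \<Phi> / \<kappa> * (LINT x|torus. cmod (p x - q x) * cmod (p x))
      + 2 * Z * \<Phi> / \<kappa> * (LINT x|torus. cmod (p x - q x) * cmod (q x))
      + 2 / real N * (LINT x|torus. cmod (p x - M) * cmod (\<phi> x)) + 2 / real N * (LINT x|torus. cmod (of_real K :: complex) * cmod (\<phi> x))"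
    unfolding rhs_def
    by (simp only: Bochner_Integration.integral_add Bochner_Integration.integral_mult_right_zero
        int_terms Bochner_Integration.integrable_add Bochner_Integration.integrable_mult_right)
  also have "\<dots> \<le> A * (\<epsilon> * \<Phi>) + 2 * Z * \<Phi> / \<kappa> * (\<epsilon> * L2_norm p) + 2 * Z * \<Phi> / \<kappa> * (\<epsilon> * L2_norm q)
      + 2 / real N * (L2_norm (\<lambda>x. p x - M) * \<Phi>) + 2 / real N * (L2_norm (\<lambda>x :: real ^ 'n. of_real K) * \<Phi>)"
    unfolding \<epsilon>_def \<Phi>_def using A0 \<kappa> Z
    by (intro add_mono mult_left_mono L2_Cauchy_Schwarz sqpq sqpM sq\<phi> p q sqM) auto
  also have "\<dots> \<le> A * (\<epsilon> * \<Phi>) + 2 * Z * \<Phi> / \<kappa> * (\<epsilon> * (D * \<kappa>)) + 2 * Z * \<Phi> / \<kappa> * (\<epsilon> * ((D + \<Theta>) * \<kappa>))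
      + 2 / real N * (K * \<Phi>) + 2 / real N * (D * K * \<Phi>)"
  proof -
    have "L2_norm p \<le> L2_norm (\<lambda>x. p x - M) + D * cmod M"
      using L2_norm_triangle_sub[OF p sqM[of M]] by (simp add: norm_const)
    also have "\<dots> \<le> D * K + D * cmod M"
      using M mult_right_mono[OF D less_imp_le[OF K]] by simp
    finally have Lp: "L2_norm p \<le> D * \<kappa>" by (simp add: \<kappa>_def algebra_simps)
    have "L2_norm q \<le> L2_norm (\<lambda>x. p x - q x) + L2_norm p"
      by (subst L2_norm_minus_commute[of p q]) (rule L2_norm_triangle_sub[OF q p])
    also have "\<dots> \<le> \<Theta> * \<kappa> + D * \<kappa>"
    proof -
      have "\<Theta> * K \<le> \<Theta> * \<kappa>" using \<Theta>(1) by (intro mult_left_mono) (auto simp: \<kappa>_def)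
      then show ?thesis using \<Theta>(2) Lp by linarith
    qed
    finally have Lq: "L2_norm q \<le> (D + \<Theta>) * \<kappa>" by (simp add: algebra_simps)
    show ?thesis
      using A0 \<kappa> Z \<epsilon> \<Phi> K M Lp Lq
      by (intro add_mono mult_left_mono mult_right_mono order_refl) (auto simp: norm_const)
  qed
  also have "\<dots> = A * (\<epsilon> * \<Phi>) + 2 * Z * (2 * D + \<Theta>) * (\<epsilon> * \<Phi>) + 2 * (1 + D) * (K / real N * \<Phi>)"
    using \<kappa> N by (simp add: field_simps)
  also have "\<dots> \<le> 2 * (5 + real CARD('n)) * l * (\<epsilon> * \<Phi>) + 2 * Z * (2 * D + \<Theta>) * (2 * l) * (\<epsilon> * \<Phi>)
      + 2 * (1 + D) * (2 * l) * (K / real N * \<Phi>)"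
  proof (intro add_mono mult_right_mono)
    have "ln 4 = 2 * ln (2 :: real)" using ln_realpow[of 2 2] by simp
    moreover have "ln 2 \<le> l" unfolding l_def using N by (intro ln_mono) auto
    moreover have "ln (4 * real N) = ln 4 + l" using N by (simp add: ln_mult l_def)
    moreover have "ln R = real CARD('n) * l" using N by (simp add: R_def l_def ln_realpow)
    ultimately have "1 + ln (4 * real N) + ln R \<le> 2 * l + 2 * l + l + real CARD('n) * l"
      using l by linarith
    then show "A \<le> 2 * (5 + real CARD('n)) * l" by (simp add: A_def algebra_simps)
    show "2 * Z * (2 * D + \<Theta>) \<le> 2 * Z * (2 * D + \<Theta>) * (2 * l)"
      using mult_left_mono[OF l, of "2 * Z * (2 * D + \<Theta>)"] Z D \<Theta>(1) by simp
    show "2 * (1 + D) \<le> 2 * (1 + D) * (2 * l)"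
      using mult_left_mono[OF l, of "2 * (1 + D)"] D by simp
  qed (use \<epsilon> \<Phi> K in auto)
  also have "\<dots> \<le> pairing_const CARD('n) \<Theta> * (l * (\<epsilon> * \<Phi>)) + pairing_const CARD('n) \<Theta> * (l * (K / real N * \<Phi>))"
  proof (rule add_mono)
    have l0: "l \<ge> 0" using l by simp
    have "2 * (5 + real CARD('n)) + 4 * Z * (2 * D + \<Theta>) \<le> pairing_const CARD('n) \<Theta>"
      using D by (simp add: pairing_const_def Z_def D_def)
    from mult_right_mono[OF this, of "l * (\<epsilon> * \<Phi>)"]
    show "2 * (5 + real CARD('n)) * l * (\<epsilon> * \<Phi>) + 2 * Z * (2 * D + \<Theta>) * (2 * l) * (\<epsilon> * \<Phi>)
        \<le> pairing_const CARD('n) \<Theta> * (l * (\<epsilon> * \<Phi>))"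
      using l0 \<epsilon> \<Phi> by (simp add: algebra_simps)
    have "4 * (1 + D) \<le> pairing_const CARD('n) \<Theta>"
      using D Z \<Theta>(1) by (simp add: pairing_const_def Z_def D_def)
    from mult_right_mono[OF this, of "l * (K / real N * \<Phi>)"]
    show "2 * (1 + D) * (2 * l) * (K / real N * \<Phi>) \<le> pairing_const CARD('n) \<Theta> * (l * (K / real N * \<Phi>))"
      using l0 K \<Phi> by (simp add: algebra_simps)
  qed
  also have "\<dots> = pairing_const CARD('n) \<Theta> * l * (\<epsilon> + K / real N) * \<Phi>" by (simp add: algebra_simps)
  finally show ?thesis by (simp only: \<kappa>_def \<phi>_def \<epsilon>_def \<Phi>_def l_def)
qed

text \<open>
  If \<open>p - q\<close> has no frequencies in the box, then the multiple of the identity that distinguishes the gauged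
  nonlinearity from the original one is invisible to the test function.
\<close>

lemma log_difference_pairing_le:
  fixes p q :: "real ^ 'n \<Rightarrow> complex"
  assumes p: "square_integrable p" and q: "square_integrable q"
    and K: "K > 0" and M: "L2_norm (\<lambda>x. p x - M) \<le> K" and \<Theta>: "\<Theta> \<ge> 0" "L2_norm (\<lambda>x. p x - q x) \<le> \<Theta> * K"
    and N: "N \<ge> 2" and proj: "\<And>k. k \<in> freq_box N \<Longrightarrow> fourier p k = fourier q k"
  shows "cmod (LINT x|torus. (log_nonlinearity (p x) - log_nonlinearity (q x)) * cnj (trig_poly N c x))
    \<le> pairing_const CARD('n) \<Theta> * ln (real N) * (L2_norm (\<lambda>x. p x - q x) + K / real N) * L2_norm (trig_poly N c :: real ^ 'n \<Rightarrow> complex)"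
proof -
  let ?a = "of_real (2 * ln (cmod M + K)) :: complex"
  have ip: "integrable torus p" and iq: "integrable torus q"
    using p q by (auto intro: square_integrable_imp_integrable)
  have "(LINT x|torus. (p x - q x) * cnj (trig_poly N c x)) = 0"
    by (subst integral_mult_cnj_trig_poly)
       (simp_all add: fourier_diff ip iq proj del: of_real_power)
  moreover have "integrable torus (\<lambda>x. (p x - q x) * cnj (trig_poly N c x))"
    by (intro integrable_mult_cnj_trig_poly Bochner_Integration.integrable_diff ip iq)
  moreover have "integrable torus (\<lambda>x. (log_nonlinearity (p x) - log_nonlinearity (q x)) * cnj (trig_poly N c x))"
    by (intro integrable_mult_cnj_trig_poly Bochner_Integration.integrable_diff integrable_log_nonlinearity p q)
  moreover have "(gauged_nonlinearity (cmod M + K) (p x) - gauged_nonlinearity (cmod M + K) (q x)) * cnj (trig_poly N c x)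
      = (log_nonlinearity (p x) - log_nonlinearity (q x)) * cnj (trig_poly N c x)
        - ?a * ((p x - q x) * cnj (trig_poly N c x))" for x
    by (simp add: gauged_nonlinearity_def algebra_simps)
  ultimately have "(LINT x|torus. (gauged_nonlinearity (cmod M + K) (p x) - gauged_nonlinearity (cmod M + K) (q x)) * cnj (trig_poly N c x))
      = (LINT x|torus. (log_nonlinearity (p x) - log_nonlinearity (q x)) * cnj (trig_poly N c x))"
    by (simp del: of_real_mult)
  then show ?thesis using gauged_difference_pairing_le[OF p q K M \<Theta> N, of c] by simp
qed

lemma L2_norm_multiplier_le:
  assumes H1: "H1_sum (freq_box N :: (int ^ 'n) set) v \<le> K\<^sup>2"
    and K: "K \<ge> 0" and B: "B \<ge> 0"
    and m: "\<And>k. k \<in> freq_box N \<Longrightarrow> cmod (m k) \<le> B * norm (freq k)"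
  shows "L2_norm (trig_poly N (\<lambda>k. m k * v k) :: real ^ 'n \<Rightarrow> complex) \<le> B * K"
proof (rule power2_le_imp_le)
  have "(L2_norm (trig_poly N (\<lambda>k. m k * v k) :: real ^ 'n \<Rightarrow> complex))\<^sup>2
      \<le> (2 * pi) ^ CARD('n) * (\<Sum>k\<in>(freq_box N :: (int ^ 'n) set). B\<^sup>2 * ((norm (freq k))\<^sup>2 * (cmod (v k))\<^sup>2))"
    unfolding L2_norm_trig_poly
  proof (intro mult_left_mono sum_mono)
    fix k :: "int ^ 'n" assume "k \<in> freq_box N"
    then have "(cmod (m k))\<^sup>2 \<le> (B * norm (freq k))\<^sup>2" by (intro power_mono m) auto
    then show "(cmod (m k * v k))\<^sup>2 \<le> B\<^sup>2 * ((norm (freq k))\<^sup>2 * (cmod (v k))\<^sup>2)"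
      unfolding norm_mult power_mult_distrib mult.assoc[symmetric] by (rule mult_right_mono) simp
  qed simp
  also have "\<dots> = B\<^sup>2 * (H1_sum (freq_box N :: (int ^ 'n) set) v)"
    by (simp only: sum_distrib_left[symmetric] mult.left_commute)
  also have "\<dots> \<le> B\<^sup>2 * K\<^sup>2" by (rule mult_left_mono[OF H1]) simp
  finally show "(L2_norm (trig_poly N (\<lambda>k. m k * v k) :: real ^ 'n \<Rightarrow> complex))\<^sup>2 \<le> (B * K)\<^sup>2"
    by (simp only: power_mult_distrib)
qed (use K B in simp)

lemma mult_cnj_sgn: "w * cnj (sgn w) = of_real (cmod w)"
proof (cases "w = 0")
  case False
  have "w * cnj (sgn w) = (w * cnj w) / of_real (cmod w)" by (simp add: sgn_eq)
  also have "\<dots> = of_real (cmod w)"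
    using False by (simp add: complex_norm_square[symmetric] power2_eq_square)
  finally show ?thesis .
qed simp

text \<open>
  A Fourier multiplier of size \<open>B |k|\<close> on the test function is moved onto \<open>g\<close>, coordinate by coordinate. In the box,
  \<open>|k\<^sub>j| \<le> 2N |exp (\<i> k\<^sub>j/N) - 1|\<close>, so that \<open>k\<^sub>j\<close> acts on \<open>g\<close> no worse than \<open>2N\<close> times the difference with the translate by
  \<open>1/N\<close>. The phases that remain are absorbed into a new test function of no larger norm, so that \<open>g\<close> is only
  ever paired with trigonometric polynomials.
\<close>

lemma slow_modes_pairing_le:
  fixes g :: "real ^ 'n \<Rightarrow> complex"
  assumes g: "continuous_on UNIV g" "periodic g" and N: "N \<ge> 1" and B: "B \<ge> 0"
    and A: "\<And>j \<phi>. cmod (LINT x|torus. (g (x + (1 / real N) *\<^sub>R axis j 1) - g x) * cnj (trig_poly N \<phi> x))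
      \<le> A * L2_norm (trig_poly N \<phi> :: real ^ 'n \<Rightarrow> complex)"
    and A0: "A \<ge> 0"
    and m: "\<And>k. cmod (m k) \<le> B * norm (freq k)"
  shows "cmod (LINT x|torus. g x * cnj (trig_poly N (\<lambda>k. m k * H k) x))
    \<le> 2 * real CARD('n) * real N * B * A * L2_norm (trig_poly N H :: real ^ 'n \<Rightarrow> complex)"
proof -
  define V where "V = (2 * pi) ^ CARD('n)"
  have V: "V \<ge> 0" by (simp add: V_def)
  define h where "h = 1 / real N"
  have "h \<le> 1" "0 \<le> h" using N by (auto simp: h_def)
  then have h: "0 \<le> h" "h \<le> 1" "h \<le> 2 * pi" using pi_gt3 by auto
  define z where "z j k = cis (h * real_of_int (k $ j)) - 1" for j and k :: "int ^ 'n"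
  let ?\<tau>g = "\<lambda>j x. g (x + h *\<^sub>R axis j 1)"
  have \<tau>g: "continuous_on UNIV (?\<tau>g j)" for j by (intro continuous_on_compose2[OF g(1)] continuous_intros) auto
  have int_g: "integrable torus g" and int_\<tau>g: "integrable torus (?\<tau>g j)" for j
    by (intro continuous_integrable_torus g \<tau>g)+
  have fz: "fourier (\<lambda>x. ?\<tau>g j x - g x) k = z j k * fourier g k" for j k
    by (simp add: fourier_diff int_g int_\<tau>g fourier_translate[OF g h(1,3)] z_def algebra_simps)
  have kz: "\<bar>real_of_int (k $ j)\<bar> \<le> 2 * real N * cmod (z j k)" if k: "k \<in> freq_box N" for j and k :: "int ^ 'n"
  proof -
    have "\<bar>k $ j\<bar> \<le> int N" using k by (simp add: freq_box_def)
    then have kN: "\<bar>real_of_int (k $ j)\<bar> \<le> real N" by linarith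
    then have "\<bar>h * real_of_int (k $ j)\<bar> \<le> 1" using N by (simp add: h_def)
    then have "\<bar>h * real_of_int (k $ j)\<bar> \<le> 2 * cmod (z j k)" unfolding z_def by (rule norm_cis_minus_1_ge)
    then show ?thesis using N by (simp add: h_def field_simps)
  qed
  have one: "V * (\<Sum>k\<in>freq_box N. cmod (z j k) * cmod (fourier g k) * cmod (H k))
      \<le> A * L2_norm (trig_poly N H :: real ^ 'n \<Rightarrow> complex)" for j
  proof -
    \<comment> \<open>The test function whose phases make every term of the pairing real and nonnegative.\<close>
    define \<phi> where "\<phi> k = of_real (cmod (H k)) * sgn (z j k * fourier g k)" for k
    have term_eq: "fourier (\<lambda>x. ?\<tau>g j x - g x) k * cnj (\<phi> k) = of_real (cmod (z j k) * cmod (fourier g k) * cmod (H k))" for k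
    proof -
      have "fourier (\<lambda>x. ?\<tau>g j x - g x) k * cnj (\<phi> k)
          = of_real (cmod (H k)) * ((z j k * fourier g k) * cnj (sgn (z j k * fourier g k)))"
        unfolding fz \<phi>_def by simp
      also have "\<dots> = of_real (cmod (z j k) * cmod (fourier g k) * cmod (H k))"
        unfolding mult_cnj_sgn by (simp add: norm_mult)
      finally show ?thesis .
    qed
    have "(LINT x|torus. (?\<tau>g j x - g x) * cnj (trig_poly N \<phi> x))
        = of_real V * (\<Sum>k\<in>freq_box N. fourier (\<lambda>x. ?\<tau>g j x - g x) k * cnj (\<phi> k))"
      unfolding V_def by (intro integral_mult_cnj_trig_poly Bochner_Integration.integrable_diff int_g int_\<tau>g)
    also have "\<dots> = of_real (V * (\<Sum>k\<in>freq_box N. cmod (z j k) * cmod (fourier g k) * cmod (H k)))"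
      unfolding term_eq by simp
    finally have "cmod (LINT x|torus. (?\<tau>g j x - g x) * cnj (trig_poly N \<phi> x))
        = V * (\<Sum>k\<in>freq_box N. cmod (z j k) * cmod (fourier g k) * cmod (H k))"
      using V by (simp only: norm_of_real) (simp add: sum_nonneg)
    moreover have "cmod (LINT x|torus. (?\<tau>g j x - g x) * cnj (trig_poly N \<phi> x)) \<le> A * L2_norm (trig_poly N \<phi> :: real ^ 'n \<Rightarrow> complex)"
      unfolding h_def by (rule A)
    moreover have "A * L2_norm (trig_poly N \<phi> :: real ^ 'n \<Rightarrow> complex) \<le> A * L2_norm (trig_poly N H :: real ^ 'n \<Rightarrow> complex)"
      by (intro mult_left_mono L2_norm_trig_poly_mono A0) (simp add: \<phi>_def norm_mult norm_sgn)
    ultimately show ?thesis by linarith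
  qed
  have "(LINT x|torus. g x * cnj (trig_poly N (\<lambda>k. m k * H k) x))
      = of_real V * (\<Sum>k\<in>freq_box N. fourier g k * cnj (m k * H k))"
    unfolding V_def by (rule integral_mult_cnj_trig_poly[OF int_g])
  then have "cmod (LINT x|torus. g x * cnj (trig_poly N (\<lambda>k. m k * H k) x))
      = V * cmod (\<Sum>k\<in>freq_box N. fourier g k * cnj (m k * H k))"
    using V by (simp add: norm_mult)
  also have "\<dots> \<le> V * (\<Sum>k\<in>freq_box N. \<Sum>j\<in>UNIV. 2 * real N * B * (cmod (z j k) * cmod (fourier g k) * cmod (H k)))"
  proof (intro mult_left_mono sum_norm_le V)
    fix k :: "int ^ 'n" assume k: "k \<in> freq_box N"
    have "norm (freq k) \<le> (\<Sum>j\<in>UNIV. \<bar>real_of_int (k $ j)\<bar>)"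
      using norm_le_l1_cart[of "freq k"] by (simp add: freq_def)
    also have "\<dots> \<le> (\<Sum>j\<in>UNIV. 2 * real N * cmod (z j k))" by (intro sum_mono kz k)
    finally have "cmod (m k) \<le> B * (\<Sum>j\<in>UNIV. 2 * real N * cmod (z j k))"
      using m[of k] B by (meson mult_left_mono order_trans)
    then have "cmod (m k) * (cmod (fourier g k) * cmod (H k))
        \<le> (B * (\<Sum>j\<in>UNIV. 2 * real N * cmod (z j k))) * (cmod (fourier g k) * cmod (H k))"
      by (rule mult_right_mono) simp
    also have "\<dots> = (\<Sum>j\<in>UNIV. 2 * real N * B * (cmod (z j k) * cmod (fourier g k) * cmod (H k)))"
      unfolding sum_distrib_left sum_distrib_right by (intro sum.cong refl) (simp add: mult_ac)
    finally show "cmod (fourier g k * cnj (m k * H k))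
        \<le> (\<Sum>j\<in>UNIV. 2 * real N * B * (cmod (z j k) * cmod (fourier g k) * cmod (H k)))"
      by (simp only: norm_mult complex_mod_cnj mult.left_commute)
  qed
  also have "\<dots> = (\<Sum>j\<in>(UNIV :: 'n set). 2 * real N * B * (V * (\<Sum>k\<in>freq_box N. cmod (z j k) * cmod (fourier g k) * cmod (H k))))"
    by (subst sum.swap) (simp only: sum_distrib_left mult.left_commute)
  also have "\<dots> \<le> (\<Sum>j\<in>(UNIV :: 'n set). 2 * real N * B * (A * L2_norm (trig_poly N H :: real ^ 'n \<Rightarrow> complex)))"
    using B by (intro sum_mono mult_left_mono one) auto
  also have "\<dots> = 2 * real CARD('n) * real N * B * A * L2_norm (trig_poly N H :: real ^ 'n \<Rightarrow> complex)" by simp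
  finally show ?thesis .
qed

lemma norm_freq_ge_1: "k \<noteq> 0 \<Longrightarrow> norm (freq k) \<ge> 1"
proof -
  assume "k \<noteq> 0"
  then obtain i where "k $ i \<noteq> 0" by (auto simp: vec_eq_iff)
  then have "1 \<le> \<bar>k $ i\<bar>" by simp
  then have "1 \<le> \<bar>freq k $ i\<bar>" by (simp add: freq_def)
  also have "\<dots> \<le> norm (freq k)" by (rule component_le_norm_cart)
  finally show ?thesis .
qed

lemma norm_cis_minus_1_le_sqrt: "cmod (cis ((norm v)\<^sup>2 * s) - 1) \<le> sqrt (2 * \<bar>s\<bar>) * norm v"
proof (rule power2_le_imp_le)
  have "(cmod (cis ((norm v)\<^sup>2 * s) - 1))\<^sup>2 \<le> 2 * \<bar>(norm v)\<^sup>2 * s\<bar>" by (rule norm_cis_minus_1_power2_le)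
  then show "(cmod (cis ((norm v)\<^sup>2 * s) - 1))\<^sup>2 \<le> (sqrt (2 * \<bar>s\<bar>) * norm v)\<^sup>2"
    by (simp add: power_mult_distrib abs_mult mult_ac)
qed simp

lemma zero_in_freq_box [simp]: "0 \<in> freq_box N"
  by (simp add: freq_box_def)

lemma trig_poly_eq_const: "(\<lambda>x. a) = trig_poly N (\<lambda>k. if k = 0 then a else 0)"
  by (simp add: fun_eq_iff trig_poly_def mult_delta_left)

text \<open>
  The linear flow is unitary and hence commutes with multiples of the identity, so that the nonlinearity may be gauged.
  The commutator then splits into the effect of the flow on the argument, where \<open>\<parallel>v - E s v\<parallel> \<le> \<surd>(2s) K\<close>, and its
  effect on the test function, which is of the form treated in \<open>slow_modes_pairing_le\<close>.
\<close>

lemma schroedinger_commutator_le: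
  assumes N: "N \<ge> 2" and K: "K > 0" and s: "s \<ge> 0" and \<Theta>: "\<Theta> \<ge> 1" "\<Theta> \<ge> sqrt (2 * s)"
    and H1: "H1_sum (freq_box N :: (int ^ 'n) set) v \<le> K\<^sup>2"
  shows "cmod ((LINT x|(torus :: (real ^ 'n) measure). log_nonlinearity (trig_poly N (\<lambda>k. cis (- ((norm (freq k))\<^sup>2 * s)) * v k) x) * cnj (trig_poly N H x))
      - (LINT x|(torus :: (real ^ 'n) measure). log_nonlinearity (trig_poly N v x) * cnj (trig_poly N (\<lambda>k. cis ((norm (freq k))\<^sup>2 * s) * H k) x)))
    \<le> (2 + 6 * real CARD('n)) * pairing_const CARD('n) \<Theta> * ln (real N) * (sqrt s + 1 / real N) * K * L2_norm (trig_poly N H :: real ^ 'n \<Rightarrow> complex)"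
proof -
  let ?c = "trig_poly N (\<lambda>k. cis (- ((norm (freq k))\<^sup>2 * s)) * v k) :: real ^ 'n \<Rightarrow> complex"
  let ?v = "trig_poly N v :: real ^ 'n \<Rightarrow> complex"
  let ?H = "trig_poly N H :: real ^ 'n \<Rightarrow> complex"
  let ?m = "\<lambda>k. cis ((norm (freq k))\<^sup>2 * s) - 1 :: complex"
  let ?Hb = "trig_poly N (\<lambda>k. cis ((norm (freq k))\<^sup>2 * s) * H k) :: real ^ 'n \<Rightarrow> complex"
  let ?dH = "trig_poly N (\<lambda>k. ?m k * H k) :: real ^ 'n \<Rightarrow> complex"
  define \<kappa> where "\<kappa> = cmod (v 0) + K"
  define C where "C = pairing_const CARD('n) \<Theta>"
  define l where "l = ln (real N)"
  define \<Phi> where "\<Phi> = L2_norm ?H"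
  define a :: complex where "a = of_real (2 * ln \<kappa>)"
  have C: "C \<ge> 0" unfolding C_def using \<Theta> by (intro less_imp_le pairing_const_pos) auto
  have l: "l \<ge> 0" using N by (simp add: l_def)
  have \<Phi>: "\<Phi> \<ge> 0" by (simp add: \<Phi>_def)
  have sqv: "square_integrable ?v" and sqc: "square_integrable ?c" by simp_all
  \<comment> \<open>Poincare's inequality for \<open>v\<close>, whose mean is its coefficient at frequency \<open>0\<close>.\<close>
  have mean: "L2_norm (\<lambda>x. ?v x - v 0) \<le> K"
  proof -
    have "?v x - v 0 = trig_poly N (\<lambda>k. v k - (if k = 0 then v 0 else 0)) x" for x
      using fun_cong[OF trig_poly_eq_const[of "v 0" N], of x] trig_poly_diff by metis
    moreover have "(\<lambda>k. v k - (if k = 0 then v 0 else 0)) = (\<lambda>k. (if k = 0 then 0 else 1) * v k)"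
      by auto
    ultimately have "(\<lambda>x. ?v x - v 0) = trig_poly N (\<lambda>k. (if k = 0 then 0 else 1) * v k)"
      by (simp only: fun_eq_iff) simp
    moreover have "cmod (if k = 0 then 0 else 1) \<le> 1 * norm (freq k)" for k :: "int ^ 'n"
      using norm_freq_ge_1[of k] by auto
    ultimately show ?thesis
      using L2_norm_multiplier_le[OF H1 less_imp_le[OF K], of 1 "\<lambda>k. if k = 0 then 0 else 1"] by simp
  qed
  have diff_c: "L2_norm (\<lambda>x. ?v x - ?c x) \<le> sqrt (2 * s) * K"
  proof -
    have "(\<lambda>x. ?v x - ?c x) = trig_poly N (\<lambda>k. (1 - cis (- ((norm (freq k))\<^sup>2 * s))) * v k)"
      by (simp only: trig_poly_diff left_diff_distrib mult_1)
    moreover have "cmod (1 - cis (- ((norm (freq k))\<^sup>2 * s))) \<le> sqrt (2 * s) * norm (freq k)" for k :: "int ^ 'n"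
      using norm_cis_minus_1_le_sqrt[of "freq k" "- s"] s by (simp add: norm_minus_commute)
    ultimately show ?thesis
      using L2_norm_multiplier_le[OF H1 less_imp_le[OF K], of "sqrt (2 * s)"] s by simp
  qed
  have diff_\<tau>: "L2_norm (\<lambda>x. ?v x - ?v (x + (1 / real N) *\<^sub>R axis j 1)) \<le> 1 / real N * K" for j
  proof -
    have "(\<lambda>x. ?v x - ?v (x + (1 / real N) *\<^sub>R axis j 1)) = trig_poly N (\<lambda>k. (1 - cis (1 / real N * real_of_int (k $ j))) * v k)"
      by (simp only: trig_poly_translate trig_poly_diff left_diff_distrib mult_1)
    moreover have "cmod (1 - cis (1 / real N * real_of_int (k $ j))) \<le> 1 / real N * norm (freq k)" for k :: "int ^ 'n"
    proof -
      have "cmod (1 - cis (1 / real N * real_of_int (k $ j))) \<le> \<bar>1 / real N * real_of_int (k $ j)\<bar>"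
        using norm_cis_minus_1_le[of "1 / real N * real_of_int (k $ j)"] by (simp add: norm_minus_commute)
      also have "\<dots> = 1 / real N * \<bar>freq k $ j\<bar>" by (simp add: freq_def abs_mult)
      also have "\<dots> \<le> 1 / real N * norm (freq k)" by (intro mult_left_mono component_le_norm_cart) simp
      finally show ?thesis .
    qed
    ultimately show ?thesis
      using L2_norm_multiplier_le[OF H1 less_imp_le[OF K], of "1 / real N"] by simp
  qed
  have first: "cmod (LINT x|torus. (gauged_nonlinearity \<kappa> (?v x) - gauged_nonlinearity \<kappa> (?c x)) * cnj (?H x))
      \<le> C * l * (sqrt (2 * s) * K + K / real N) * \<Phi>"
  proof -
    have "sqrt (2 * s) * K \<le> \<Theta> * K" using \<Theta>(2) K by (intro mult_right_mono) auto
    then have "L2_norm (\<lambda>x. ?v x - ?c x) \<le> \<Theta> * K" using diff_c by linarith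
    from gauged_difference_pairing_le[OF sqv sqc K mean _ this N, of H] \<Theta>(1)
    have "cmod (LINT x|torus. (gauged_nonlinearity \<kappa> (?v x) - gauged_nonlinearity \<kappa> (?c x)) * cnj (?H x))
      \<le> C * l * (L2_norm (\<lambda>x. ?v x - ?c x) + K / real N) * \<Phi>"
      unfolding \<kappa>_def C_def l_def \<Phi>_def by linarith
    also have "\<dots> \<le> C * l * (sqrt (2 * s) * K + K / real N) * \<Phi>"
      using C l \<Phi> diff_c by (intro mult_right_mono mult_left_mono add_right_mono) auto
    finally show ?thesis .
  qed
  have second: "cmod (LINT x|torus. gauged_nonlinearity \<kappa> (?v x) * cnj (?dH x))
      \<le> 2 * real CARD('n) * real N * sqrt (2 * s) * (C * l * (K / real N + K / real N)) * \<Phi>"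
    unfolding \<Phi>_def
  proof (rule slow_modes_pairing_le)
    show "continuous_on UNIV (\<lambda>x. gauged_nonlinearity \<kappa> (?v x))"
      unfolding gauged_nonlinearity_def by (intro continuous_intros continuous_log_nonlinearity)
    show "periodic (\<lambda>x. gauged_nonlinearity \<kappa> (?v x))"
      by (rule periodic_compose[of ?v "gauged_nonlinearity \<kappa>", OF periodic_trig_poly])
    show "1 \<le> N" "0 \<le> sqrt (2 * s)" "0 \<le> C * l * (K / real N + K / real N)" using N s C l K by auto
    show "cmod (?m k) \<le> sqrt (2 * s) * norm (freq k)" for k :: "int ^ 'n"
      using norm_cis_minus_1_le_sqrt[of "freq k" s] s by simp
    fix j :: 'n and \<phi> :: "int ^ 'n \<Rightarrow> complex"
    let ?\<tau>v = "\<lambda>x. ?v (x + (1 / real N) *\<^sub>R axis j 1)"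
    have sq\<tau>: "square_integrable ?\<tau>v"
      by (intro square_integrable_continuous continuous_on_compose2[OF continuous_trig_poly[of UNIV N v]] continuous_intros) auto
    have "1 / real N \<le> 1" using N by simp
    then have "1 / real N * K \<le> \<Theta> * K" using \<Theta>(1) K by (intro mult_right_mono) linarith+
    then have "L2_norm (\<lambda>x. ?v x - ?\<tau>v x) \<le> \<Theta> * K" using diff_\<tau>[of j] by linarith
    from gauged_difference_pairing_le[OF sqv sq\<tau> K mean _ this N, of \<phi>] \<Theta>(1)
    have "cmod (LINT x|torus. (gauged_nonlinearity \<kappa> (?v x) - gauged_nonlinearity \<kappa> (?\<tau>v x)) * cnj (trig_poly N \<phi> x))
      \<le> C * l * (L2_norm (\<lambda>x. ?v x - ?\<tau>v x) + K / real N) * L2_norm (trig_poly N \<phi> :: real ^ 'n \<Rightarrow> complex)"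
      unfolding \<kappa>_def C_def l_def by linarith
    also have "\<dots> \<le> C * l * (K / real N + K / real N) * L2_norm (trig_poly N \<phi> :: real ^ 'n \<Rightarrow> complex)"
      using C l diff_\<tau>[of j] by (intro mult_right_mono mult_left_mono add_right_mono) auto
    also have "(LINT x|torus. (gauged_nonlinearity \<kappa> (?v x) - gauged_nonlinearity \<kappa> (?\<tau>v x)) * cnj (trig_poly N \<phi> x))
        = - (LINT x|torus. (gauged_nonlinearity \<kappa> (?\<tau>v x) - gauged_nonlinearity \<kappa> (?v x)) * cnj (trig_poly N \<phi> x))"
      by (subst Bochner_Integration.integral_minus[symmetric]) (simp add: algebra_simps)
    finally show "cmod (LINT x|torus. (gauged_nonlinearity \<kappa> (?\<tau>v x) - gauged_nonlinearity \<kappa> (?v x)) * cnj (trig_poly N \<phi> x))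
        \<le> C * l * (K / real N + K / real N) * L2_norm (trig_poly N \<phi> :: real ^ 'n \<Rightarrow> complex)"
      by simp
  qed
  \<comment> \<open>Unitarity of the linear flow, in the form that makes the gauge terms cancel.\<close>
  have lin: "(LINT x|torus. ?c x * cnj (?H x)) = (LINT x|torus. ?v x * cnj (?Hb x))"
    unfolding integral_mult_cnj_trig_poly[OF square_integrable_imp_integrable[OF sqc]]
      integral_mult_cnj_trig_poly[OF square_integrable_imp_integrable[OF sqv]]
    by (rule arg_cong2[where f = "(*)", OF refl], rule sum.cong[OF refl])
       (simp add: fourier_trig_poly cis_cnj mult_ac)
  have gsplit: "(LINT x|torus. log_nonlinearity (p x) * cnj (trig_poly N \<phi> x))
      = (LINT x|torus. gauged_nonlinearity \<kappa> (p x) * cnj (trig_poly N \<phi> x)) + a * (LINT x|torus. p x * cnj (trig_poly N \<phi> x))"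
    if "square_integrable p" for p :: "real ^ 'n \<Rightarrow> complex" and \<phi>
  proof -
    have "log_nonlinearity (p x) * cnj (trig_poly N \<phi> x)
        = gauged_nonlinearity \<kappa> (p x) * cnj (trig_poly N \<phi> x) + a * (p x * cnj (trig_poly N \<phi> x))" for x
      by (simp add: gauged_nonlinearity_def a_def algebra_simps)
    moreover have "integrable torus (\<lambda>x. gauged_nonlinearity \<kappa> (p x) * cnj (trig_poly N \<phi> x))"
      "integrable torus (\<lambda>x. p x * cnj (trig_poly N \<phi> x))"
      by (intro integrable_mult_cnj_trig_poly integrable_gauged_nonlinearity square_integrable_imp_integrable that)+
    ultimately show ?thesis by simp
  qed
  let ?I = "\<lambda>p \<phi>. LINT x|torus. gauged_nonlinearity \<kappa> (p x) * cnj (\<phi> x)"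
  have int: "integrable torus (\<lambda>x. gauged_nonlinearity \<kappa> (p x) * cnj (trig_poly N \<phi> x))"
    if "square_integrable p" for p :: "real ^ 'n \<Rightarrow> complex" and \<phi>
    by (intro integrable_mult_cnj_trig_poly integrable_gauged_nonlinearity that)
  have "(LINT x|torus. log_nonlinearity (?c x) * cnj (?H x)) - (LINT x|torus. log_nonlinearity (?v x) * cnj (?Hb x))
      = ?I ?c ?H - ?I ?v ?Hb"
    unfolding gsplit[OF sqc] gsplit[OF sqv] lin by simp
  also have "\<dots> = - (?I ?v ?H - ?I ?c ?H) - (?I ?v ?Hb - ?I ?v ?H)" by simp
  also have "?I ?v ?H - ?I ?c ?H = (LINT x|torus. (gauged_nonlinearity \<kappa> (?v x) - gauged_nonlinearity \<kappa> (?c x)) * cnj (?H x))"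
    unfolding left_diff_distrib by (intro Bochner_Integration.integral_diff[symmetric] int sqv sqc)
  also have "?I ?v ?Hb - ?I ?v ?H = ?I ?v ?dH"
  proof -
    have "?dH = (\<lambda>x. ?Hb x - ?H x)" by (simp only: trig_poly_diff left_diff_distrib mult_1)
    then show ?thesis
      by (simp only: complex_cnj_diff right_diff_distrib) (intro Bochner_Integration.integral_diff[symmetric] int sqv)
  qed
  finally have "cmod ((LINT x|torus. log_nonlinearity (?c x) * cnj (?H x)) - (LINT x|torus. log_nonlinearity (?v x) * cnj (?Hb x)))
      \<le> C * l * (sqrt (2 * s) * K + K / real N) * \<Phi>
        + 2 * real CARD('n) * real N * sqrt (2 * s) * (C * l * (K / real N + K / real N)) * \<Phi>"
    using first second by (smt (verit) norm_minus_cancel norm_triangle_ineq4)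
  also have "\<dots> = C * l * K * \<Phi> * (sqrt (2 * s) + 1 / real N + 4 * real CARD('n) * sqrt (2 * s))"
    using N by (simp add: field_simps)
  also have "\<dots> \<le> C * l * K * \<Phi> * ((2 + 6 * real CARD('n)) * (sqrt s + 1 / real N))"
  proof (rule mult_left_mono)
    have r: "sqrt 2 \<le> 3 / 2" by (rule real_le_lsqrt) (auto simp: power2_eq_square)
    have "sqrt (2 * s) = sqrt 2 * sqrt s" by (rule real_sqrt_mult)
    also have "\<dots> \<le> 3 / 2 * sqrt s" using r s by (intro mult_right_mono) auto
    finally have q: "sqrt (2 * s) \<le> 3 / 2 * sqrt s" .
    have "sqrt (2 * s) + 4 * real CARD('n) * sqrt (2 * s) \<le> 3 / 2 * sqrt s + 4 * real CARD('n) * (3 / 2 * sqrt s)"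
      using q by (intro add_mono mult_left_mono) auto
    also have "\<dots> \<le> (2 + 6 * real CARD('n)) * sqrt s" using s by (simp add: algebra_simps)
    finally have "sqrt (2 * s) + 4 * real CARD('n) * sqrt (2 * s) \<le> (2 + 6 * real CARD('n)) * sqrt s" .
    moreover have "1 / real N \<le> (2 + 6 * real CARD('n)) * (1 / real N)"
      using mult_right_mono[of 1 "2 + 6 * real CARD('n)" "1 / real N"] by simp
    ultimately show "sqrt (2 * s) + 1 / real N + 4 * real CARD('n) * sqrt (2 * s) \<le> (2 + 6 * real CARD('n)) * (sqrt s + 1 / real N)"
      unfolding distrib_left by linarith
  qed (use C l K \<Phi> in auto)
  also have "\<dots> = (2 + 6 * real CARD('n)) * C * l * (sqrt s + 1 / real N) * K * \<Phi>" by (simp only: mult_ac)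
  finally show ?thesis unfolding C_def l_def \<Phi>_def .
qed

section \<open>The solution and the scheme in Fourier coefficients\<close>

lemma fourier_phase_flow_has_vector_derivative:
  fixes w :: "real ^ 'n \<Rightarrow> complex"
  assumes w: "continuous_on UNIV w"
  shows "((\<lambda>s. fourier (\<lambda>x. phase_flow lam s (w x)) k) has_vector_derivative
    - (\<i> * of_real lam * fourier (\<lambda>x. log_nonlinearity (phase_flow lam s (w x))) k)) (at s)"
proof -
  let ?Q = "cbox cell_lo (cell_hi :: real ^ 'n)"
  let ?e = "\<lambda>x. cis (- (freq k \<bullet> x)) :: complex"
  let ?f = "\<lambda>t x. phase_flow lam t (w x) * ?e x"
  let ?f' = "\<lambda>t x. - (\<i> * of_real lam * log_nonlinearity (phase_flow lam t (w x))) * ?e x"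
  have "((\<lambda>t. integral ?Q (?f t)) has_vector_derivative integral ?Q (?f' s)) (at s within UNIV)"
  proof (rule leibniz_rule_vector_derivative)
    show "((\<lambda>t. ?f t x) has_vector_derivative ?f' t x) (at t within UNIV)" for t x
      by (intro has_vector_derivative_mult_left phase_flow_has_vector_derivative)
    show "?f t integrable_on ?Q" for t
      by (intro integrable_continuous continuous_intros continuous_phase_flow continuous_on_subset[OF w]) auto
    have "continuous_on (UNIV \<times> ?Q) (\<lambda>z. phase_flow lam (fst z) (w (snd z)))"
    proof -
      have "continuous_on (UNIV \<times> ?Q) (\<lambda>z. (fst z, w (snd z)))"
        by (intro continuous_intros continuous_on_compose2[OF w]) auto
      from continuous_on_compose2[OF continuous_phase_flow_joint[of lam] this] show ?thesis by simp
    qed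
    then show "continuous_on (UNIV \<times> ?Q) (\<lambda>(t, x). ?f' t x)"
      unfolding case_prod_beta by (intro continuous_intros continuous_log_nonlinearity)
  qed auto
  then have "((\<lambda>t. (1 / of_real ((2 * pi) ^ CARD('n))) * integral ?Q (?f t)) has_vector_derivative
      (1 / of_real ((2 * pi) ^ CARD('n))) * integral ?Q (?f' s)) (at s)"
    by (intro has_vector_derivative_mult_right) simp
  moreover have "(1 / of_real ((2 * pi) ^ CARD('n))) * integral ?Q (?f t) = fourier (\<lambda>x. phase_flow lam t (w x)) k" for t
    unfolding fourier_def
    by (subst integral_torus_eq_cbox) (auto intro!: continuous_intros continuous_phase_flow w)
  moreover have "(1 / of_real ((2 * pi) ^ CARD('n))) * integral ?Q (?f' s)
      = - (\<i> * of_real lam * fourier (\<lambda>x. log_nonlinearity (phase_flow lam s (w x))) k)"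
  proof -
    have "integral ?Q (?f' s) = (LINT x|torus. ?f' s x)"
      by (intro integral_torus_eq_cbox[symmetric] continuous_intros continuous_log_nonlinearity continuous_phase_flow w)
    also have "\<dots> = (LINT x|torus. - (\<i> * of_real lam) * (log_nonlinearity (phase_flow lam s (w x)) * ?e x))"
      by (simp add: mult.assoc)
    also have "\<dots> = - (\<i> * of_real lam) * (LINT x|torus. log_nonlinearity (phase_flow lam s (w x)) * ?e x)"
      by (rule Bochner_Integration.integral_mult_right_zero)
    finally show ?thesis by (simp add: fourier_def)
  qed
  ultimately show ?thesis by simp
qed

lemma plane_wave_partial:
  "partial j (\<lambda>x. a * cis (- (v \<bullet> x))) = (\<lambda>x. (- \<i> * of_real (v $ j) * a) * cis (- (v \<bullet> x)))"
proof
  fix x :: "real ^ 'a"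
  have eq: "(\<lambda>s. a * cis (- (v \<bullet> (x + s *\<^sub>R axis j 1)))) = (\<lambda>s. a * cis (- (v \<bullet> x)) * exp (of_real s * (- \<i> * of_real (v $ j))))"
  proof
    fix s
    have "- (v \<bullet> (x + s *\<^sub>R axis j 1)) = - (v \<bullet> x) + - (s * v $ j)"
      by (simp add: inner_add_right inner_axis)
    moreover have "cis (- (s * v $ j)) = exp (of_real s * (- \<i> * of_real (v $ j)))"
      by (simp add: cis_conv_exp mult_ac)
    ultimately show "a * cis (- (v \<bullet> (x + s *\<^sub>R axis j 1))) = a * cis (- (v \<bullet> x)) * exp (of_real s * (- \<i> * of_real (v $ j)))"
      by (simp only: cis_mult[symmetric] mult.assoc)
  qed
  have deriv: "((\<lambda>s. a * cis (- (v \<bullet> x)) * exp (of_real s * (- \<i> * of_real (v $ j)))) has_vector_derivative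
      a * cis (- (v \<bullet> x)) * (- \<i> * of_real (v $ j))) (at 0)"
    by (rule has_vector_derivative_real_field) (auto intro!: derivative_eq_intros)
  show "partial j (\<lambda>x. a * cis (- (v \<bullet> x))) x = (- \<i> * of_real (v $ j) * a) * cis (- (v \<bullet> x))"
    unfolding partial_def eq vector_derivative_at[OF deriv] by (simp only: mult_ac)
qed

lemma test_function_plane_wave: "test_function (\<lambda>x. cis (- (freq k \<bullet> x)))"
proof -
  have "\<exists>a. foldr partial js (\<lambda>x. cis (- (freq k \<bullet> x))) = (\<lambda>x. a * cis (- (freq k \<bullet> x)))" for js
  proof (induction js)
    case Nil
    show ?case by (intro exI[of _ 1]) simp
  next
    case (Cons j js)
    then obtain a where "foldr partial js (\<lambda>x. cis (- (freq k \<bullet> x))) = (\<lambda>x. a * cis (- (freq k \<bullet> x)))" by blast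
    then have "foldr partial (j # js) (\<lambda>x. cis (- (freq k \<bullet> x))) = (\<lambda>x. (- \<i> * of_real (freq k $ j) * a) * cis (- (freq k \<bullet> x)))"
      by (simp only: foldr.simps o_apply plane_wave_partial)
    then show ?case by blast
  qed
  moreover have "(\<lambda>x. a * cis (- (freq k \<bullet> x))) differentiable_on UNIV" for a
  proof -
    have "((\<lambda>x. exp (\<i> * of_real (- (freq k \<bullet> x)))) has_derivative
        (\<lambda>h. exp (\<i> * of_real (- (freq k \<bullet> x))) * (\<i> * of_real (- (freq k \<bullet> h))))) (at x)" for x
      by (rule has_derivative_compose[where f = "\<lambda>x. \<i> * of_real (- (freq k \<bullet> x))" and g = exp])
         (auto intro!: derivative_eq_intros DERIV_exp[unfolded has_field_derivative_def])
    then have "((\<lambda>x. a * cis (- (freq k \<bullet> x))) has_derivative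
        (\<lambda>h. a * (exp (\<i> * of_real (- (freq k \<bullet> x))) * (\<i> * of_real (- (freq k \<bullet> h)))))) (at x)" for x
      unfolding cis_conv_exp by (intro has_derivative_mult_right)
    then show ?thesis
      unfolding differentiable_on_def differentiable_def by blast
  qed
  moreover have "periodic (\<lambda>x. cis (- (freq k \<bullet> x)))"
    using periodic_compose[OF periodic_cis_freq[of k], of cnj] by (simp add: cis_cnj)
  ultimately show ?thesis
    unfolding test_function_def by metis
qed

lemma laplacian_plane_wave:
  "laplacian (\<lambda>x. cis (- (freq k \<bullet> x))) x = - of_real ((norm (freq k))\<^sup>2) * cis (- (freq k \<bullet> x))"
proof -
  have "partial j (partial j (\<lambda>x. cis (- (freq k \<bullet> x)))) x = - of_real ((freq k $ j)\<^sup>2) * cis (- (freq k \<bullet> x))" for j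
  proof -
    have once: "partial j (\<lambda>x. cis (- (freq k \<bullet> x))) = (\<lambda>x. (- \<i> * of_real (freq k $ j)) * cis (- (freq k \<bullet> x)))"
      using plane_wave_partial[of j 1 "freq k"] by (simp only: mult_1 mult_1_right)
    have "- \<i> * of_real (freq k $ j) * (- \<i> * of_real (freq k $ j)) = - of_real ((freq k $ j)\<^sup>2)"
      by (simp add: complex_eq_iff power2_eq_square)
    then show ?thesis by (simp only: once plane_wave_partial)
  qed
  then have "laplacian (\<lambda>x. cis (- (freq k \<bullet> x))) x = - of_real (\<Sum>j\<in>UNIV. (freq k $ j)\<^sup>2) * cis (- (freq k \<bullet> x))"
    by (simp add: laplacian_def sum_distrib_right sum_negf)
  also have "(\<Sum>j\<in>UNIV. (freq k $ j)\<^sup>2) = (norm (freq k))\<^sup>2"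
    unfolding power2_norm_freq by (simp add: freq_def)
  finally show ?thesis .
qed

lemma solution_square_integrable:
  "log_schroedinger_solution lam T u0 u \<Longrightarrow> t \<in> {0..T} \<Longrightarrow> square_integrable (u t)"
  by (simp add: log_schroedinger_solution_def in_L2_square_integrable)

text \<open>
  The weak formulation tested with a plane wave.
\<close>

lemma fourier_solution_has_vector_derivative:
  fixes u :: "real \<Rightarrow> real ^ 'n \<Rightarrow> complex"
  assumes sol: "log_schroedinger_solution lam T u0 u" and t: "t \<in> {0<..<T}"
  shows "((\<lambda>s. fourier (u s) k) has_vector_derivative
      - \<i> * of_real ((norm (freq k))\<^sup>2) * fourier (u t) k - \<i> * of_real lam * fourier (\<lambda>x. log_nonlinearity (u t x)) k) (at t)"
proof -
  let ?\<phi> = "\<lambda>x. cis (- (freq k \<bullet> x))"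
  define V :: complex where "V = of_real ((2 * pi) ^ CARD('n))"
  have V: "V \<noteq> 0" by (simp add: V_def)
  from sol t test_function_plane_wave[of k] obtain D where
    D: "((\<lambda>s. LINT x|torus. u s x * ?\<phi> x) has_vector_derivative D) (at t)"
    and eq: "\<i> * D + (LINT x|torus. u t x * laplacian ?\<phi> x) = of_real lam * (LINT x|torus. log_nonlinearity (u t x) * ?\<phi> x)"
    unfolding log_schroedinger_solution_def by blast
  have four: "(LINT x|torus. g x * ?\<phi> x) = V * fourier g k" for g :: "real ^ 'n \<Rightarrow> complex"
    using V by (simp add: fourier_def V_def del: of_real_power)
  have "(LINT x|torus. u t x * laplacian ?\<phi> x) = (LINT x|torus. - of_real ((norm (freq k))\<^sup>2) * (u t x * ?\<phi> x))"
    by (simp only: laplacian_plane_wave mult.left_commute)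
  also have "\<dots> = - of_real ((norm (freq k))\<^sup>2) * (V * fourier (u t) k)"
    by (simp only: Bochner_Integration.integral_mult_right_zero four)
  finally have lap: "(LINT x|torus. u t x * laplacian ?\<phi> x) = - of_real ((norm (freq k))\<^sup>2) * (V * fourier (u t) k)" .
  have "\<i> * D = of_real ((norm (freq k))\<^sup>2) * (V * fourier (u t) k) + of_real lam * (V * fourier (\<lambda>x. log_nonlinearity (u t x)) k)"
    using eq unfolding lap four by (simp add: algebra_simps)
  moreover have "D = - \<i> * (\<i> * D)" by (simp add: complex_eq_iff)
  ultimately have "D = - \<i> * (of_real ((norm (freq k))\<^sup>2) * (V * fourier (u t) k) + of_real lam * (V * fourier (\<lambda>x. log_nonlinearity (u t x)) k))"
    by (simp only:)
  also have "\<dots> = V * (- \<i> * of_real ((norm (freq k))\<^sup>2) * fourier (u t) k - \<i> * of_real lam * fourier (\<lambda>x. log_nonlinearity (u t x)) k)"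
    by (simp add: algebra_simps)
  finally have D_eq: "D = V * (- \<i> * of_real ((norm (freq k))\<^sup>2) * fourier (u t) k - \<i> * of_real lam * fourier (\<lambda>x. log_nonlinearity (u t x)) k)" .
  have "((\<lambda>s. (1 / V) * (LINT x|torus. u s x * ?\<phi> x)) has_vector_derivative (1 / V) * D) (at t)"
    by (intro has_vector_derivative_mult_right D)
  then show ?thesis using V by (simp add: four D_eq)
qed

lemma fourier_solution_tendsto:
  assumes sol: "log_schroedinger_solution lam T u0 u" and t: "t \<in> {0..T}"
  shows "((\<lambda>s. fourier (u s) k) \<longlongrightarrow> fourier (u t) k) (at t within {0..T})"
proof (rule LIM_zero_cancel, rule Lim_null_comparison)
  show "((\<lambda>s. L2_norm (\<lambda>x. u s x - u t x)) \<longlongrightarrow> 0) (at t within {0..T})"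
    using sol t by (auto simp: log_schroedinger_solution_def)
  show "\<forall>\<^sub>F s in at t within {0..T}. cmod (fourier (u s) k - fourier (u t) k) \<le> L2_norm (\<lambda>x. u s x - u t x)"
    unfolding eventually_at_filter
  proof (intro always_eventually allI impI)
    fix s assume "s \<in> {0..T}"
    then have s: "square_integrable (u s)" and t': "square_integrable (u t)"
      using solution_square_integrable[OF sol] t by auto
    have "fourier (u s) k - fourier (u t) k = fourier (\<lambda>x. u s x - u t x) k"
      by (intro fourier_diff[symmetric] square_integrable_imp_integrable s t')
    then show "cmod (fourier (u s) k - fourier (u t) k) \<le> L2_norm (\<lambda>x. u s x - u t x)"
      using norm_fourier_le[OF square_integrable_diff[OF s t'], of k] by simp
  qed
qed

lemma continuous_on_fourier_solution:
  assumes "log_schroedinger_solution lam T u0 u"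
  shows "continuous_on {0..T} (\<lambda>t. fourier (u t) k)"
  unfolding continuous_on_def using fourier_solution_tendsto[OF assms] by blast

lemma H1_sum_le_seminorm:
  fixes f :: "real ^ 'n \<Rightarrow> complex"
  assumes "in_H1 f" "finite F"
  shows "H1_sum F (fourier f) \<le> (H1_seminorm f)\<^sup>2"
proof -
  let ?f = "\<lambda>k. (norm (freq k))\<^sup>2 * (cmod (fourier f k))\<^sup>2"
  have big: "(\<lambda>k. (1 + (norm (freq k))\<^sup>2) * (cmod (fourier f k))\<^sup>2) summable_on UNIV"
    using assms(1) by (simp only: in_H1_def)
  have "?f summable_on (UNIV - {0})"
  proof (rule summable_on_comparison_test[OF summable_on_subset[OF big]])
    fix k :: "int ^ 'n"
    have "(norm (freq k))\<^sup>2 \<le> 1 + (norm (freq k))\<^sup>2" by simp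
    then show "?f k \<le> (1 + (norm (freq k))\<^sup>2) * (cmod (fourier f k))\<^sup>2"
      by (rule mult_right_mono) simp
  qed simp_all
  then have "sum ?f (F - {0}) \<le> infsum ?f (UNIV - {0})"
    using assms(2) by (intro finite_sum_le_infsum) auto
  moreover have "sum ?f F = sum ?f (F - {0})"
    using assms(2) by (intro sum.mono_neutral_right) auto
  ultimately have "sum ?f F \<le> infsum ?f (UNIV - {0})" by simp
  moreover have "(H1_seminorm f)\<^sup>2 = (2 * pi) ^ CARD('n) * infsum ?f (UNIV - {0})"
  proof -
    have "((2 * pi) powr (real CARD('n) / 2))\<^sup>2 = (2 * pi) ^ CARD('n)"
      by (simp add: power2_eq_square powr_realpow flip: powr_add)
    moreover have "infsum ?f (UNIV - {0}) \<ge> 0" by (intro infsum_nonneg) auto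
    ultimately show ?thesis by (simp only: H1_seminorm_def power_mult_distrib real_sqrt_pow2)
  qed
  ultimately show ?thesis by (simp add: mult_left_mono)
qed

lemma fourier_cong_AE:
  fixes f g :: "real ^ 'n \<Rightarrow> complex"
  assumes "AE x in torus. f x = g x" "square_integrable f" "square_integrable g"
  shows "fourier f k = fourier g k"
proof -
  have m: "(\<lambda>x. h x * cis (- (freq k \<bullet> x))) \<in> borel_measurable torus" if "square_integrable h" for h :: "real ^ 'n \<Rightarrow> complex"
    by (intro borel_measurable_integrable integrable_torus_mult_cis_minus square_integrable_imp_integrable that)
  have "(LINT x|torus. f x * cis (- (freq k \<bullet> x))) = (LINT x|torus. g x * cis (- (freq k \<bullet> x)))"
    by (intro integral_cong_AE m assms) (use assms(1) in \<open>eventually_elim, simp\<close>)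
  then show ?thesis by (simp add: fourier_def)
qed

text \<open>
  The \<open>H\<^sup>1\<close>-bound is given for positive times only. It passes to the initial value because each finite sum is
  continuous in \<open>L\<^sup>2\<close>.
\<close>

lemma initial_H1_sum_le:
  fixes u0 :: "real ^ 'n \<Rightarrow> complex"
  assumes sol: "log_schroedinger_solution lam T u0 u" and u0: "in_L2 u0" and T: "T > 0" and F: "finite F"
    and H1: "\<And>t. t \<in> {0<..T} \<Longrightarrow> H1_sum F (fourier (u t)) \<le> B"
  shows "H1_sum F (fourier u0) \<le> B"
proof -
  have "AE x in torus. u 0 x = u0 x" using sol by (simp add: log_schroedinger_solution_def)
  then have "fourier (u 0) k = fourier u0 k" for k
    by (rule fourier_cong_AE[OF _ solution_square_integrable[OF sol] in_L2_square_integrable[OF u0]]) (use T in auto)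
  then have "((\<lambda>t. fourier (u t) k) \<longlongrightarrow> fourier u0 k) (at 0 within {0..T})" for k
    using fourier_solution_tendsto[OF sol, of 0 k] T by simp
  then have lim: "((\<lambda>t. H1_sum F (fourier (u t)))
      \<longlongrightarrow> H1_sum F (fourier u0)) (at 0 within {0..T})"
    by (intro tendsto_intros)
  show ?thesis
  proof (rule tendsto_upperbound[OF lim])
    show "\<forall>\<^sub>F t in at 0 within {0..T}. H1_sum F (fourier (u t)) \<le> B"
      unfolding eventually_at_filter
    proof (intro always_eventually allI impI)
      fix t assume "t \<noteq> 0" "t \<in> {0..T}"
      then have "t \<in> {0<..T}" by auto
      then show "H1_sum F (fourier (u t)) \<le> B" by (rule H1)
    qed
    show "at 0 within {0..T} \<noteq> bot" using T by (simp add: at_within_Icc_at_right)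
  qed
qed

text \<open>
  The Fourier coefficients of the iterates inside the box. The values outside the box are arbitrary: \<open>trig_poly\<close>
  ignores them.
\<close>

primrec scheme_coeff :: "real \<Rightarrow> real \<Rightarrow> nat \<Rightarrow> (real ^ 'n \<Rightarrow> complex) \<Rightarrow> nat \<Rightarrow> int ^ 'n \<Rightarrow> complex" where
  "scheme_coeff lam tau N u0 0 = fourier u0"
| "scheme_coeff lam tau N u0 (Suc m) = (\<lambda>k. cis (- ((norm (freq k))\<^sup>2 * tau)) *
     fourier (\<lambda>x. phase_flow lam tau (trig_poly N (scheme_coeff lam tau N u0 m) x)) k)"

lemma flow_A_trig_poly: "flow_A t (trig_poly N c) = trig_poly N (\<lambda>k. cis (- ((norm (freq k))\<^sup>2 * t)) * c k)"
proof
  fix x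
  have "flow_A t (trig_poly N c) x = (\<Sum>\<^sub>\<infinity>k\<in>freq_box N. cis (- ((norm (freq k))\<^sup>2 * t)) * c k * cis (freq k \<bullet> x))"
    unfolding flow_A_def by (intro infsum_cong_neutral) (auto simp: fourier_trig_poly)
  then show "flow_A t (trig_poly N c) x = trig_poly N (\<lambda>k. cis (- ((norm (freq k))\<^sup>2 * t)) * c k) x"
    by (simp add: trig_poly_def)
qed

lemma lie_trotter_eq_trig_poly: "lie_trotter lam tau N u0 m = trig_poly N (scheme_coeff lam tau N u0 m)"
  by (induction m) (simp_all add: fourier_proj_eq_trig_poly flow_B_eq_phase_flow flow_A_trig_poly)

lemma phase_flow_trig_poly_H1_sum_le:
  assumes t: "t \<ge> 0" and F: "finite F" and K: "K \<ge> 0"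
    and H1: "H1_sum (freq_box N :: (int ^ 'n) set) c \<le> K\<^sup>2"
  shows "H1_sum (F :: (int ^ 'n) set) (fourier (\<lambda>x. phase_flow lam t (trig_poly N c x)))
    \<le> ((1 + 2 * \<bar>lam\<bar> * t) * K)\<^sup>2"
proof -
  define L where "L = 1 + 2 * \<bar>lam\<bar> * t"
  have "(\<Sum>k\<in>F. (norm (freq k))\<^sup>2 * (cmod (fourier (\<lambda>x. phase_flow lam t (trig_poly N c x)) k))\<^sup>2)
      \<le> L\<^sup>2 * (\<Sum>k\<in>(freq_box N :: (int ^ 'n) set). (norm (freq k))\<^sup>2 * (cmod (c k))\<^sup>2)"
    using t unfolding L_def
    by (intro H1_sum_le_of_lipschitz continuous_phase_flow continuous_trig_poly phase_flow_lipschitz F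
        periodic_compose[OF periodic_trig_poly]) auto
  then have "H1_sum F (fourier (\<lambda>x. phase_flow lam t (trig_poly N c x)))
      \<le> (2 * pi) ^ CARD('n) * (L\<^sup>2 * (\<Sum>k\<in>(freq_box N :: (int ^ 'n) set). (norm (freq k))\<^sup>2 * (cmod (c k))\<^sup>2))"
    by (rule mult_left_mono) simp
  also have "\<dots> = L\<^sup>2 * (H1_sum (freq_box N :: (int ^ 'n) set) c)"
    by (rule mult.left_commute)
  also have "\<dots> \<le> L\<^sup>2 * K\<^sup>2" by (rule mult_left_mono[OF H1]) simp
  finally show ?thesis by (simp only: L_def power_mult_distrib)
qed

lemma scheme_coeff_H1_sum_le:
  assumes tau: "tau \<ge> 0" and K: "K \<ge> 0"
    and H1: "H1_sum (freq_box N :: (int ^ 'n) set) (fourier u0) \<le> K\<^sup>2"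
  shows "H1_sum (freq_box N :: (int ^ 'n) set) (scheme_coeff lam tau N u0 m)
    \<le> ((1 + 2 * \<bar>lam\<bar> * tau) ^ m * K)\<^sup>2"
proof (induction m)
  case 0
  then show ?case using H1 by simp
next
  case (Suc m)
  have "(1 + 2 * \<bar>lam\<bar> * tau) ^ m * K \<ge> 0" using tau K by simp
  from phase_flow_trig_poly_H1_sum_le[OF tau finite_freq_box this Suc, where lam = lam]
  show ?case by (simp add: norm_mult mult.assoc)
qed

section \<open>The energy inequality on one time step\<close>

lemma Im_monotone_pairing_le:
  fixes p q :: "real ^ 'n \<Rightarrow> complex"
  assumes p: "square_integrable p" and q: "square_integrable q"
    and \<phi>: "\<And>x. trig_poly N c x = p x - q x"
  shows "\<bar>Im (LINT x|torus. (log_nonlinearity (p x) - log_nonlinearity (q x)) * cnj (trig_poly N c x))\<bar>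
    \<le> 2 * (L2_norm (trig_poly N c :: real ^ 'n \<Rightarrow> complex))\<^sup>2"
proof -
  let ?f = "\<lambda>x. (log_nonlinearity (p x) - log_nonlinearity (q x)) * cnj (trig_poly N c x)"
  have int: "integrable torus ?f"
    by (intro integrable_mult_cnj_trig_poly Bochner_Integration.integrable_diff integrable_log_nonlinearity p q)
  have "\<bar>Im (LINT x|torus. ?f x)\<bar> = \<bar>LINT x|torus. Im (?f x)\<bar>"
    by (simp only: integral_Im[OF int])
  also have "\<dots> \<le> (LINT x|torus. \<bar>Im (?f x)\<bar>)"
    using integral_norm_bound[of torus "\<lambda>x. Im (?f x)"] by (simp only: real_norm_def)
  also have "\<dots> \<le> (LINT x|torus. 2 * (cmod (trig_poly N c x))\<^sup>2)"
  proof (rule integral_mono)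
    show "integrable torus (\<lambda>x. \<bar>Im (?f x)\<bar>)"
      by (intro Bochner_Integration.integrable_abs integrable_Im int)
    show "integrable torus (\<lambda>x. 2 * (cmod (trig_poly N c x))\<^sup>2)"
      by (intro Bochner_Integration.integrable_mult_right square_integrableD(2) square_integrable_trig_poly)
    show "\<bar>Im (?f x)\<bar> \<le> 2 * (cmod (trig_poly N c x))\<^sup>2" for x
      unfolding \<phi> by (rule log_nonlinearity_monotone)
  qed
  also have "\<dots> = 2 * (L2_norm (trig_poly N c :: real ^ 'n \<Rightarrow> complex))\<^sup>2"
    by (simp only: Bochner_Integration.integral_mult_right_zero L2_norm_power2)
  finally show ?thesis .
qed

lemma mean_deviation_le:
  fixes g :: "real ^ 'n \<Rightarrow> complex"
  assumes "g \<in> borel_measurable torus" "AE x in torus. cmod (g x) \<le> B"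
    and "\<And>F. finite F \<Longrightarrow> H1_sum F (fourier g) \<le> K\<^sup>2"
    and "K \<ge> 0"
  shows "L2_norm (\<lambda>x. g x - fourier g 0) \<le> K"
proof -
  have "freq_box 0 = {0 :: int ^ 'n}" by (auto simp: freq_box_def vec_eq_iff)
  then have "trig_poly 0 (fourier g) x = fourier g 0" for x by (simp add: trig_poly_def)
  then show ?thesis using L2_norm_diff_projection_le[OF assms, of 0] by simp
qed

lemma projection_error_pairing_le:
  fixes g :: "real ^ 'n \<Rightarrow> complex"
  assumes meas: "g \<in> borel_measurable torus" and bnd: "AE x in torus. cmod (g x) \<le> B"
    and H1: "\<And>F. finite F \<Longrightarrow> H1_sum F (fourier g) \<le> K\<^sup>2"
    and K: "K > 0" and N: "N \<ge> 2" and \<Theta>: "\<Theta> \<ge> 1"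
  shows "cmod (LINT x|torus. (log_nonlinearity (g x) - log_nonlinearity (trig_poly N (fourier g) x)) * cnj (trig_poly N c x))
    \<le> 2 * pairing_const CARD('n) \<Theta> * ln (real N) * (1 / real N) * K * L2_norm (trig_poly N c :: real ^ 'n \<Rightarrow> complex)"
proof -
  let ?d = "L2_norm (\<lambda>x. g x - trig_poly N (fourier g) x)"
  let ?\<Phi> = "L2_norm (trig_poly N c :: real ^ 'n \<Rightarrow> complex)"
  have sq: "square_integrable g" by (rule square_integrable_bounded[OF meas bnd])
  have K0: "K \<ge> 0" using K by simp
  have "?d \<le> K / (real N + 1)" by (rule L2_norm_diff_projection_le[OF meas bnd H1 K0])
  also have "\<dots> \<le> K / real N" using K N by (intro divide_left_mono) auto
  finally have d: "?d \<le> K / real N" .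
  have "K / real N \<le> K / 1" using K N by (intro divide_left_mono) auto
  also have "\<dots> \<le> \<Theta> * K" using mult_right_mono[OF \<Theta> K0] by simp
  finally have "?d \<le> \<Theta> * K" using d by linarith
  from log_difference_pairing_le[OF sq square_integrable_trig_poly K mean_deviation_le[OF meas bnd H1 K0] _ this N, of c]
  have "cmod (LINT x|torus. (log_nonlinearity (g x) - log_nonlinearity (trig_poly N (fourier g) x)) * cnj (trig_poly N c x))
    \<le> pairing_const CARD('n) \<Theta> * ln (real N) * (?d + K / real N) * ?\<Phi>"
    using \<Theta> by (simp add: fourier_trig_poly)
  also have "\<dots> \<le> pairing_const CARD('n) \<Theta> * ln (real N) * (K / real N + K / real N) * ?\<Phi>"
    using d N \<Theta> pairing_const_pos[of \<Theta> "CARD('n)"] by (intro mult_right_mono mult_left_mono add_right_mono) auto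
  also have "\<dots> = 2 * pairing_const CARD('n) \<Theta> * ln (real N) * (1 / real N) * K * ?\<Phi>" by simp
  finally show ?thesis .
qed

text \<open>
  The four terms \<open>T1\<close> to \<open>T4\<close> are the telescoping decomposition of the introduction: projection defect of the solution,
  monotone part, commutator, and projection defect of the numerical solution. Both the solution and the nonlinear flow of
  the numerical solution need the \<open>H\<^sup>1\<close>-bound \<open>K\<close>, the latter by Lipschitz stability.
\<close>

lemma energy_rate_le:
  fixes a :: "real ^ 'n \<Rightarrow> complex"
  assumes meas: "a \<in> borel_measurable torus" and bnd: "AE x in torus. cmod (a x) \<le> B"
    and H1a: "\<And>F. finite F \<Longrightarrow> H1_sum F (fourier a) \<le> K\<^sup>2"
    and H1w: "H1_sum (freq_box N :: (int ^ 'n) set) \<omega> \<le> Kw\<^sup>2"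
    and Kw: "Kw \<ge> 0" "(1 + 2 * \<bar>lam\<bar> * s) * Kw \<le> K"
    and K: "K > 0" and N: "N \<ge> 2" and s: "s \<ge> 0" and \<Theta>: "\<Theta> \<ge> 1" "\<Theta> \<ge> sqrt (2 * s)"
  defines "b \<equiv> \<lambda>x. phase_flow lam s (trig_poly N \<omega> x)"
  defines "H \<equiv> \<lambda>k. fourier a k - cis (- ((norm (freq k))\<^sup>2 * s)) * fourier b k"
  shows "\<bar>Im (of_real ((2 * pi) ^ CARD('n)) * (\<Sum>k\<in>freq_box N.
      (fourier (\<lambda>x. log_nonlinearity (a x)) k - cis (- ((norm (freq k))\<^sup>2 * s)) * fourier (\<lambda>x. log_nonlinearity (b x)) k) * cnj (H k)))\<bar>
    \<le> 2 * (L2_norm (trig_poly N H :: real ^ 'n \<Rightarrow> complex))\<^sup>2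
      + (6 + 6 * real CARD('n)) * pairing_const CARD('n) \<Theta> * ln (real N) * (sqrt s + 1 / real N) * K * L2_norm (trig_poly N H :: real ^ 'n \<Rightarrow> complex)"
proof -
  define \<Phi> where "\<Phi> = L2_norm (trig_poly N H :: real ^ 'n \<Rightarrow> complex)"
  define C where "C = pairing_const CARD('n) \<Theta>"
  define l where "l = ln (real N)"
  have C: "C \<ge> 0" unfolding C_def using \<Theta> by (intro less_imp_le pairing_const_pos) auto
  have l: "l \<ge> 0" using N by (simp add: l_def)
  have \<Phi>: "\<Phi> \<ge> 0" by (simp add: \<Phi>_def)
  define c where "c = (\<lambda>k. cis (- ((norm (freq k))\<^sup>2 * s)) * fourier b k)"
  define Hb where "Hb = (\<lambda>k. cis ((norm (freq k))\<^sup>2 * s) * H k)"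
  have b_cont: "continuous_on UNIV b" unfolding b_def by (intro continuous_phase_flow continuous_trig_poly)
  have b_bnd: "AE x in torus. cmod (b x) \<le> 3 ^ CARD('n) * real N ^ CARD('n) * L2_norm (trig_poly N \<omega> :: real ^ 'n \<Rightarrow> complex)"
    unfolding b_def norm_phase_flow using N by (intro AE_I2 norm_trig_poly_le) simp
  have b_meas: "b \<in> borel_measurable torus" by (rule continuous_measurable_torus[OF b_cont])
  have sqa: "square_integrable a" by (rule square_integrable_bounded[OF meas bnd])
  have sqb: "square_integrable b" by (rule square_integrable_continuous[OF b_cont])
  have H1b: "H1_sum F (fourier b) \<le> K\<^sup>2" if "finite F" for F
  proof -
    have "H1_sum F (fourier b) \<le> ((1 + 2 * \<bar>lam\<bar> * s) * Kw)\<^sup>2"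
      unfolding b_def by (rule phase_flow_trig_poly_H1_sum_le[OF s that Kw(1) H1w])
    also have "\<dots> \<le> K\<^sup>2" using Kw s by (intro power_mono) auto
    finally show ?thesis .
  qed
  define P where "P p \<phi> = (LINT x|(torus :: (real ^ 'n) measure). log_nonlinearity (p x) * cnj (trig_poly N \<phi> x))" for p \<phi>
  have P_diff: "P p \<phi> - P q \<phi> = (LINT x|torus. (log_nonlinearity (p x) - log_nonlinearity (q x)) * cnj (trig_poly N \<phi> x))"
    if "square_integrable p" "square_integrable q" for p q \<phi>
    unfolding P_def left_diff_distrib
    by (intro Bochner_Integration.integral_diff[symmetric] integrable_mult_cnj_trig_poly integrable_log_nonlinearity that)
  have T1: "cmod (P a H - P (trig_poly N (fourier a)) H) \<le> 2 * C * l * (1 / real N) * K * \<Phi>"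
    unfolding P_diff[OF sqa square_integrable_trig_poly] C_def l_def \<Phi>_def
    by (rule projection_error_pairing_le[OF meas bnd H1a K N \<Theta>(1)])
  have T2: "\<bar>Im (P (trig_poly N (fourier a)) H - P (trig_poly N c) H)\<bar> \<le> 2 * \<Phi>\<^sup>2"
    unfolding P_diff[OF square_integrable_trig_poly square_integrable_trig_poly] \<Phi>_def
    by (rule Im_monotone_pairing_le) (simp_all add: trig_poly_diff H_def c_def)
  have T3: "cmod (P (trig_poly N c) H - P (trig_poly N (fourier b)) Hb)
      \<le> (2 + 6 * real CARD('n)) * C * l * (sqrt s + 1 / real N) * K * \<Phi>"
    unfolding P_def C_def l_def \<Phi>_def c_def Hb_def
    by (rule schroedinger_commutator_le[OF N K s \<Theta> H1b[OF finite_freq_box]])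
  have norm_Hb: "L2_norm (trig_poly N Hb :: real ^ 'n \<Rightarrow> complex) = \<Phi>"
    unfolding \<Phi>_def by (intro antisym L2_norm_trig_poly_mono) (simp_all add: Hb_def norm_mult)
  have T4: "cmod (P b Hb - P (trig_poly N (fourier b)) Hb) \<le> 2 * C * l * (1 / real N) * K * \<Phi>"
    unfolding P_diff[OF sqb square_integrable_trig_poly] C_def l_def norm_Hb[symmetric]
    by (rule projection_error_pairing_le[OF b_meas b_bnd H1b K N \<Theta>(1)])
  have "of_real ((2 * pi) ^ CARD('n)) * (\<Sum>k\<in>freq_box N.
      (fourier (\<lambda>x. log_nonlinearity (a x)) k - cis (- ((norm (freq k))\<^sup>2 * s)) * fourier (\<lambda>x. log_nonlinearity (b x)) k) * cnj (H k))
      = P a H - P b Hb"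
    unfolding P_def integral_mult_cnj_trig_poly[OF integrable_log_nonlinearity[OF sqa]]
      integral_mult_cnj_trig_poly[OF integrable_log_nonlinearity[OF sqb]] right_diff_distrib[symmetric] sum_subtractf[symmetric]
    by (rule arg_cong2[where f = "(*)", OF refl], rule sum.cong[OF refl]) (simp add: Hb_def cis_cnj algebra_simps)
  also have "\<dots> = (P (trig_poly N (fourier a)) H - P (trig_poly N c) H) + ((P a H - P (trig_poly N (fourier a)) H)
      + (P (trig_poly N c) H - P (trig_poly N (fourier b)) Hb) - (P b Hb - P (trig_poly N (fourier b)) Hb))"
    by simp
  finally have decomp: "of_real ((2 * pi) ^ CARD('n)) * (\<Sum>k\<in>freq_box N.
      (fourier (\<lambda>x. log_nonlinearity (a x)) k - cis (- ((norm (freq k))\<^sup>2 * s)) * fourier (\<lambda>x. log_nonlinearity (b x)) k) * cnj (H k))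
      = \<dots>" .
  have ImT: "\<bar>Im (z + (x + y - w))\<bar> \<le> \<bar>Im z\<bar> + (cmod x + cmod y + cmod w)" for x y z w
    using abs_Im_le_cmod[of x] abs_Im_le_cmod[of y] abs_Im_le_cmod[of w] by simp
  have "\<bar>Im (of_real ((2 * pi) ^ CARD('n)) * (\<Sum>k\<in>freq_box N.
      (fourier (\<lambda>x. log_nonlinearity (a x)) k - cis (- ((norm (freq k))\<^sup>2 * s)) * fourier (\<lambda>x. log_nonlinearity (b x)) k) * cnj (H k)))\<bar>
      \<le> 2 * \<Phi>\<^sup>2 + (2 * C * l * (1 / real N) * K * \<Phi> + (2 + 6 * real CARD('n)) * C * l * (sqrt s + 1 / real N) * K * \<Phi>
         + 2 * C * l * (1 / real N) * K * \<Phi>)"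
    unfolding decomp by (rule order_trans[OF ImT]) (intro add_mono T1 T2 T3 T4)
  also have "\<dots> = 2 * \<Phi>\<^sup>2 + (C * l * K * \<Phi>) * (4 * (1 / real N) + (2 + 6 * real CARD('n)) * (sqrt s + 1 / real N))"
    by (simp only: distrib_left distrib_right mult_ac)
  also have "\<dots> \<le> 2 * \<Phi>\<^sup>2 + (C * l * K * \<Phi>) * ((6 + 6 * real CARD('n)) * (sqrt s + 1 / real N))"
  proof (intro add_left_mono mult_left_mono)
    show "4 * (1 / real N) + (2 + 6 * real CARD('n)) * (sqrt s + 1 / real N) \<le> (6 + 6 * real CARD('n)) * (sqrt s + 1 / real N)"
      using s by (simp add: algebra_simps)
    show "0 \<le> C * l * K * \<Phi>" using C l K \<Phi> by simp
  qed
  finally show ?thesis unfolding \<Phi>_def C_def l_def by (simp only: mult_ac)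
qed

lemma has_real_derivative_cmod_power2:
  assumes "(f has_vector_derivative f') (at s)"
  shows "((\<lambda>s. (cmod (f s))\<^sup>2) has_real_derivative 2 * Re (f' * cnj (f s))) (at s)"
proof -
  have re: "((\<lambda>s. Re (f s)) has_real_derivative Re f') (at s)"
    and im: "((\<lambda>s. Im (f s)) has_real_derivative Im f') (at s)"
    unfolding has_real_derivative_iff_has_vector_derivative
    using bounded_linear.has_vector_derivative[OF bounded_linear_Re assms]
      bounded_linear.has_vector_derivative[OF bounded_linear_Im assms] by auto
  from DERIV_add[OF DERIV_power[OF re, of 2] DERIV_power[OF im, of 2]]
  show ?thesis by (simp add: cmod_power2 algebra_simps)
qed

lemma Gronwall_affine:
  fixes y :: "real \<Rightarrow> real"
  assumes tau: "tau \<ge> 0" and cont: "continuous_on {0..tau} y"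
    and deriv: "\<And>s. 0 < s \<Longrightarrow> s < tau \<Longrightarrow> \<exists>D. (y has_real_derivative D) (at s) \<and> D \<le> A * y s + B"
    and AB: "A \<ge> 0" "B \<ge> 0"
  shows "y tau \<le> exp (A * tau) * (y 0 + B * tau)"
proof -
  define z where "z s = exp (- (A * s)) * y s - B * s" for s
  have "z 0 \<ge> z tau"
  proof (rule DERIV_nonpos_imp_decreasing_open[OF tau])
    show "continuous_on {0..tau} z" unfolding z_def by (intro continuous_intros cont)
    fix s assume s: "0 < s" "s < tau"
    then obtain D where D: "(y has_real_derivative D) (at s)" "D \<le> A * y s + B" using deriv by blast
    have "(z has_real_derivative exp (- (A * s)) * (D - A * y s) - B) (at s)"
      unfolding z_def by (auto intro!: derivative_eq_intros D simp: algebra_simps)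
    moreover have "exp (- (A * s)) * (D - A * y s) \<le> exp (- (A * s)) * B"
      using D(2) by (intro mult_left_mono) auto
    moreover have "exp (- (A * s)) * B \<le> 1 * B"
      using s AB by (intro mult_right_mono) auto
    ultimately show "\<exists>D. (z has_real_derivative D) (at s) \<and> D \<le> 0" by (intro exI) (auto simp: algebra_simps)
  qed
  then have "exp (- (A * tau)) * y tau \<le> y 0 + B * tau" by (simp add: z_def)
  then have "exp (A * tau) * (exp (- (A * tau)) * y tau) \<le> exp (A * tau) * (y 0 + B * tau)"
    by (rule mult_left_mono) simp
  moreover have "exp (A * tau) * (exp (- (A * tau)) * y tau) = y tau"
    by (simp add: mult.assoc[symmetric] exp_minus_inverse)
  ultimately show ?thesis by simp
qed

text \<open>
  Together with a factor \<open>K \<parallel>H\<parallel>\<close>, this bounds the terms in the energy rate that are not quadratic in \<open>H\<close>.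
\<close>

definition rate_const :: "nat \<Rightarrow> real \<Rightarrow> nat \<Rightarrow> real \<Rightarrow> real" where
  "rate_const d \<Theta> N tau = (6 + 6 * real d) * pairing_const d \<Theta> * ln (real N) * (sqrt tau + 1 / real N)"

text \<open>
  The interpolation of the scheme inside a step carries both flows: at \<open>s = 0\<close> it is the current iterate and at
  \<open>s = tau\<close> the next one. The stiff linear terms of the solution and of the interpolation cancel in the energy, since
  they rotate each Fourier coefficient of the difference.
\<close>

lemma splitting_step_energy:
  fixes u :: "real \<Rightarrow> real ^ 'n \<Rightarrow> complex"
  assumes sol: "log_schroedinger_solution lam T u0 u" and t0: "t0 \<ge> 0" and tau: "tau > 0" "t0 + tau \<le> T"
    and bnd: "\<And>t. t \<in> {0<..T} \<Longrightarrow> \<exists>B. AE x in torus. cmod (u t x) \<le> B"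
    and H1: "\<And>t F. t \<in> {0<..T} \<Longrightarrow> finite F \<Longrightarrow>
      H1_sum F (fourier (u t)) \<le> K\<^sup>2"
    and H1w: "H1_sum (freq_box N :: (int ^ 'n) set) \<omega> \<le> Kw\<^sup>2"
    and Kw: "Kw \<ge> 0" "(1 + 2 * \<bar>lam\<bar> * tau) * Kw \<le> K"
    and K: "K > 0" and N: "N \<ge> 2" and \<Theta>: "\<Theta> \<ge> 1" "\<Theta> \<ge> sqrt (2 * tau)"
  defines "y \<equiv> \<lambda>s. (L2_norm (trig_poly N (\<lambda>k. fourier (u (t0 + s)) k
      - cis (- ((norm (freq k))\<^sup>2 * s)) * fourier (\<lambda>x. phase_flow lam s (trig_poly N \<omega> x)) k) :: real ^ 'n \<Rightarrow> complex))\<^sup>2"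
  shows "y tau \<le> exp (5 * \<bar>lam\<bar> * tau) * (y 0 + \<bar>lam\<bar> * (rate_const CARD('n) \<Theta> N tau * K)\<^sup>2 * tau)"
proof (rule Gronwall_affine)
  define V where "V = (2 * pi) ^ CARD('n)"
  define E where "E = rate_const CARD('n) \<Theta> N tau * K"
  let ?w = "trig_poly N \<omega> :: real ^ 'n \<Rightarrow> complex"
  define b where "b s = (\<lambda>x. phase_flow lam s (?w x))" for s
  define e where "e s k = cis (- ((norm (freq k))\<^sup>2 * s))" for s and k :: "int ^ 'n"
  define H where "H s k = fourier (u (t0 + s)) k - e s k * fourier (b s) k" for s k
  have y: "y s = V * (\<Sum>k\<in>freq_box N. (cmod (H s k))\<^sup>2)" for s
    unfolding y_def L2_norm_trig_poly V_def H_def e_def b_def ..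
  have yH: "y s = (L2_norm (trig_poly N (H s) :: real ^ 'n \<Rightarrow> complex))\<^sup>2" for s
    unfolding y L2_norm_trig_poly V_def ..
  have flow_deriv: "((\<lambda>s. e s k * fourier (b s) k) has_vector_derivative
      - \<i> * of_real ((norm (freq k))\<^sup>2) * (e s k * fourier (b s) k)
      - \<i> * of_real lam * (e s k * fourier (\<lambda>x. log_nonlinearity (b s x)) k)) (at s)" for s k
  proof -
    have "((\<lambda>s. exp (of_real s * (- \<i> * of_real ((norm (freq k))\<^sup>2)))) has_vector_derivative
        (- \<i> * of_real ((norm (freq k))\<^sup>2)) * exp (of_real s * (- \<i> * of_real ((norm (freq k))\<^sup>2)))) (at s)"
      by (rule has_vector_derivative_real_field) (auto intro!: derivative_eq_intros)
    moreover have e_exp: "(\<lambda>s. e s k) = (\<lambda>s. exp (of_real s * (- \<i> * of_real ((norm (freq k))\<^sup>2))))"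
      by (simp add: fun_eq_iff e_def cis_conv_exp mult_ac)
    ultimately have "((\<lambda>s. e s k) has_vector_derivative - \<i> * of_real ((norm (freq k))\<^sup>2) * e s k) (at s)"
      by (simp add: fun_cong[OF e_exp, of s])
    from has_vector_derivative_mult[OF this fourier_phase_flow_has_vector_derivative[OF continuous_trig_poly[of UNIV N \<omega>], where k = k and lam = lam and s = s]]
    show ?thesis unfolding b_def by (rule has_vector_derivative_eq_rhs) (simp add: algebra_simps)
  qed
  show "0 \<le> tau" using tau by simp
  show "continuous_on {0..tau} y"
    unfolding y H_def
  proof (intro continuous_intros)
    fix k
    show "continuous_on {0..tau} (\<lambda>s. fourier (u (t0 + s)) k)"
      by (rule continuous_on_compose2[OF continuous_on_fourier_solution[OF sol]])
         (use t0 tau in \<open>auto intro!: continuous_intros\<close>)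
    show "continuous_on {0..tau} (\<lambda>s. e s k)" unfolding e_def by (intro continuous_intros)
    show "continuous_on {0..tau} (\<lambda>s. fourier (b s) k)"
      unfolding b_def
      by (intro continuous_at_imp_continuous_on ballI
          has_vector_derivative_continuous[OF fourier_phase_flow_has_vector_derivative[OF continuous_trig_poly]])
  qed
  show "0 \<le> 5 * \<bar>lam\<bar>" "0 \<le> \<bar>lam\<bar> * (rate_const CARD('n) \<Theta> N tau * K)\<^sup>2" by simp_all
  fix s assume s: "0 < s" "s < tau"
  let ?t = "t0 + s"
  have t: "?t \<in> {0<..<T}" "?t \<in> {0<..T}" using s t0 tau by auto
  let ?F = "fourier (\<lambda>x. log_nonlinearity (u ?t x))"
  let ?Q = "fourier (\<lambda>x. log_nonlinearity (b s x))"
  have H_deriv: "((\<lambda>s. H s k) has_vector_derivative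
      - \<i> * of_real ((norm (freq k))\<^sup>2) * H s k - \<i> * of_real lam * (?F k - e s k * ?Q k)) (at s)" for k
  proof -
    have "((\<lambda>s. t0 + s) has_vector_derivative 1) (at s)" by (auto intro!: derivative_eq_intros)
    from vector_diff_chain_at[OF this fourier_solution_has_vector_derivative[OF sol t(1)], of k]
    have "((\<lambda>s. fourier (u (t0 + s)) k) has_vector_derivative
        - \<i> * of_real ((norm (freq k))\<^sup>2) * fourier (u ?t) k - \<i> * of_real lam * ?F k) (at s)"
      by (simp add: o_def)
    from has_vector_derivative_diff[OF this flow_deriv[where s = s and k = k]]
    show ?thesis unfolding H_def by (rule has_vector_derivative_eq_rhs) (simp add: algebra_simps)
  qed
  have "(y has_real_derivative V * (\<Sum>k\<in>freq_box N.
      2 * Re ((- \<i> * of_real ((norm (freq k))\<^sup>2) * H s k - \<i> * of_real lam * (?F k - e s k * ?Q k)) * cnj (H s k)))) (at s)"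
    unfolding y[abs_def] by (intro DERIV_cmult DERIV_sum has_real_derivative_cmod_power2 H_deriv)
  moreover have "2 * Re ((- \<i> * of_real ((norm (freq k))\<^sup>2) * H s k - \<i> * of_real lam * (?F k - e s k * ?Q k)) * cnj (H s k))
      = 2 * lam * Im ((?F k - e s k * ?Q k) * cnj (H s k))" for k
    by (simp add: algebra_simps)
  moreover have "V * (\<Sum>k\<in>freq_box N. 2 * lam * Im ((?F k - e s k * ?Q k) * cnj (H s k)))
      = 2 * lam * Im (of_real V * (\<Sum>k\<in>freq_box N. (?F k - e s k * ?Q k) * cnj (H s k)))"
    by (simp add: sum_distrib_left mult_ac)
  ultimately have D: "(y has_real_derivative 2 * lam * Im (of_real V * (\<Sum>k\<in>freq_box N. (?F k - e s k * ?Q k) * cnj (H s k)))) (at s)"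
    by (simp only:)
  define \<Phi> where "\<Phi> = L2_norm (trig_poly N (H s) :: real ^ 'n \<Rightarrow> complex)"
  have \<Phi>: "\<Phi> \<ge> 0" by (simp add: \<Phi>_def)
  have "\<bar>Im (of_real V * (\<Sum>k\<in>freq_box N. (?F k - e s k * ?Q k) * cnj (H s k)))\<bar>
      \<le> 2 * \<Phi>\<^sup>2 + (6 + 6 * real CARD('n)) * pairing_const CARD('n) \<Theta> * ln (real N) * (sqrt s + 1 / real N) * K * \<Phi>"
  proof -
    obtain B where B: "AE x in torus. cmod (u ?t x) \<le> B" using bnd[OF t(2)] by blast
    have meas: "u ?t \<in> borel_measurable torus"
      using solution_square_integrable[OF sol, of ?t] t by (auto intro: square_integrableD)
    have "(1 + 2 * \<bar>lam\<bar> * s) * Kw \<le> (1 + 2 * \<bar>lam\<bar> * tau) * Kw"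
      using s Kw by (intro mult_right_mono add_left_mono mult_left_mono) auto
    then have Kws: "(1 + 2 * \<bar>lam\<bar> * s) * Kw \<le> K" using Kw by linarith
    have "sqrt (2 * s) \<le> sqrt (2 * tau)" using s by simp
    then have \<Theta>s: "\<Theta> \<ge> sqrt (2 * s)" using \<Theta> by linarith
    show ?thesis
      unfolding \<Phi>_def V_def H_def b_def e_def
      by (rule energy_rate_le[OF meas B H1[OF t(2)] H1w Kw(1) Kws K N _ \<Theta>(1) \<Theta>s]) (use s in auto)
  qed
  also have "\<dots> \<le> 2 * \<Phi>\<^sup>2 + E * \<Phi>"
  proof -
    have "sqrt s + 1 / real N \<le> sqrt tau + 1 / real N" using s by simp
    then have "(6 + 6 * real CARD('n)) * pairing_const CARD('n) \<Theta> * ln (real N) * (sqrt s + 1 / real N) * K * \<Phi>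
      \<le> (6 + 6 * real CARD('n)) * pairing_const CARD('n) \<Theta> * ln (real N) * (sqrt tau + 1 / real N) * K * \<Phi>"
      using pairing_const_pos[of \<Theta> "CARD('n)"] \<Theta> N K \<Phi> by (intro mult_right_mono mult_left_mono) auto
    then show ?thesis by (simp add: E_def rate_const_def)
  qed
  \<comment> \<open>Young's inequality: \<open>E \<Phi> \<le> (\<Phi>\<^sup>2 + E\<^sup>2) / 2\<close>.\<close>
  also have "\<dots> \<le> 5 / 2 * \<Phi>\<^sup>2 + E\<^sup>2 / 2"
    using sum_squares_bound[of E \<Phi>] by simp
  finally have rate: "\<bar>Im (of_real V * (\<Sum>k\<in>freq_box N. (?F k - e s k * ?Q k) * cnj (H s k)))\<bar> \<le> 5 / 2 * y s + E\<^sup>2 / 2"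
    by (simp add: yH \<Phi>_def)
  have "2 * lam * Im (of_real V * (\<Sum>k\<in>freq_box N. (?F k - e s k * ?Q k) * cnj (H s k)))
      \<le> 2 * \<bar>lam\<bar> * \<bar>Im (of_real V * (\<Sum>k\<in>freq_box N. (?F k - e s k * ?Q k) * cnj (H s k)))\<bar>"
    using abs_ge_self[of "2 * lam * Im (of_real V * (\<Sum>k\<in>freq_box N. (?F k - e s k * ?Q k) * cnj (H s k)))"]
    by (simp only: abs_mult abs_numeral)
  also have "\<dots> \<le> 2 * \<bar>lam\<bar> * (5 / 2 * y s + E\<^sup>2 / 2)"
    by (rule mult_left_mono[OF rate]) simp
  also have "\<dots> = 5 * \<bar>lam\<bar> * y s + \<bar>lam\<bar> * E\<^sup>2" by (simp add: algebra_simps)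
  finally show "\<exists>D. (y has_real_derivative D) (at s) \<and> D \<le> 5 * \<bar>lam\<bar> * y s + \<bar>lam\<bar> * (rate_const CARD('n) \<Theta> N tau * K)\<^sup>2"
    using D unfolding E_def by blast
qed

section \<open>The error estimate\<close>

text \<open>
  The energies at the end of a step and at the beginning of the next one coincide, so that the inequalities for the
  single steps chain without loss. The \<open>H\<^sup>1\<close>-bound of the iterates grows by \<open>1 + 2 |\<lambda>| \<tau>\<close> per step, hence by at most
  \<open>exp (2 |\<lambda>| T)\<close> up to time \<open>T\<close>.
\<close>

lemma scheme_energy_le:
  fixes u :: "real \<Rightarrow> real ^ 'n \<Rightarrow> complex"
  assumes sol: "log_schroedinger_solution lam T u0 u" and u0: "in_L2 u0" and T: "T > 0" and tau: "tau > 0"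
    and bnd: "\<And>t. t \<in> {0<..T} \<Longrightarrow> \<exists>B. AE x in torus. cmod (u t x) \<le> B"
    and H1: "\<And>t F. t \<in> {0<..T} \<Longrightarrow> finite F \<Longrightarrow>
      H1_sum F (fourier (u t)) \<le> K\<^sup>2"
    and K: "K > 0" and N: "N \<ge> 2" and \<Theta>: "\<Theta> \<ge> 1" "\<Theta> \<ge> sqrt (2 * T)"
    and m: "real m * tau \<le> T"
  shows "(L2_norm (trig_poly N (\<lambda>k. fourier (u (real m * tau)) k - scheme_coeff lam tau N u0 m k) :: real ^ 'n \<Rightarrow> complex))\<^sup>2
    \<le> exp (5 * \<bar>lam\<bar> * (real m * tau)) * (\<bar>lam\<bar> * (rate_const CARD('n) \<Theta> N tau * (exp (2 * \<bar>lam\<bar> * T) * K))\<^sup>2 * (real m * tau))"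
  using m
proof (induction m)
  case 0
  have "AE x in torus. u 0 x = u0 x" using sol by (simp add: log_schroedinger_solution_def)
  then have "fourier (u 0) k = fourier u0 k" for k
    by (rule fourier_cong_AE[OF _ solution_square_integrable[OF sol] in_L2_square_integrable[OF u0]]) (use T in auto)
  then show ?case by (simp add: L2_norm_trig_poly)
next
  case (Suc m)
  define L where "L = 1 + 2 * \<bar>lam\<bar> * tau"
  define Kb where "Kb = exp (2 * \<bar>lam\<bar> * T) * K"
  define Q where "Q = \<bar>lam\<bar> * (rate_const CARD('n) \<Theta> N tau * Kb)\<^sup>2"
  define t0 where "t0 = real m * tau"
  define \<omega> where "\<omega> = scheme_coeff lam tau N u0 m"
  have L: "L \<ge> 1" using tau by (simp add: L_def)
  have Q: "Q \<ge> 0" by (simp add: Q_def)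
  have t0: "t0 \<ge> 0" using tau by (simp add: t0_def)
  have t1: "t0 + tau \<le> T" "real (Suc m) * tau = t0 + tau" using Suc.prems by (simp_all add: t0_def algebra_simps)
  have K0: "K \<ge> 0" using K by simp
  have "1 * K \<le> Kb" unfolding Kb_def using K T by (intro mult_right_mono) auto
  then have KKb: "K \<le> Kb" by simp
  have "L ^ Suc m \<le> exp (2 * \<bar>lam\<bar> * tau) ^ Suc m"
    using L exp_ge_add_one_self[of "2 * \<bar>lam\<bar> * tau"] by (intro power_mono) (auto simp: L_def)
  also have "\<dots> = exp (2 * \<bar>lam\<bar> * (t0 + tau))"
    unfolding t1(2)[symmetric] by (simp only: exp_of_nat_mult[symmetric] mult_ac)
  also have "\<dots> \<le> exp (2 * \<bar>lam\<bar> * T)"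
    using t1(1) by (simp add: mult_left_mono)
  finally have Lm: "L * (L ^ m * K) \<le> Kb"
    unfolding Kb_def using mult_right_mono[OF _ K0, of "L ^ Suc m"] by (simp add: mult.assoc)
  have "H1_sum (freq_box N :: (int ^ 'n) set) (fourier u0) \<le> K\<^sup>2"
    by (rule initial_H1_sum_le[OF sol u0 T finite_freq_box H1[OF _ finite_freq_box]])
  from scheme_coeff_H1_sum_le[OF less_imp_le[OF tau] K0 this, of lam m]
  have H1w: "H1_sum (freq_box N :: (int ^ 'n) set) \<omega> \<le> (L ^ m * K)\<^sup>2"
    unfolding \<omega>_def L_def .
  have "K\<^sup>2 \<le> Kb\<^sup>2" using KKb K0 by (rule power_mono)
  then have H1b: "H1_sum F (fourier (u t)) \<le> Kb\<^sup>2"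
    if "t \<in> {0<..T}" "finite F" for t F
    using H1[OF that] by linarith
  have tauT: "tau \<le> T" using t0 t1 by linarith
  then have "sqrt (2 * tau) \<le> sqrt (2 * T)" by simp
  then have \<Theta>': "\<Theta> \<ge> sqrt (2 * tau)" using \<Theta> by linarith
  have Kw0: "L ^ m * K \<ge> 0" using L K by simp
  have Kb: "Kb > 0" using K KKb by linarith
  from splitting_step_energy[OF sol t0 tau t1(1) bnd H1b H1w Kw0 _ Kb N \<Theta>(1) \<Theta>'] Lm
  have step: "(L2_norm (trig_poly N (\<lambda>k. fourier (u (t0 + tau)) k
      - cis (- ((norm (freq k))\<^sup>2 * tau)) * fourier (\<lambda>x. phase_flow lam tau (trig_poly N \<omega> x)) k) :: real ^ 'n \<Rightarrow> complex))\<^sup>2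
    \<le> exp (5 * \<bar>lam\<bar> * tau) * ((L2_norm (trig_poly N (\<lambda>k. fourier (u t0) k - fourier (trig_poly N \<omega>) k) :: real ^ 'n \<Rightarrow> complex))\<^sup>2 + Q * tau)"
    by (simp add: L_def Q_def)
  also have "trig_poly N (\<lambda>k. fourier (u t0) k - fourier (trig_poly N \<omega>) k) = (trig_poly N (\<lambda>k. fourier (u t0) k - \<omega> k) :: real ^ 'n \<Rightarrow> complex)"
    by (rule trig_poly_cong) (simp add: fourier_trig_poly)
  also have "exp (5 * \<bar>lam\<bar> * tau) * ((L2_norm (trig_poly N (\<lambda>k. fourier (u t0) k - \<omega> k) :: real ^ 'n \<Rightarrow> complex))\<^sup>2 + Q * tau)
      \<le> exp (5 * \<bar>lam\<bar> * tau) * (exp (5 * \<bar>lam\<bar> * t0) * (Q * t0) + exp (5 * \<bar>lam\<bar> * t0) * (Q * tau))"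
  proof (intro mult_left_mono add_mono)
    show "(L2_norm (trig_poly N (\<lambda>k. fourier (u t0) k - \<omega> k) :: real ^ 'n \<Rightarrow> complex))\<^sup>2 \<le> exp (5 * \<bar>lam\<bar> * t0) * (Q * t0)"
      using Suc.IH t1(1) tau unfolding \<omega>_def t0_def Q_def Kb_def by linarith
    have "1 * (Q * tau) \<le> exp (5 * \<bar>lam\<bar> * t0) * (Q * tau)"
      using Q tau t0 by (intro mult_right_mono) auto
    then show "Q * tau \<le> exp (5 * \<bar>lam\<bar> * t0) * (Q * tau)" by simp
  qed simp
  also have "\<dots> = exp (5 * \<bar>lam\<bar> * (t0 + tau)) * (Q * (t0 + tau))"
    by (simp add: exp_add distrib_left mult.assoc)
  finally show ?case unfolding t1(2) Q_def Kb_def \<omega>_def scheme_coeff.simps .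
qed

definition error_const :: "nat \<Rightarrow> real \<Rightarrow> real \<Rightarrow> real" where
  "error_const d lam T = 2 + sqrt (exp (5 * \<bar>lam\<bar> * T) * (\<bar>lam\<bar> * T)) *
     ((6 + 6 * real d) * pairing_const d (1 + sqrt (2 * T)) * exp (2 * \<bar>lam\<bar> * T))"

lemma error_const_pos: "T > 0 \<Longrightarrow> error_const d lam T > 0"
  using pairing_const_pos[of "1 + sqrt (2 * T)" d] by (simp add: error_const_def add_pos_nonneg)

text \<open>
  The part of the solution outside the box is bounded by its \<open>H\<^sup>1\<close>-norm, the rest by the energy inequality. The estimate is
  stated with an arbitrary bound \<open>K > 0\<close>, since the scale \<open>|M| + K\<close> of the gauge has to be positive also for solutions that
  are constant in space.
\<close>

lemma splitting_error_le:
  fixes u :: "real \<Rightarrow> real ^ 'n \<Rightarrow> complex"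
  assumes sol: "log_schroedinger_solution lam T u0 u" and u0: "in_L2 u0" and T: "T > 0" and tau: "tau > 0"
    and reg: "\<And>t. t \<in> {0<..T} \<Longrightarrow> in_H1 (u t)"
    and bnd: "\<And>t. t \<in> {0<..T} \<Longrightarrow> \<exists>B. AE x in torus. cmod (u t x) \<le> B"
    and semi: "\<And>t. t \<in> {0<..T} \<Longrightarrow> H1_seminorm (u t) \<le> K"
    and K: "K > 0" and N: "N \<ge> 2" and m: "real (Suc m) * tau \<le> T"
  shows "L2_norm (\<lambda>x. u (real (Suc m) * tau) x - lie_trotter lam tau N u0 (Suc m) x)
    \<le> error_const CARD('n) lam T * ln (real N) * (sqrt tau + 1 / real N) * K"
proof -
  define \<Theta> where "\<Theta> = 1 + sqrt (2 * T)"
  define t where "t = real (Suc m) * tau"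
  define l where "l = ln (real N)"
  define \<delta> where "\<delta> = sqrt tau + 1 / real N"
  define E where "E = rate_const CARD('n) \<Theta> N tau * (exp (2 * \<bar>lam\<bar> * T) * K)"
  let ?P = "trig_poly N (fourier (u t)) :: real ^ 'n \<Rightarrow> complex"
  let ?S = "lie_trotter lam tau N u0 (Suc m) :: real ^ 'n \<Rightarrow> complex"
  have t: "t \<in> {0<..T}" using m tau by (simp add: t_def)
  have l: "1 \<le> 2 * l" unfolding l_def by (rule one_le_2_ln[OF N])
  have \<delta>: "\<delta> \<ge> 0" using tau by (simp add: \<delta>_def)
  have K0: "K \<ge> 0" using K by simp
  have \<Theta>: "\<Theta> \<ge> 1" "\<Theta> \<ge> sqrt (2 * T)" using T by (simp_all add: \<Theta>_def)
  have C: "pairing_const CARD('n) \<Theta> > 0" using \<Theta> by (intro pairing_const_pos) auto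
  have E: "E \<ge> 0" unfolding E_def rate_const_def using C N tau K by auto
  have H1: "H1_sum F (fourier (u s)) \<le> K\<^sup>2"
    if "s \<in> {0<..T}" "finite F" for s F
  proof -
    have "H1_seminorm (u s) \<ge> 0"
      unfolding H1_seminorm_def by (intro mult_nonneg_nonneg real_sqrt_ge_zero infsum_nonneg) auto
    then have "(H1_seminorm (u s))\<^sup>2 \<le> K\<^sup>2" by (intro power_mono semi that)
    then show ?thesis using H1_sum_le_seminorm[OF reg[OF that(1)] that(2)] by linarith
  qed
  obtain B where B: "AE x in torus. cmod (u t x) \<le> B" using bnd[OF t] by blast
  have sq: "square_integrable (u t)" by (rule solution_square_integrable[OF sol]) (use t in auto)
  have proj: "L2_norm (\<lambda>x. u t x - ?P x) \<le> 2 * l * \<delta> * K"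
  proof -
    have "L2_norm (\<lambda>x. u t x - ?P x) \<le> K / (real N + 1)"
      by (rule L2_norm_diff_projection_le[OF square_integrableD(1)[OF sq] B H1[OF t] K0])
    also have "\<dots> \<le> K / real N" using K N by (intro divide_left_mono) auto
    also have "\<dots> = 1 / real N * K" by simp
    also have "\<dots> \<le> \<delta> * K" using tau K by (intro mult_right_mono) (auto simp: \<delta>_def)
    also have "\<dots> \<le> 2 * l * (\<delta> * K)" using mult_right_mono[OF l, of "\<delta> * K"] \<delta> K by simp
    finally show ?thesis by (simp only: mult.assoc)
  qed
  have scheme: "L2_norm (\<lambda>x. ?P x - ?S x) \<le> sqrt (exp (5 * \<bar>lam\<bar> * T) * (\<bar>lam\<bar> * T)) * E"
  proof (rule power2_le_imp_le)
    have "(\<lambda>x. ?P x - ?S x) = trig_poly N (\<lambda>k. fourier (u t) k - scheme_coeff lam tau N u0 (Suc m) k)"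
      unfolding lie_trotter_eq_trig_poly trig_poly_diff ..
    then have "(L2_norm (\<lambda>x. ?P x - ?S x))\<^sup>2 \<le> exp (5 * \<bar>lam\<bar> * t) * (\<bar>lam\<bar> * E\<^sup>2 * t)"
      using scheme_energy_le[OF sol u0 T tau bnd H1 K N \<Theta> m] unfolding t_def E_def by simp
    also have "\<dots> \<le> exp (5 * \<bar>lam\<bar> * T) * (\<bar>lam\<bar> * E\<^sup>2 * T)"
      using t by (intro mult_mono) (auto intro!: mult_left_mono)
    also have "\<dots> = (exp (5 * \<bar>lam\<bar> * T) * (\<bar>lam\<bar> * T)) * E\<^sup>2" by simp
    also have "\<dots> = (sqrt (exp (5 * \<bar>lam\<bar> * T) * (\<bar>lam\<bar> * T)) * E)\<^sup>2"
      using T by (simp add: power_mult_distrib)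
    finally show "(L2_norm (\<lambda>x. ?P x - ?S x))\<^sup>2 \<le> (sqrt (exp (5 * \<bar>lam\<bar> * T) * (\<bar>lam\<bar> * T)) * E)\<^sup>2" .
    show "0 \<le> sqrt (exp (5 * \<bar>lam\<bar> * T) * (\<bar>lam\<bar> * T)) * E" using E T by simp
  qed
  have sqS: "square_integrable ?S" unfolding lie_trotter_eq_trig_poly by simp
  have "L2_norm (\<lambda>x. u t x - ?S x) \<le> L2_norm (\<lambda>x. u t x - ?P x) + L2_norm (\<lambda>x. ?P x - ?S x)"
    using L2_norm_triangle[OF square_integrable_diff[OF sq square_integrable_trig_poly]
        square_integrable_diff[OF square_integrable_trig_poly sqS], of N "fourier (u t)" N "fourier (u t)"]
    by simp
  also have "\<dots> \<le> 2 * l * \<delta> * K + sqrt (exp (5 * \<bar>lam\<bar> * T) * (\<bar>lam\<bar> * T)) * E"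
    by (rule add_mono[OF proj scheme])
  also have "\<dots> = error_const CARD('n) lam T * l * \<delta> * K"
    by (simp add: error_const_def E_def rate_const_def \<Theta>_def l_def \<delta>_def algebra_simps)
  finally show ?thesis by (simp only: t_def l_def \<delta>_def)
qed

lemma AE_bounded_of_Linf_norm:
  assumes "Linf_norm f < \<infinity>"
  shows "\<exists>B. AE x in torus. cmod (f x) \<le> B"
proof -
  define B where "B = real_of_ereal (max 0 (Linf_norm f))"
  have "max 0 (Linf_norm f) = ereal B"
    unfolding B_def using assms by (intro ereal_real'[symmetric]) (auto simp: max_def)
  then have le: "Linf_norm f \<le> ereal B" by (metis max.cobounded2)
  have "AE x in torus. ereal (cmod (f x)) \<le> Linf_norm f"
    unfolding Linf_norm_def by (rule esssup_AE)
  then have "AE x in torus. cmod (f x) \<le> B"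
    by eventually_elim (use le order_trans in fastforce)
  then show ?thesis by blast
qed

lemma Linf_norm_nonneg: "Linf_norm (f :: real ^ 'n \<Rightarrow> complex) \<ge> 0"
proof -
  have "measure (torus :: (real ^ 'n) measure) (space torus) > 0"
    by (simp add: measure_restrict_space torus_cell_sets measure_torus_cell)
  then have "emeasure (torus :: (real ^ 'n) measure) (space torus) \<noteq> 0"
    by (auto simp: measure_def)
  then have "0 = esssup (torus :: (real ^ 'n) measure) (\<lambda>x. 0 :: ereal)"
    by (rule esssup_const[symmetric])
  also have "\<dots> \<le> Linf_norm f" unfolding Linf_norm_def by (rule esssup_mono) auto
  finally show ?thesis .
qed

lemma log_factor_nonneg:
  fixes u :: "real \<Rightarrow> real ^ 'n \<Rightarrow> complex"
  assumes "T > 0"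
  shows "log_factor T u0 u \<ge> 0"
proof -
  have "0 \<le> Linf_norm (u T)" by (rule Linf_norm_nonneg)
  also have "\<dots> \<le> C_Linf_norm T u" unfolding C_Linf_norm_def using assms by (intro SUP_upper) auto
  finally have pos: "0 \<le> C_Linf_norm T u" .
  have "0 \<le> ln_ereal (C_Linf_norm T u + 1)"
    using pos by (cases "C_Linf_norm T u") (auto simp: ln_ereal_def one_ereal_def)
  then show ?thesis by (simp add: log_factor_def)
qed

theorem theorem4p1:
  fixes lam T :: real
  assumes "lam \<noteq> 0" and "T > 0"
  shows "\<exists>C>0. \<forall>(u0 :: real ^ 'n \<Rightarrow> complex) (u :: real \<Rightarrow> real ^ 'n \<Rightarrow> complex) (tau :: real) (N :: nat).
    in_L2 u0 \<longrightarrow> log_schroedinger_solution lam T u0 u \<longrightarrow> regular_solution T u \<longrightarrow>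
    tau > 0 \<longrightarrow> N \<ge> 2 \<longrightarrow>
    (\<forall>m < nat \<lfloor>T / tau\<rfloor>.
      ereal (L2_norm (\<lambda>x. u (real (m + 1) * tau) x - lie_trotter lam tau N u0 (m + 1) x))
        \<le> ereal (C * exp (2 * \<bar>lam\<bar> * T)) * (log_factor T u0 u + ereal (ln (real N)))
          * ereal (sqrt tau + 1 / real N) * C_H1_seminorm T u)"
proof (intro exI[of _ "error_const CARD('n) lam T"] conjI allI impI)
  show Cpos: "error_const CARD('n) lam T > 0" by (rule error_const_pos[OF assms(2)])
  fix u0 :: "real ^ 'n \<Rightarrow> complex" and u :: "real \<Rightarrow> real ^ 'n \<Rightarrow> complex" and tau :: real and N m :: nat
  assume u0: "in_L2 u0" and sol: "log_schroedinger_solution lam T u0 u" and reg: "regular_solution T u"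
    and tau: "tau > 0" and N: "N \<ge> 2" and m: "m < nat \<lfloor>T / tau\<rfloor>"
  define C where "C = error_const CARD('n) lam T"
  define c where "c = C * ln (real N) * (sqrt tau + 1 / real N)"
  define err where "err = L2_norm (\<lambda>x. u (real (m + 1) * tau) x - lie_trotter lam tau N u0 (m + 1) x)"
  define S where "S = C_H1_seminorm T u"
  have C: "C > 0" using Cpos by (simp add: C_def)
  have lnN: "ln (real N) > 0" using N by simp
  have \<delta>: "sqrt tau + 1 / real N > 0" using tau N by (intro add_pos_pos) auto
  have c: "c > 0" using C lnN \<delta> by (simp add: c_def)
  have "int (Suc m) \<le> \<lfloor>T / tau\<rfloor>" using m by linarith
  then have "real (Suc m) \<le> T / tau" by (simp add: le_floor_iff)
  then have mT: "real (Suc m) * tau \<le> T" using tau by (simp add: pos_le_divide_eq)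
  have in_H1: "in_H1 (u t)" and bnd: "\<exists>B. AE x in torus. cmod (u t x) \<le> B" if "t \<in> {0<..T}" for t
    using reg that AE_bounded_of_Linf_norm[of "u t"] by (auto simp: regular_solution_def)
  have semi: "ereal (H1_seminorm (u t)) \<le> S" if "t \<in> {0<..T}" for t
    unfolding S_def C_H1_seminorm_def using that by (intro SUP_upper)
  have "H1_seminorm (u T) \<ge> 0"
    unfolding H1_seminorm_def by (intro mult_nonneg_nonneg real_sqrt_ge_zero infsum_nonneg) auto
  then have S0: "0 \<le> S" using semi[of T] assms(2) by (metis ereal_less_eq(5) greaterThanAtMost_iff order_refl order_trans)
  have err_le: "ereal err \<le> ereal c * S"
  proof (cases S)
    case (real r)
    \<comment> \<open>The seminorm bound \<open>r\<close> may vanish, hence the detour through \<open>r + e/c\<close>.\<close>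
    have "err \<le> c * r"
    proof (rule field_le_epsilon)
      fix e :: real assume e: "e > 0"
      have r: "r \<ge> 0" using S0 real by simp
      have "H1_seminorm (u t) \<le> r + e / c" if "t \<in> {0<..T}" for t
      proof -
        have "H1_seminorm (u t) \<le> r" using semi[OF that] real by simp
        moreover have "e / c > 0" using e c by simp
        ultimately show ?thesis by linarith
      qed
      moreover have "r + e / c > 0" using r e c by (intro add_nonneg_pos) auto
      ultimately have "err \<le> c * (r + e / c)"
        using splitting_error_le[OF sol u0 assms(2) tau in_H1 bnd _ _ N mT, of "r + e / c"]
        by (simp only: err_def c_def C_def Suc_eq_plus1)
      then show "err \<le> c * r + e" using c by (simp add: distrib_left)
    qed
    then show ?thesis using real by simp
  next
    case PInf
    then show ?thesis using c by simp
  next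
    case MInf
    then show ?thesis using S0 by simp
  qed
  have "1 \<le> exp (2 * \<bar>lam\<bar> * T)" using assms(2) by simp
  then have "ereal C \<le> ereal (C * exp (2 * \<bar>lam\<bar> * T))"
    using mult_left_mono[of 1 "exp (2 * \<bar>lam\<bar> * T)" C] C by simp
  moreover have "ereal (ln (real N)) \<le> log_factor T u0 u + ereal (ln (real N))"
    using add_right_mono[OF log_factor_nonneg[OF assms(2), of u0 u], of "ereal (ln (real N))"] by simp
  ultimately have "ereal C * ereal (ln (real N)) \<le> ereal (C * exp (2 * \<bar>lam\<bar> * T)) * (log_factor T u0 u + ereal (ln (real N)))"
    using C lnN by (intro ereal_mult_mono) auto
  then have "ereal C * ereal (ln (real N)) * ereal (sqrt tau + 1 / real N) * S
      \<le> ereal (C * exp (2 * \<bar>lam\<bar> * T)) * (log_factor T u0 u + ereal (ln (real N))) * ereal (sqrt tau + 1 / real N) * S"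
    using \<delta> S0 by (intro ereal_mult_right_mono) auto
  moreover have "ereal C * ereal (ln (real N)) * ereal (sqrt tau + 1 / real N) = ereal c"
    by (simp add: c_def)
  ultimately show "ereal (L2_norm (\<lambda>x. u (real (m + 1) * tau) x - lie_trotter lam tau N u0 (m + 1) x))
        \<le> ereal (error_const CARD('n) lam T * exp (2 * \<bar>lam\<bar> * T)) * (log_factor T u0 u + ereal (ln (real N)))
          * ereal (sqrt tau + 1 / real N) * C_H1_seminorm T u"
    using err_le unfolding err_def[symmetric] S_def[symmetric] C_def[symmetric] by (metis order_trans)
qed

end
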